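(* Every finitely generated (word-)hyperbolic group and every finitely generated group of polynomial growth has the Révész property. In particular, the free group $\mathbb F_2$ on two generators has the Révész property. Thus the conjecture that $\mathbb F_2$ does not have the Révész property is false, and the conjecture that finitely generated groups of polynomial growth have the Révész property is true.
   Context: For a countable discrete group $\Gamma$, let $\lambda_g\delta_h=\delta_{gh}$ be the left regular representation on $\ell^2(\Gamma)$, $C_r^*(\Gamma)$ the operator-norm closure of $\operatorname{span}\{\lambda_g:g\in\Gamma\}$, $\tau$ the canonical trace ($\tau(\lambda_g)=\mathbf 1_{\{g=e\}}$), and $\widehat f(g)=\tau(\lambda_g^*f)$ for $f\in C_r^*(\Gamma)$. $\Gamma$ has the Révész property if for every $f\in C_r^*(\Gamma)$ there are finite sets $E_1\subset E_2\subset\cdots\subset\Gamma$ with $\bigcup_jE_j=\Gamma$ such that $\sum_{g\in E_j}\widehat f(g)\lambda_g\to f$ in operator norm as $j\to\infty$. A finitely generated group has polynomial growth if its word balls $B_R$ with respect to a finite symmetric generating set satisfy $|B_R|\le C(R+1)^d$ for some constants $C\ge1,d\ge0$ and all $R\ge0$. The groups in the statement may be finite. *)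

theory Defs
  imports "HOL-Analysis.Analysis" "HOL-Algebra.Generated_Groups"
begin

section \<open>Operators on the Hilbert space of a discrete group\<close>

text \<open>
  Vectors are functions on the whole type that vanish off the carrier.  An operator is a
  HOL function on vectors; every notion below evaluates it only at elements of \<open>l2 G\<close>, so that its
  values elsewhere are irrelevant.
\<close>

definition l2 :: "('a, 'b) monoid_scheme \<Rightarrow> ('a \<Rightarrow> complex) set" where
  "l2 G = {\<xi>. (\<lambda>h. (cmod (\<xi> h))\<^sup>2) summable_on carrier G \<and> (\<forall>h. h \<notin> carrier G \<longrightarrow> \<xi> h = 0)}"

definition l2_norm :: "('a, 'b) monoid_scheme \<Rightarrow> ('a \<Rightarrow> complex) \<Rightarrow> real" where
  "l2_norm G \<xi> = sqrt (\<Sum>\<^sub>\<infinity>h\<in>carrier G. (cmod (\<xi> h))\<^sup>2)"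

definition l2_inner :: "('a, 'b) monoid_scheme \<Rightarrow> ('a \<Rightarrow> complex) \<Rightarrow> ('a \<Rightarrow> complex) \<Rightarrow> complex" where
  "l2_inner G \<xi> \<eta> = (\<Sum>\<^sub>\<infinity>h\<in>carrier G. cnj (\<xi> h) * \<eta> h)"

definition delta :: "'a \<Rightarrow> 'a \<Rightarrow> complex" where
  "delta g = (\<lambda>h. if h = g then 1 else 0)"

type_synonym 'a operator = "('a \<Rightarrow> complex) \<Rightarrow> ('a \<Rightarrow> complex)"

definition bounded_op :: "('a, 'b) monoid_scheme \<Rightarrow> 'a operator \<Rightarrow> bool" where
  "bounded_op G T \<longleftrightarrow>
     (\<forall>\<xi>\<in>l2 G. T \<xi> \<in> l2 G) \<and>
     (\<forall>\<xi>\<in>l2 G. \<forall>\<eta>\<in>l2 G. T (\<lambda>h. \<xi> h + \<eta> h) = (\<lambda>h. T \<xi> h + T \<eta> h)) \<and>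
     (\<forall>c. \<forall>\<xi>\<in>l2 G. T (\<lambda>h. c * \<xi> h) = (\<lambda>h. c * T \<xi> h)) \<and>
     (\<exists>K. \<forall>\<xi>\<in>l2 G. l2_norm G (T \<xi>) \<le> K * l2_norm G \<xi>)"

definition op_norm :: "('a, 'b) monoid_scheme \<Rightarrow> 'a operator \<Rightarrow> real" where
  "op_norm G T = (SUP \<xi>\<in>{\<xi> \<in> l2 G. l2_norm G \<xi> \<le> 1}. l2_norm G (T \<xi>))"

definition op_diff :: "'a operator \<Rightarrow> 'a operator \<Rightarrow> 'a operator" where
  "op_diff S T = (\<lambda>\<xi> h. S \<xi> h - T \<xi> h)"


section \<open>The reduced group C*-algebra\<close>

definition left_reg :: "('a, 'b) monoid_scheme \<Rightarrow> 'a \<Rightarrow> 'a operator" where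
  "left_reg G g = (\<lambda>\<xi> h. if h \<in> carrier G then \<xi> (inv\<^bsub>G\<^esub> g \<otimes>\<^bsub>G\<^esub> h) else 0)"

lemma left_reg_delta:
  assumes "group G" "g \<in> carrier G" "h \<in> carrier G"
  shows "left_reg G g (delta h) = delta (g \<otimes>\<^bsub>G\<^esub> h)"
proof -
  interpret group G by fact
  have "inv\<^bsub>G\<^esub> g \<otimes>\<^bsub>G\<^esub> x = h \<longleftrightarrow> x = g \<otimes>\<^bsub>G\<^esub> h" if "x \<in> carrier G" for x
    using that assms by (metis inv_solve_left)
  then show ?thesis
    using assms by (auto simp: left_reg_def delta_def fun_eq_iff)
qed

definition lin_comb :: "('a, 'b) monoid_scheme \<Rightarrow> 'a set \<Rightarrow> ('a \<Rightarrow> complex) \<Rightarrow> 'a operator" where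
  "lin_comb G E c = (\<lambda>\<xi> h. \<Sum>g\<in>E. c g * left_reg G g \<xi> h)"

definition left_reg_span :: "('a, 'b) monoid_scheme \<Rightarrow> 'a operator set" where
  "left_reg_span G = {lin_comb G E c | E c. finite E \<and> E \<subseteq> carrier G}"

definition reduced_C_star :: "('a, 'b) monoid_scheme \<Rightarrow> 'a operator set" where
  "reduced_C_star G =
     {T. bounded_op G T \<and> (\<forall>\<epsilon>>0. \<exists>S\<in>left_reg_span G. op_norm G (op_diff T S) < \<epsilon>)}"

definition canonical_trace :: "('a, 'b) monoid_scheme \<Rightarrow> 'a operator \<Rightarrow> complex" where
  "canonical_trace G T = l2_inner G (delta \<one>\<^bsub>G\<^esub>) (T (delta \<one>\<^bsub>G\<^esub>))"

lemma canonical_trace_left_reg: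
  assumes "group G" "g \<in> carrier G"
  shows "canonical_trace G (left_reg G g) = (if g = \<one>\<^bsub>G\<^esub> then 1 else 0)"
proof -
  interpret group G by fact
  have "canonical_trace G (left_reg G g) =
          (\<Sum>\<^sub>\<infinity>h\<in>carrier G. cnj (delta \<one>\<^bsub>G\<^esub> h) * delta g h)"
    using assms by (simp add: canonical_trace_def l2_inner_def left_reg_delta)
  also have "\<dots> = (\<Sum>\<^sub>\<infinity>h\<in>{\<one>\<^bsub>G\<^esub>}. cnj (delta \<one>\<^bsub>G\<^esub> h) * delta g h)"
    by (rule infsum_cong_neutral) (auto simp: delta_def)
  finally show ?thesis
    by (auto simp: delta_def)
qed

text \<open>The adjoint of \<open>left_reg G g\<close> is \<open>left_reg G (inv g)\<close>.\<close>

lemma left_reg_adjoint: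
  assumes "group G" "g \<in> carrier G"
  shows "l2_inner G (left_reg G g \<xi>) \<eta> = l2_inner G \<xi> (left_reg G (inv\<^bsub>G\<^esub> g) \<eta>)"
proof -
  interpret group G by fact
  have bij: "bij_betw (\<lambda>h. g \<otimes>\<^bsub>G\<^esub> h) (carrier G) (carrier G)"
    using assms(2) by (intro bij_betwI[where g = "\<lambda>h. inv\<^bsub>G\<^esub> g \<otimes>\<^bsub>G\<^esub> h"])
      (auto simp flip: m_assoc)
  have "l2_inner G (left_reg G g \<xi>) \<eta> =
          (\<Sum>\<^sub>\<infinity>h\<in>carrier G. cnj (left_reg G g \<xi> (g \<otimes>\<^bsub>G\<^esub> h)) * \<eta> (g \<otimes>\<^bsub>G\<^esub> h))"
    unfolding l2_inner_def
    using infsum_reindex_bij_betw[OF bij, of "\<lambda>h. cnj (left_reg G g \<xi> h) * \<eta> h"] by simp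
  also have "\<dots> = l2_inner G \<xi> (left_reg G (inv\<^bsub>G\<^esub> g) \<eta>)"
    unfolding l2_inner_def
    by (rule infsum_cong) (use assms(2) in \<open>simp add: left_reg_def flip: m_assoc\<close>)
  finally show ?thesis .
qed

definition fourier_coeff :: "('a, 'b) monoid_scheme \<Rightarrow> 'a operator \<Rightarrow> 'a \<Rightarrow> complex" where
  "fourier_coeff G T g = canonical_trace G (left_reg G (inv\<^bsub>G\<^esub> g) \<circ> T)"

text \<open>The inclusions are not required to be strict, since the group may be finite.\<close>

definition revesz_property :: "('a, 'b) monoid_scheme \<Rightarrow> bool" where
  "revesz_property G \<longleftrightarrow>
     (\<forall>T\<in>reduced_C_star G. \<exists>E :: nat \<Rightarrow> 'a set.
        (\<forall>j. finite (E j) \<and> E j \<subseteq> E (Suc j)) \<and>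
        (\<Union>j. E j) = carrier G \<and>
        (\<lambda>j. op_norm G (op_diff (lin_comb G (E j) (fourier_coeff G T)) T)) \<longlonglongrightarrow> 0)"


section \<open>Growth and hyperbolicity\<close>

definition finitely_generated :: "('a, 'b) monoid_scheme \<Rightarrow> bool" where
  "finitely_generated G \<longleftrightarrow> (\<exists>S. finite S \<and> S \<subseteq> carrier G \<and> generate G S = carrier G)"

definition symmetric_generating_set :: "('a, 'b) monoid_scheme \<Rightarrow> 'a set \<Rightarrow> bool" where
  "symmetric_generating_set G S \<longleftrightarrow>
     S \<subseteq> carrier G \<and> (\<forall>s\<in>S. inv\<^bsub>G\<^esub> s \<in> S) \<and> generate G S = carrier G"

definition word_ball :: "('a, 'b) monoid_scheme \<Rightarrow> 'a set \<Rightarrow> nat \<Rightarrow> 'a set" where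
  "word_ball G S R = {foldr (\<otimes>\<^bsub>G\<^esub>) ws \<one>\<^bsub>G\<^esub> | ws. set ws \<subseteq> S \<and> length ws \<le> R}"

definition polynomial_growth :: "('a, 'b) monoid_scheme \<Rightarrow> bool" where
  "polynomial_growth G \<longleftrightarrow>
     (\<exists>S. finite S \<and> symmetric_generating_set G S \<and>
        (\<exists>C d :: real. C \<ge> 1 \<and> d \<ge> 0 \<and>
           (\<forall>R. real (card (word_ball G S R)) \<le> C * (real R + 1) powr d)))"

definition word_length :: "('a, 'b) monoid_scheme \<Rightarrow> 'a set \<Rightarrow> 'a \<Rightarrow> nat" where
  "word_length G S g = (LEAST n. g \<in> word_ball G S n)"

definition word_dist :: "('a, 'b) monoid_scheme \<Rightarrow> 'a set \<Rightarrow> 'a \<Rightarrow> 'a \<Rightarrow> real" where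
  "word_dist G S x y = real (word_length G S (inv\<^bsub>G\<^esub> x \<otimes>\<^bsub>G\<^esub> y))"

definition gromov_product :: "('a, 'b) monoid_scheme \<Rightarrow> 'a set \<Rightarrow> 'a \<Rightarrow> 'a \<Rightarrow> 'a \<Rightarrow> real" where
  "gromov_product G S w x y =
     (word_dist G S x w + word_dist G S y w - word_dist G S x y) / 2"

text \<open>Gromov's definition, for the word metric of some finite symmetric generating set.\<close>

definition hyperbolic_group :: "('a, 'b) monoid_scheme \<Rightarrow> bool" where
  "hyperbolic_group G \<longleftrightarrow>
     (\<exists>S. finite S \<and> symmetric_generating_set G S \<and>
        (\<exists>\<delta>\<ge>0. \<forall>w\<in>carrier G. \<forall>x\<in>carrier G. \<forall>y\<in>carrier G. \<forall>z\<in>carrier G.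
           gromov_product G S w x z
             \<ge> min (gromov_product G S w x y) (gromov_product G S w y z) - \<delta>))"


section \<open>Free groups\<close>

text \<open>
  The letter \<open>(x, True)\<close> stands for the generator \<open>x\<close> and \<open>(x, False)\<close> for its inverse.  The elements
  of the free group are the reduced words, multiplied by concatenation followed by cancellation.
\<close>

definition inv_letter :: "'x \<times> bool \<Rightarrow> 'x \<times> bool" where
  "inv_letter l = (fst l, \<not> snd l)"

fun reduced_word :: "('x \<times> bool) list \<Rightarrow> bool" where
  "reduced_word (l # m # w) \<longleftrightarrow> m \<noteq> inv_letter l \<and> reduced_word (m # w)"
| "reduced_word _ \<longleftrightarrow> True"

fun cancel_cons :: "'x \<times> bool \<Rightarrow> ('x \<times> bool) list \<Rightarrow> ('x \<times> bool) list" where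
  "cancel_cons l [] = [l]"
| "cancel_cons l (m # w) = (if m = inv_letter l then w else l # m # w)"

definition free_group :: "('x \<times> bool) list monoid" where
  "free_group = \<lparr>carrier = {w. reduced_word w}, mult = foldr cancel_cons, one = []\<rparr>"

abbreviation F2 :: "(bool \<times> bool) list monoid" where
  "F2 \<equiv> free_group"

lemma inv_letter_inv [simp]: "inv_letter (inv_letter l) = l"
  by (simp add: inv_letter_def)

lemma reduced_word_tl: "reduced_word (l # w) \<Longrightarrow> reduced_word w"
  by (cases w) auto

lemma reduced_cancel_cons: "reduced_word w \<Longrightarrow> reduced_word (cancel_cons l w)"
  by (cases w) (auto dest: reduced_word_tl)

lemma cancel_cons_inv:
  "reduced_word w \<Longrightarrow> cancel_cons l (cancel_cons (inv_letter l) w) = w"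
  by (cases w rule: reduced_word.cases) auto

lemma reduced_foldr_cancel: "reduced_word v \<Longrightarrow> reduced_word (foldr cancel_cons u v)"
  by (induction u) (auto intro: reduced_cancel_cons)

lemma foldr_cancel_cons:
  assumes "reduced_word w"
  shows "foldr cancel_cons (cancel_cons l v) w = cancel_cons l (foldr cancel_cons v w)"
  using cancel_cons_inv[OF reduced_foldr_cancel[OF assms]] by (cases v) auto

lemma foldr_cancel_assoc:
  assumes "reduced_word w"
  shows "foldr cancel_cons (foldr cancel_cons u v) w =
           foldr cancel_cons u (foldr cancel_cons v w)"
  by (induction u) (simp_all add: foldr_cancel_cons[OF assms])

lemma foldr_cancel_Nil: "reduced_word w \<Longrightarrow> foldr cancel_cons w [] = w"
  by (induction w rule: reduced_word.induct) auto

lemma foldr_cancel_inverse: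
  "reduced_word v \<Longrightarrow> foldr cancel_cons (rev (map inv_letter w)) (foldr cancel_cons w v) = v"
proof (induction w)
  case (Cons l w)
  then show ?case
    using cancel_cons_inv[OF reduced_foldr_cancel[of v w], of "inv_letter l"] by simp
qed simp

lemma group_free_group: "group (free_group :: ('x \<times> bool) list monoid)"
proof (rule groupI)
  fix w :: "('x \<times> bool) list"
  assume w: "w \<in> carrier free_group"
  let ?v = "foldr cancel_cons (rev (map inv_letter w)) []"
  have "foldr cancel_cons ?v w = foldr cancel_cons (rev (map inv_letter w)) w"
    using w by (simp add: foldr_cancel_assoc free_group_def)
  also have "\<dots> = []"
    using foldr_cancel_inverse[of "[]" w] w by (simp add: foldr_cancel_Nil free_group_def)
  finally show "\<exists>v\<in>carrier free_group. v \<otimes>\<^bsub>free_group\<^esub> w = \<one>\<^bsub>free_group\<^esub>"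
    using reduced_foldr_cancel[of "[]"]
    by (intro bexI[of _ ?v]) (auto simp: free_group_def)
qed (auto simp: free_group_def reduced_foldr_cancel foldr_cancel_assoc)

end

theory Submission imports Defs begin

text \<open>
  Let \<open>f\<close> be in the reduced C*-algebra.  Suppose that there are multipliers \<open>V\<^sub>i\<close> with values in \<open>[0, 1]\<close>,
  uniformly bounded on convolution operators, equal to one on the ball of radius \<open>2\<^sup>i\<close> and vanishing
  outside the ball of radius \<open>2\<^sup>i\<^sup>+\<^sup>2\<close>; then \<open>V\<^sub>i f\<close> converges to \<open>f\<close>.  On the shell between the two balls, \<open>V\<^sub>i\<close> is
  rounded to zero or one, one binary digit at a time, with random signs.  A random sum of
  translations with coefficients \<open>a\<close> has even moments bounded by those of the scalar random sum with
  coefficients \<open>|a|\<close>, and rapid decay compares the operator norm with the moment of order about \<open>i\<close>; so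
  rounding costs \<open>O(\<surd>i)\<close> times the l2-norm of the coefficients of \<open>f\<close> on the shell.  The energies of the
  shells have a finite sum while \<open>\<Sum>1/i\<close> diverges, hence this cost tends to zero along a subsequence.

  For polynomial growth the multipliers are matrix coefficients of the regular representation at
  indicators of balls, at doubling scales.  In a hyperbolic group they are averages of indicators of
  balls: the relation \<open>d(x, y) \<le> n\<close> holds exactly if two bounded sets of points, one depending on \<open>x\<close> and
  one on \<open>y\<close>, meet, and inclusion-exclusion turns this into an inner product of vectors of bounded
  length (as in Ozawa's proof of weak amenability).
\<close>

section \<open>Bounds for convolution kernels\<close>

text \<open>The partial sums to be produced multiply each coefficient by \<open>0\<close> or
  \<open>1\<close>, and such a sharp cutoff to a ball need not be bounded uniformly in operator
  norm, whereas the smoothed cutoffs are. The proof is about the price of making a smoothed cutoff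
  sharp. That price is small because rapid decay loses only a power of the radius: at radius about
  \<open>2 ^ i\<close>, the root of order \<open>p\<close> of this loss is bounded by a constant as
  soon as \<open>p\<close> is at least \<open>i\<close>, and a moment of order \<open>2 * p\<close>
  of a random sum costs only \<open>sqrt p\<close>. Operator norms are reached through the
  C*-identity, applied \<open>k\<close> times, so the moments that occur have
  \<open>p = 2 ^ k\<close>. Norms are handled as bounds for finite bilinear forms in a kernel
  \<open>c (inv x \<otimes> y)\<close>. Hence the estimates involve only finite sums, pass to
  pointwise limits of kernels, and apply also to coefficient families that are not finitely
  supported; operators on \<open>l2 G\<close> are needed only at the two ends of the
  argument.\<close>

definition (in group) conv_bound :: "('a \<Rightarrow> complex) \<Rightarrow> real \<Rightarrow> bool" where
  "conv_bound c K \<longleftrightarrow> (\<forall>X Y \<eta> \<xi>. finite X \<and> X \<subseteq> carrier G \<and> finite Y \<and> Y \<subseteq> carrier G \<longrightarrow>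
     cmod (\<Sum>x\<in>X. \<Sum>y\<in>Y. \<eta> x * c (inv x \<otimes> y) * \<xi> y)
       \<le> K * (L2_set (\<lambda>x. cmod (\<eta> x)) X * L2_set (\<lambda>y. cmod (\<xi> y)) Y))"

lemma L2_set_power2: "(L2_set f A)\<^sup>2 = (\<Sum>i\<in>A. (f i)\<^sup>2)"
  by (simp add: L2_set_def sum_nonneg)

lemma L2_set_subset_mono: "finite B \<Longrightarrow> A \<subseteq> B \<Longrightarrow> L2_set f A \<le> L2_set f B"
  by (auto simp: L2_set_def intro!: sum_mono2)

lemma L2_set_reindex: "inj_on h A \<Longrightarrow> L2_set f (h ` A) = L2_set (\<lambda>x. f (h x)) A"
  by (simp add: L2_set_def sum.reindex)

lemma norm_sum_mult_le_L2_set: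
  fixes f g :: "'a \<Rightarrow> complex"
  shows "cmod (\<Sum>i\<in>A. f i * g i) \<le> L2_set (\<lambda>i. cmod (f i)) A * L2_set (\<lambda>i. cmod (g i)) A"
proof -
  have "cmod (\<Sum>i\<in>A. f i * g i) \<le> (\<Sum>i\<in>A. \<bar>cmod (f i)\<bar> * \<bar>cmod (g i)\<bar>)"
    by (rule order_trans[OF norm_sum]) (simp add: norm_mult)
  also note L2_set_mult_ineq
  finally show ?thesis .
qed

lemma of_real_L2_set_power2:
  "complex_of_real ((L2_set (\<lambda>i. cmod (f i)) A)\<^sup>2) = (\<Sum>i\<in>A. cnj (f i) * f i)"
  by (simp only: L2_set_power2 of_real_sum complex_norm_square mult.commute)

text \<open>Double counting with bounded overlap: the square at \<open>x\<close> occurs once for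
  every \<open>w\<close> related to \<open>x\<close>.\<close>

lemma sum_L2_set_power2_le:
  assumes fin: "finite X" "finite W" and bd: "\<And>x. x \<in> X \<Longrightarrow> card {w \<in> W. R w x} \<le> C"
  shows "(\<Sum>w\<in>W. (L2_set f {x \<in> X. R w x})\<^sup>2) \<le> real C * (L2_set f X)\<^sup>2"
proof -
  have "(\<Sum>w\<in>W. (L2_set f {x \<in> X. R w x})\<^sup>2) = (\<Sum>w\<in>W. \<Sum>x\<in>X. if R w x then (f x)\<^sup>2 else 0)"
    using fin by (simp add: L2_set_power2 sum.inter_filter)
  also have "\<dots> = (\<Sum>x\<in>X. \<Sum>w\<in>W. if R w x then (f x)\<^sup>2 else 0)"
    by (rule sum.swap)
  also have "\<dots> = (\<Sum>x\<in>X. real (card {w \<in> W. R w x}) * (f x)\<^sup>2)"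
    using fin by (simp flip: sum.inter_filter)
  also have "\<dots> \<le> (\<Sum>x\<in>X. real C * (f x)\<^sup>2)"
    using bd by (intro sum_mono mult_right_mono) auto
  finally show ?thesis
    by (simp add: L2_set_power2 sum_distrib_left)
qed

context group
begin

lemma inj_on_left_mult: "u \<in> carrier G \<Longrightarrow> X \<subseteq> carrier G \<Longrightarrow> inj_on (\<lambda>x. u \<otimes> x) X"
  using inj_on_cmult inj_on_subset by blast

lemma inj_on_inv: "X \<subseteq> carrier G \<Longrightarrow> inj_on (\<lambda>x. inv x) X"
  by (rule inj_on_inverseI[where g = "\<lambda>x. inv x"]) auto

lemma conv_boundI:
  assumes "\<And>X Y \<eta> \<xi>. \<lbrakk>finite X; X \<subseteq> carrier G; finite Y; Y \<subseteq> carrier G\<rbrakk> \<Longrightarrow>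
    cmod (\<Sum>x\<in>X. \<Sum>y\<in>Y. \<eta> x * c (inv x \<otimes> y) * \<xi> y)
       \<le> K * (L2_set (\<lambda>x. cmod (\<eta> x)) X * L2_set (\<lambda>y. cmod (\<xi> y)) Y)"
  shows "conv_bound c K"
  using assms by (simp add: conv_bound_def)

lemma conv_boundD:
  assumes "conv_bound c K" "finite X" "X \<subseteq> carrier G" "finite Y" "Y \<subseteq> carrier G"
  shows "cmod (\<Sum>x\<in>X. \<Sum>y\<in>Y. \<eta> x * c (inv x \<otimes> y) * \<xi> y)
       \<le> K * (L2_set (\<lambda>x. cmod (\<eta> x)) X * L2_set (\<lambda>y. cmod (\<xi> y)) Y)"
  using assms by (simp add: conv_bound_def)

lemma conv_bound_nonneg: "conv_bound c K \<Longrightarrow> 0 \<le> K"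
  using conv_boundD[of c K "{\<one>}" "{\<one>}" "\<lambda>_. 1" "\<lambda>_. 1"] norm_ge_zero[of "c \<one>"]
  by (simp del: norm_ge_zero)

lemma conv_bound_mono: "conv_bound c K \<Longrightarrow> K \<le> K' \<Longrightarrow> conv_bound c K'"
  unfolding conv_bound_def
  by (meson L2_set_nonneg mult_nonneg_nonneg mult_right_mono order_trans)

lemma conv_bound_cong:
  assumes "\<And>g. g \<in> carrier G \<Longrightarrow> c g = c' g"
  shows "conv_bound c K \<longleftrightarrow> conv_bound c' K"
proof -
  have "(\<Sum>x\<in>X. \<Sum>y\<in>Y. \<eta> x * c (inv x \<otimes> y) * \<xi> y) = (\<Sum>x\<in>X. \<Sum>y\<in>Y. \<eta> x * c' (inv x \<otimes> y) * \<xi> y)"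
    if "X \<subseteq> carrier G" "Y \<subseteq> carrier G" for X Y \<eta> \<xi>
    using that by (intro sum.cong refl) (auto simp: assms subset_iff)
  then show ?thesis
    by (simp add: conv_bound_def cong: conj_cong)
qed

lemma conv_bound_add:
  assumes "conv_bound c K" "conv_bound c' K'"
  shows "conv_bound (\<lambda>g. c g + c' g) (K + K')"
proof (rule conv_boundI)
  fix X Y \<eta> \<xi>
  assume XY: "finite X" "X \<subseteq> carrier G" "finite Y" "Y \<subseteq> carrier G"
  have "(\<Sum>x\<in>X. \<Sum>y\<in>Y. \<eta> x * (c (inv x \<otimes> y) + c' (inv x \<otimes> y)) * \<xi> y)
     = (\<Sum>x\<in>X. \<Sum>y\<in>Y. \<eta> x * c (inv x \<otimes> y) * \<xi> y) + (\<Sum>x\<in>X. \<Sum>y\<in>Y. \<eta> x * c' (inv x \<otimes> y) * \<xi> y)"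
    by (simp add: sum.distrib algebra_simps)
  then show "cmod (\<Sum>x\<in>X. \<Sum>y\<in>Y. \<eta> x * (c (inv x \<otimes> y) + c' (inv x \<otimes> y)) * \<xi> y)
       \<le> (K + K') * (L2_set (\<lambda>x. cmod (\<eta> x)) X * L2_set (\<lambda>y. cmod (\<xi> y)) Y)"
    using norm_triangle_mono[OF conv_boundD[OF assms(1) XY, of \<eta> \<xi>] conv_boundD[OF assms(2) XY, of \<eta> \<xi>]]
    by (simp add: distrib_right)
qed

lemma conv_bound_scale:
  assumes "conv_bound c K"
  shows "conv_bound (\<lambda>g. a * c g) (cmod a * K)"
proof (rule conv_boundI)
  fix X Y \<eta> \<xi>
  assume XY: "finite X" "X \<subseteq> carrier G" "finite Y" "Y \<subseteq> carrier G"
  have "(\<Sum>x\<in>X. \<Sum>y\<in>Y. \<eta> x * (a * c (inv x \<otimes> y)) * \<xi> y)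
     = a * (\<Sum>x\<in>X. \<Sum>y\<in>Y. \<eta> x * c (inv x \<otimes> y) * \<xi> y)"
    by (simp add: sum_distrib_left mult_ac)
  then show "cmod (\<Sum>x\<in>X. \<Sum>y\<in>Y. \<eta> x * (a * c (inv x \<otimes> y)) * \<xi> y)
       \<le> cmod a * K * (L2_set (\<lambda>x. cmod (\<eta> x)) X * L2_set (\<lambda>y. cmod (\<xi> y)) Y)"
    using mult_left_mono[OF conv_boundD[OF assms XY, of \<eta> \<xi>] norm_ge_zero[of a]]
    by (simp add: norm_mult mult_ac)
qed

lemma conv_bound_zero: "conv_bound (\<lambda>_. 0) 0"
  by (rule conv_boundI) simp

lemma conv_bound_sum:
  assumes "finite I" "\<And>i. i \<in> I \<Longrightarrow> conv_bound (c i) (K i)"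
  shows "conv_bound (\<lambda>g. \<Sum>i\<in>I. c i g) (\<Sum>i\<in>I. K i)"
  using assms by (induction I rule: finite_induct) (auto intro: conv_bound_add conv_bound_zero)

text \<open>The kernel pairs \<open>x\<close> with the one point \<open>x \<otimes> u\<close>, so
  the form is an inner product of \<open>\<eta>\<close> with a right translate of
  \<open>\<xi>\<close>.\<close>

lemma conv_bound_single:
  assumes "u \<in> carrier G"
  shows "conv_bound (\<lambda>g. if g = u then a else 0) (cmod a)"
proof (rule conv_boundI)
  fix X Y \<eta> \<xi>
  assume XY: "finite X" "X \<subseteq> carrier G" "finite Y" "Y \<subseteq> carrier G"
  let ?X = "{x \<in> X. x \<otimes> u \<in> Y}"
  have eq: "inv x \<otimes> y = u \<longleftrightarrow> y = x \<otimes> u" if "x \<in> X" "y \<in> Y" for x y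
    using that XY assms by (metis inv_solve_left subsetD)
  have inj: "inj_on (\<lambda>x. x \<otimes> u) ?X"
    using XY by (intro inj_on_subset[OF inj_on_multc[OF assms]]) auto
  have "(\<Sum>x\<in>X. \<Sum>y\<in>Y. \<eta> x * (if inv x \<otimes> y = u then a else 0) * \<xi> y)
      = (\<Sum>x\<in>X. \<Sum>y\<in>Y. if y = x \<otimes> u then a * \<eta> x * \<xi> (x \<otimes> u) else 0)"
    by (intro sum.cong refl) (auto simp: eq)
  also have "\<dots> = (\<Sum>x\<in>X. if x \<otimes> u \<in> Y then a * \<eta> x * \<xi> (x \<otimes> u) else 0)"
    using XY by simp
  also have "\<dots> = a * (\<Sum>x\<in>?X. \<eta> x * \<xi> (x \<otimes> u))"
    using XY by (auto simp: sum.inter_filter sum_distrib_left mult_ac intro!: sum.cong)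
  finally have "cmod (\<Sum>x\<in>X. \<Sum>y\<in>Y. \<eta> x * (if inv x \<otimes> y = u then a else 0) * \<xi> y)
     = cmod a * cmod (\<Sum>x\<in>?X. \<eta> x * \<xi> (x \<otimes> u))"
    by (simp add: norm_mult)
  also have "cmod (\<Sum>x\<in>?X. \<eta> x * \<xi> (x \<otimes> u))
      \<le> L2_set (\<lambda>x. cmod (\<eta> x)) ?X * L2_set (\<lambda>x. cmod (\<xi> (x \<otimes> u))) ?X"
    by (rule norm_sum_mult_le_L2_set)
  also have "L2_set (\<lambda>x. cmod (\<xi> (x \<otimes> u))) ?X = L2_set (\<lambda>y. cmod (\<xi> y)) ((\<lambda>x. x \<otimes> u) ` ?X)"
    by (simp add: L2_set_reindex[OF inj])
  also have "L2_set (\<lambda>x. cmod (\<eta> x)) ?X * \<dots>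
      \<le> L2_set (\<lambda>x. cmod (\<eta> x)) X * L2_set (\<lambda>y. cmod (\<xi> y)) Y"
    using XY by (intro mult_mono L2_set_subset_mono) auto
  finally show "cmod (\<Sum>x\<in>X. \<Sum>y\<in>Y. \<eta> x * (if inv x \<otimes> y = u then a else 0) * \<xi> y)
       \<le> cmod a * (L2_set (\<lambda>x. cmod (\<eta> x)) X * L2_set (\<lambda>y. cmod (\<xi> y)) Y)"
    by (simp add: mult_left_mono)
qed

lemma conv_bound_l1:
  assumes "finite B" "B \<subseteq> carrier G" "\<And>g. g \<in> carrier G \<Longrightarrow> g \<notin> B \<Longrightarrow> c g = 0"
  shows "conv_bound c (\<Sum>g\<in>B. cmod (c g))"
proof -
  have "conv_bound (\<lambda>g. \<Sum>u\<in>B. if g = u then c u else 0) (\<Sum>g\<in>B. cmod (c g))"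
    using assms by (intro conv_bound_sum conv_bound_single) auto
  then show ?thesis
    by (rule conv_bound_cong[THEN iffD1, rotated]) (use assms in auto)
qed

text \<open>Each form involves only finitely many values of the kernel, so pointwise convergence is
  enough.\<close>

lemma conv_bound_LIMSEQ:
  assumes "\<And>n. conv_bound (c n) (K n)" "\<And>g. g \<in> carrier G \<Longrightarrow> (\<lambda>n. c n g) \<longlonglongrightarrow> c' g" "K \<longlonglongrightarrow> K'"
  shows "conv_bound c' K'"
proof (rule conv_boundI)
  fix X Y \<eta> \<xi>
  assume XY: "finite X" "X \<subseteq> carrier G" "finite Y" "Y \<subseteq> carrier G"
  show "cmod (\<Sum>x\<in>X. \<Sum>y\<in>Y. \<eta> x * c' (inv x \<otimes> y) * \<xi> y)
       \<le> K' * (L2_set (\<lambda>x. cmod (\<eta> x)) X * L2_set (\<lambda>y. cmod (\<xi> y)) Y)"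
  proof (rule LIMSEQ_le)
    show "(\<lambda>n. cmod (\<Sum>x\<in>X. \<Sum>y\<in>Y. \<eta> x * c n (inv x \<otimes> y) * \<xi> y)) \<longlonglongrightarrow>
        cmod (\<Sum>x\<in>X. \<Sum>y\<in>Y. \<eta> x * c' (inv x \<otimes> y) * \<xi> y)"
      using XY by (intro tendsto_intros assms(2)) auto
    show "(\<lambda>n. K n * (L2_set (\<lambda>x. cmod (\<eta> x)) X * L2_set (\<lambda>y. cmod (\<xi> y)) Y)) \<longlonglongrightarrow>
        K' * (L2_set (\<lambda>x. cmod (\<eta> x)) X * L2_set (\<lambda>y. cmod (\<xi> y)) Y)"
      by (intro tendsto_intros assms(3))
    show "\<exists>N. \<forall>n\<ge>N. cmod (\<Sum>x\<in>X. \<Sum>y\<in>Y. \<eta> x * c n (inv x \<otimes> y) * \<xi> y)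
        \<le> K n * (L2_set (\<lambda>x. cmod (\<eta> x)) X * L2_set (\<lambda>y. cmod (\<xi> y)) Y)"
      using conv_boundD[OF assms(1) XY] by blast
  qed
qed

text \<open>The elementary half of the description of Schur multipliers as inner products of bounded
  families of vectors: weight both arguments by the components of these vectors, apply the bound for
  \<open>c\<close> to each component, and use Cauchy-Schwarz over the components. The index set may
  depend on \<open>X\<close> and \<open>Y\<close>, which keeps it finite even when no single finite
  set serves the whole group.\<close>

lemma conv_bound_schur:
  fixes P Q :: "'s \<Rightarrow> 'a \<Rightarrow> real" and V :: "'a \<Rightarrow> real"
  assumes c: "conv_bound c K"
    and PQ: "\<And>X Y. \<lbrakk>finite X; X \<subseteq> carrier G; finite Y; Y \<subseteq> carrier G\<rbrakk> \<Longrightarrow>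
      \<exists>\<Omega> :: 's set. finite \<Omega> \<and> (\<forall>x\<in>X. \<forall>y\<in>Y. V (inv x \<otimes> y) = (\<Sum>s\<in>\<Omega>. P s x * Q s y)) \<and>
        (\<forall>x\<in>X. (\<Sum>s\<in>\<Omega>. (P s x)\<^sup>2) \<le> M) \<and> (\<forall>y\<in>Y. (\<Sum>s\<in>\<Omega>. (Q s y)\<^sup>2) \<le> M)"
    and M: "0 \<le> M"
  shows "conv_bound (\<lambda>g. of_real (V g) * c g) (M * K)"
proof (rule conv_boundI)
  fix X Y \<eta> \<xi>
  assume XY: "finite X" "X \<subseteq> carrier G" "finite Y" "Y \<subseteq> carrier G"
  obtain \<Omega> where \<Omega>: "finite \<Omega>" and V: "\<And>x y. x \<in> X \<Longrightarrow> y \<in> Y \<Longrightarrow> V (inv x \<otimes> y) = (\<Sum>s\<in>\<Omega>. P s x * Q s y)"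
    and P: "\<And>x. x \<in> X \<Longrightarrow> (\<Sum>s\<in>\<Omega>. (P s x)\<^sup>2) \<le> M" and Q: "\<And>y. y \<in> Y \<Longrightarrow> (\<Sum>s\<in>\<Omega>. (Q s y)\<^sup>2) \<le> M"
    using PQ[OF XY] by blast
  define N where "N R \<zeta> Z s = L2_set (\<lambda>z. cmod (of_real (R s z) * \<zeta> z)) Z"
    for R :: "'s \<Rightarrow> 'a \<Rightarrow> real" and \<zeta> Z s
  have N: "L2_set (N R \<zeta> Z) \<Omega> \<le> sqrt M * L2_set (\<lambda>z. cmod (\<zeta> z)) Z"
    if "\<And>z. z \<in> Z \<Longrightarrow> (\<Sum>s\<in>\<Omega>. (R s z)\<^sup>2) \<le> M" for R \<zeta> Z
  proof -
    have "(\<Sum>s\<in>\<Omega>. (N R \<zeta> Z s)\<^sup>2) = (\<Sum>s\<in>\<Omega>. \<Sum>z\<in>Z. (R s z)\<^sup>2 * (cmod (\<zeta> z))\<^sup>2)"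
      by (simp add: N_def L2_set_power2 norm_mult power_mult_distrib)
    also have "\<dots> = (\<Sum>z\<in>Z. (\<Sum>s\<in>\<Omega>. (R s z)\<^sup>2) * (cmod (\<zeta> z))\<^sup>2)"
      by (subst sum.swap) (simp add: sum_distrib_right)
    also have "\<dots> \<le> (\<Sum>z\<in>Z. M * (cmod (\<zeta> z))\<^sup>2)"
      using that by (intro sum_mono mult_right_mono) auto
    finally show ?thesis
      by (simp add: L2_set_def sum_distrib_left flip: real_sqrt_mult)
  qed
  have "(\<Sum>x\<in>X. \<Sum>y\<in>Y. \<eta> x * (of_real (V (inv x \<otimes> y)) * c (inv x \<otimes> y)) * \<xi> y)
     = (\<Sum>x\<in>X. \<Sum>y\<in>Y. \<Sum>s\<in>\<Omega>. (of_real (P s x) * \<eta> x) * c (inv x \<otimes> y) * (of_real (Q s y) * \<xi> y))"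
    by (intro sum.cong refl) (simp add: V sum_distrib_left sum_distrib_right mult_ac)
  also have "\<dots> = (\<Sum>s\<in>\<Omega>. \<Sum>x\<in>X. \<Sum>y\<in>Y. (of_real (P s x) * \<eta> x) * c (inv x \<otimes> y) * (of_real (Q s y) * \<xi> y))"
    by (subst (2) sum.swap) (subst sum.swap, simp)
  also have "cmod \<dots> \<le> (\<Sum>s\<in>\<Omega>. K * (N P \<eta> X s * N Q \<xi> Y s))"
    unfolding N_def by (intro sum_norm_le conv_boundD[OF c XY])
  also have "\<dots> \<le> K * (L2_set (N P \<eta> X) \<Omega> * L2_set (N Q \<xi> Y) \<Omega>)"
    using L2_set_mult_ineq[of "N P \<eta> X" "N Q \<xi> Y" \<Omega>] conv_bound_nonneg[OF c]
    by (simp add: N_def mult_left_mono flip: sum_distrib_left)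
  also have "\<dots> \<le> K * ((sqrt M * L2_set (\<lambda>z. cmod (\<eta> z)) X) * (sqrt M * L2_set (\<lambda>z. cmod (\<xi> z)) Y))"
    using conv_bound_nonneg[OF c] M by (intro mult_left_mono mult_mono N P Q) auto
  also have "\<dots> = M * K * (L2_set (\<lambda>z. cmod (\<eta> z)) X * L2_set (\<lambda>z. cmod (\<xi> z)) Y)"
    using M by (simp add: mult_ac)
  finally show "cmod (\<Sum>x\<in>X. \<Sum>y\<in>Y. \<eta> x * (of_real (V (inv x \<otimes> y)) * c (inv x \<otimes> y)) * \<xi> y)
       \<le> M * K * (L2_set (\<lambda>z. cmod (\<eta> z)) X * L2_set (\<lambda>z. cmod (\<xi> z)) Y)" .
qed

end

section \<open>The C*-identity for kernels\<close>

context group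
begin

text \<open>If \<open>T\<close> has kernel \<open>c (inv x \<otimes> y)\<close>, these are the
  coefficients of the kernel of \<open>T* T\<close>. The sum runs over the support of
  \<open>c\<close>, and defaults to zero if that is infinite.\<close>

definition star_square :: "('a \<Rightarrow> complex) \<Rightarrow> 'a \<Rightarrow> complex" where
  "star_square c g = (\<Sum>u\<in>{u \<in> carrier G. c u \<noteq> 0}. cnj (c u) * c (u \<otimes> g))"

lemma star_square_eq:
  assumes "finite B" "B \<subseteq> carrier G" "\<And>g. g \<in> carrier G \<Longrightarrow> g \<notin> B \<Longrightarrow> c g = 0"
  shows "star_square c g = (\<Sum>u\<in>B. cnj (c u) * c (u \<otimes> g))"
  unfolding star_square_def using assms by (intro sum.mono_neutral_left) auto

text \<open>The C*-identity: the squared norm of \<open>T \<xi>\<close> is the form of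
  \<open>T* T\<close> at \<open>\<xi>\<close>.\<close>

lemma conv_bound_sqrt:
  assumes c: "conv_bound (star_square c) (K\<^sup>2)" and K: "0 \<le> K"
    and B: "finite B" "B \<subseteq> carrier G" "\<And>g. g \<in> carrier G \<Longrightarrow> g \<notin> B \<Longrightarrow> c g = 0"
  shows "conv_bound c K"
proof (rule conv_boundI)
  fix X Y \<eta> \<xi>
  assume XY: "finite X" "X \<subseteq> carrier G" "finite Y" "Y \<subseteq> carrier G"
  \<comment> \<open>The function \<open>T\<close> below vanishes off the points
    \<open>y \<otimes> inv u\<close>. Once these are added to \<open>X\<close>, summing over
    \<open>Z\<close> amounts to summing over the whole group.\<close>
  define Z where "Z = X \<union> (\<lambda>(y, u). y \<otimes> inv u) ` (Y \<times> B)"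
  have Z: "finite Z" "Z \<subseteq> carrier G" "X \<subseteq> Z"
    using XY B by (auto simp: Z_def intro!: m_closed inv_closed)
  define T where "T x = (\<Sum>y\<in>Y. c (inv x \<otimes> y) * \<xi> y)" for x
  have sq: "(\<Sum>x\<in>Z. cnj (c (inv x \<otimes> y)) * c (inv x \<otimes> y')) = star_square c (inv y \<otimes> y')"
    if y: "y \<in> Y" and y': "y' \<in> Y" for y y'
  proof -
    have yc: "y \<in> carrier G" "y' \<in> carrier G"
      using y y' XY by auto
    have "star_square c (inv y \<otimes> y') = (\<Sum>u\<in>B. cnj (c u) * c (u \<otimes> (inv y \<otimes> y')))"
      by (rule star_square_eq[OF B]) auto
    also have "\<dots> = (\<Sum>x\<in>(\<lambda>u. y \<otimes> inv u) ` B. cnj (c (inv x \<otimes> y)) * c (inv x \<otimes> y'))"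
    proof (subst sum.reindex)
      show "inj_on (\<lambda>u. y \<otimes> inv u) B"
        using B(2) yc by (intro inj_onI) (metis Units_l_cancel Units_eq inv_closed inv_inv subsetD)
      show "(\<Sum>u\<in>B. cnj (c u) * c (u \<otimes> (inv y \<otimes> y'))) =
        sum ((\<lambda>x. cnj (c (inv x \<otimes> y)) * c (inv x \<otimes> y')) \<circ> (\<lambda>u. y \<otimes> inv u)) B"
        using B(2) yc by (intro sum.cong) (auto simp: inv_mult_group m_assoc subset_iff)
    qed
    also have "\<dots> = (\<Sum>x\<in>Z. cnj (c (inv x \<otimes> y)) * c (inv x \<otimes> y'))"
    proof (rule sum.mono_neutral_left)
      show "(\<lambda>u. y \<otimes> inv u) ` B \<subseteq> Z"
        using y by (auto simp: Z_def)
      show "\<forall>x\<in>Z - (\<lambda>u. y \<otimes> inv u) ` B. cnj (c (inv x \<otimes> y)) * c (inv x \<otimes> y') = 0"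
      proof
        fix x assume x: "x \<in> Z - (\<lambda>u. y \<otimes> inv u) ` B"
        then have xc: "x \<in> carrier G"
          using Z by auto
        have "y \<otimes> inv (inv x \<otimes> y) = x"
          using xc yc by (simp add: inv_mult_group flip: m_assoc)
        then have "inv x \<otimes> y \<notin> B"
          using x by force
        then show "cnj (c (inv x \<otimes> y)) * c (inv x \<otimes> y') = 0"
          using B(3) xc yc by simp
      qed
    qed (rule Z)
    finally show ?thesis ..
  qed
  have "of_real ((L2_set (\<lambda>x. cmod (T x)) Z)\<^sup>2) = (\<Sum>x\<in>Z. cnj (T x) * T x)"
    by (rule of_real_L2_set_power2)
  also have "\<dots> = (\<Sum>x\<in>Z. \<Sum>y\<in>Y. \<Sum>y'\<in>Y. cnj (\<xi> y) * (cnj (c (inv x \<otimes> y)) * c (inv x \<otimes> y')) * \<xi> y')"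
    by (simp only: T_def cnj_sum complex_cnj_mult sum_product) (intro sum.cong refl, simp add: mult_ac)
  also have "\<dots> = (\<Sum>y\<in>Y. \<Sum>x\<in>Z. \<Sum>y'\<in>Y. cnj (\<xi> y) * (cnj (c (inv x \<otimes> y)) * c (inv x \<otimes> y')) * \<xi> y')"
    by (rule sum.swap)
  also have "\<dots> = (\<Sum>y\<in>Y. \<Sum>y'\<in>Y. \<Sum>x\<in>Z. cnj (\<xi> y) * (cnj (c (inv x \<otimes> y)) * c (inv x \<otimes> y')) * \<xi> y')"
    by (intro sum.cong refl sum.swap)
  also have "\<dots> = (\<Sum>y\<in>Y. \<Sum>y'\<in>Y. cnj (\<xi> y) * star_square c (inv y \<otimes> y') * \<xi> y')"
    by (intro sum.cong refl) (simp flip: sum_distrib_left sum_distrib_right add: sq)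
  finally have "(L2_set (\<lambda>x. cmod (T x)) Z)\<^sup>2
      = cmod (\<Sum>y\<in>Y. \<Sum>y'\<in>Y. cnj (\<xi> y) * star_square c (inv y \<otimes> y') * \<xi> y')"
    by (metis abs_of_nonneg norm_of_real zero_le_power2)
  also have "\<dots> \<le> K\<^sup>2 * (L2_set (\<lambda>y. cmod (cnj (\<xi> y))) Y * L2_set (\<lambda>y. cmod (\<xi> y)) Y)"
    by (rule conv_boundD[OF c XY(3,4) XY(3,4)])
  also have "\<dots> = (K * L2_set (\<lambda>y. cmod (\<xi> y)) Y)\<^sup>2"
    by (simp add: power2_eq_square)
  finally have T: "L2_set (\<lambda>x. cmod (T x)) Z \<le> K * L2_set (\<lambda>y. cmod (\<xi> y)) Y"
    using K by (simp add: power2_le_iff_abs_le)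
  have "(\<Sum>x\<in>X. \<Sum>y\<in>Y. \<eta> x * c (inv x \<otimes> y) * \<xi> y) = (\<Sum>x\<in>X. \<eta> x * T x)"
    by (simp add: T_def sum_distrib_left mult_ac)
  also have "cmod \<dots> \<le> L2_set (\<lambda>x. cmod (\<eta> x)) X * L2_set (\<lambda>x. cmod (T x)) X"
    by (rule norm_sum_mult_le_L2_set)
  also have "\<dots> \<le> L2_set (\<lambda>x. cmod (\<eta> x)) X * (K * L2_set (\<lambda>y. cmod (\<xi> y)) Y)"
    by (intro mult_left_mono order_trans[OF L2_set_subset_mono[OF Z(1,3)] T]) auto
  finally show "cmod (\<Sum>x\<in>X. \<Sum>y\<in>Y. \<eta> x * c (inv x \<otimes> y) * \<xi> y)
       \<le> K * (L2_set (\<lambda>x. cmod (\<eta> x)) X * L2_set (\<lambda>y. cmod (\<xi> y)) Y)"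
    by (simp add: mult_ac)
qed

end

section \<open>Square-summable vectors and operator bounds\<close>

lemma L2_set_le_l2_norm:
  assumes "\<xi> \<in> l2 G" "finite H" "H \<subseteq> carrier G"
  shows "L2_set (\<lambda>h. cmod (\<xi> h)) H \<le> l2_norm G \<xi>"
  unfolding L2_set_def l2_norm_def using assms
  by (intro real_sqrt_le_mono finite_sum_le_infsum) (auto simp: l2_def)

lemma l2_bound:
  assumes "\<And>h. h \<notin> carrier G \<Longrightarrow> \<xi> h = 0"
    and "\<And>H. finite H \<Longrightarrow> H \<subseteq> carrier G \<Longrightarrow> L2_set (\<lambda>h. cmod (\<xi> h)) H \<le> K"
  shows "\<xi> \<in> l2 G" "l2_norm G \<xi> \<le> K"
proof -
  have K: "0 \<le> K"
    using assms(2)[of "{}"] by simp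
  have bd: "(\<Sum>h\<in>H. (cmod (\<xi> h))\<^sup>2) \<le> K\<^sup>2" if "finite H" "H \<subseteq> carrier G" for H
    using power_mono[OF assms(2)[OF that], of 2] by (simp add: L2_set_power2)
  have summ: "(\<lambda>h. (cmod (\<xi> h))\<^sup>2) summable_on carrier G"
    by (rule nonneg_bdd_above_summable_on) (auto intro!: bdd_aboveI[of _ "K\<^sup>2"] bd)
  then show "\<xi> \<in> l2 G"
    using assms(1) by (simp add: l2_def)
  have "(\<Sum>\<^sub>\<infinity>h\<in>carrier G. (cmod (\<xi> h))\<^sup>2) \<le> K\<^sup>2"
    by (rule infsum_le_finite_sums[OF summ bd])
  then show "l2_norm G \<xi> \<le> K"
    using K by (simp add: l2_norm_def real_le_lsqrt)
qed

lemma l2_norm_nonneg: "0 \<le> l2_norm G \<xi>"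
  by (auto simp: l2_norm_def intro!: infsum_nonneg)

lemma l2_finite_support:
  assumes "finite Y" "Y \<subseteq> carrier G" "\<And>h. h \<notin> Y \<Longrightarrow> \<xi> h = 0"
  shows "\<xi> \<in> l2 G" "l2_norm G \<xi> = L2_set (\<lambda>h. cmod (\<xi> h)) Y"
proof -
  have bd: "L2_set (\<lambda>h. cmod (\<xi> h)) H \<le> L2_set (\<lambda>h. cmod (\<xi> h)) Y" if "finite H" for H
  proof -
    have "L2_set (\<lambda>h. cmod (\<xi> h)) H = L2_set (\<lambda>h. cmod (\<xi> h)) (H \<inter> Y)"
      unfolding L2_set_def using that assms(3) by (intro arg_cong[of _ _ sqrt] sum.mono_neutral_right) auto
    also have "\<dots> \<le> L2_set (\<lambda>h. cmod (\<xi> h)) Y"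
      using assms by (intro L2_set_subset_mono) auto
    finally show ?thesis .
  qed
  show "\<xi> \<in> l2 G"
    by (rule l2_bound(1)[OF _ bd]) (use assms in auto)
  moreover have "l2_norm G \<xi> \<le> L2_set (\<lambda>h. cmod (\<xi> h)) Y"
    by (rule l2_bound(2)[OF _ bd]) (use assms in auto)
  ultimately show "l2_norm G \<xi> = L2_set (\<lambda>h. cmod (\<xi> h)) Y"
    using assms by (simp add: L2_set_le_l2_norm antisym)
qed

lemma l2_add:
  assumes "\<xi> \<in> l2 G" "\<eta> \<in> l2 G"
  shows "(\<lambda>h. \<xi> h + \<eta> h) \<in> l2 G" "l2_norm G (\<lambda>h. \<xi> h + \<eta> h) \<le> l2_norm G \<xi> + l2_norm G \<eta>"
proof -
  have bd: "L2_set (\<lambda>h. cmod (\<xi> h + \<eta> h)) H \<le> l2_norm G \<xi> + l2_norm G \<eta>"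
    if "finite H" "H \<subseteq> carrier G" for H
  proof -
    have "L2_set (\<lambda>h. cmod (\<xi> h + \<eta> h)) H \<le> L2_set (\<lambda>h. cmod (\<xi> h) + cmod (\<eta> h)) H"
      by (intro L2_set_mono norm_triangle_ineq) auto
    also note L2_set_triangle_ineq
    also have "L2_set (\<lambda>h. cmod (\<xi> h)) H + L2_set (\<lambda>h. cmod (\<eta> h)) H \<le> l2_norm G \<xi> + l2_norm G \<eta>"
      by (intro add_mono L2_set_le_l2_norm assms that)
    finally show ?thesis .
  qed
  show "(\<lambda>h. \<xi> h + \<eta> h) \<in> l2 G" "l2_norm G (\<lambda>h. \<xi> h + \<eta> h) \<le> l2_norm G \<xi> + l2_norm G \<eta>"
    by (rule l2_bound; use assms bd in \<open>auto simp: l2_def\<close>)+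
qed

lemma l2_scale:
  assumes "\<xi> \<in> l2 G"
  shows "(\<lambda>h. a * \<xi> h) \<in> l2 G" "l2_norm G (\<lambda>h. a * \<xi> h) = cmod a * l2_norm G \<xi>"
proof -
  show "(\<lambda>h. a * \<xi> h) \<in> l2 G"
    using assms by (auto simp: l2_def norm_mult power_mult_distrib intro: summable_on_cmult_right)
  show "l2_norm G (\<lambda>h. a * \<xi> h) = cmod a * l2_norm G \<xi>"
    by (simp add: l2_norm_def norm_mult power_mult_distrib infsum_cmult_right' real_sqrt_mult)
qed

lemma l2_diff:
  assumes "\<xi> \<in> l2 G" "\<eta> \<in> l2 G"
  shows "(\<lambda>h. \<xi> h - \<eta> h) \<in> l2 G" "l2_norm G (\<lambda>h. \<xi> h - \<eta> h) \<le> l2_norm G \<xi> + l2_norm G \<eta>"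
  using l2_add[OF assms(1) l2_scale(1)[OF assms(2), of "-1"]] l2_scale(2)[OF assms(2), of "-1"] by auto

text \<open>\<open>op_norm\<close> is a supremum, which is informative only once its set is known to
  be bounded. Estimates therefore carry an explicit constant and are converted to
  \<open>op_norm\<close> at the end.\<close>

definition op_bound :: "('a, 'b) monoid_scheme \<Rightarrow> 'a operator \<Rightarrow> real \<Rightarrow> bool" where
  "op_bound G T K \<longleftrightarrow> (\<forall>\<xi>\<in>l2 G. T \<xi> \<in> l2 G \<and> l2_norm G (T \<xi>) \<le> K * l2_norm G \<xi>)"

lemma op_bound_add:
  assumes "op_bound G (op_diff R S) K" "op_bound G (op_diff S T) K'"
  shows "op_bound G (op_diff R T) (K + K')"
  unfolding op_bound_def
proof
  fix \<xi> assume \<xi>: "\<xi> \<in> l2 G"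
  have "op_diff R T \<xi> = (\<lambda>h. op_diff R S \<xi> h + op_diff S T \<xi> h)"
    by (simp add: op_diff_def)
  then show "op_diff R T \<xi> \<in> l2 G \<and> l2_norm G (op_diff R T \<xi>) \<le> (K + K') * l2_norm G \<xi>"
    using assms \<xi> l2_add[of "op_diff R S \<xi>" G "op_diff S T \<xi>"]
    by (auto simp: op_bound_def distrib_right intro: order_trans[OF _ add_mono])
qed

lemma op_bound_diff_commute: "op_bound G (op_diff R S) K \<Longrightarrow> op_bound G (op_diff S R) K"
  unfolding op_bound_def
proof (intro ballI)
  fix \<xi> assume *: "\<forall>\<xi>\<in>l2 G. op_diff R S \<xi> \<in> l2 G \<and> l2_norm G (op_diff R S \<xi>) \<le> K * l2_norm G \<xi>"
    and "\<xi> \<in> l2 G"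
  moreover have "op_diff S R \<xi> = (\<lambda>h. - 1 * op_diff R S \<xi> h)"
    by (simp add: op_diff_def)
  ultimately show "op_diff S R \<xi> \<in> l2 G \<and> l2_norm G (op_diff S R \<xi>) \<le> K * l2_norm G \<xi>"
    using l2_scale[of "op_diff R S \<xi>" G "- 1"] by simp
qed

lemma zero_in_l2: "(\<lambda>_. 0) \<in> l2 G" "l2_norm G (\<lambda>_. 0) = 0"
  by (simp_all add: l2_def l2_norm_def)

lemma op_norm_le:
  assumes "op_bound G T K" "0 \<le> K"
  shows "op_norm G T \<le> K"
  unfolding op_norm_def
proof (rule cSUP_least)
  show "{\<xi> \<in> l2 G. l2_norm G \<xi> \<le> 1} \<noteq> {}"
    using zero_in_l2 by (metis (mono_tags, lifting) empty_Collect_eq zero_le_one)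
  show "l2_norm G (T \<xi>) \<le> K" if "\<xi> \<in> {\<xi> \<in> l2 G. l2_norm G \<xi> \<le> 1}" for \<xi>
    using that assms mult_left_mono[of "l2_norm G \<xi>" 1 K] by (force simp: op_bound_def)
qed

lemma op_norm_nonneg:
  assumes "op_bound G T K" "0 \<le> K"
  shows "0 \<le> op_norm G T"
proof -
  have "bdd_above ((\<lambda>\<xi>. l2_norm G (T \<xi>)) ` {\<xi> \<in> l2 G. l2_norm G \<xi> \<le> 1})"
  proof (rule bdd_aboveI2)
    show "l2_norm G (T \<xi>) \<le> K" if "\<xi> \<in> {\<xi> \<in> l2 G. l2_norm G \<xi> \<le> 1}" for \<xi>
      using that assms mult_left_mono[of "l2_norm G \<xi>" 1 K] by (force simp: op_bound_def)
  qed
  then have "l2_norm G (T (\<lambda>_. 0)) \<le> op_norm G T"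
    unfolding op_norm_def by (intro cSUP_upper) (auto simp: zero_in_l2)
  then show ?thesis
    using l2_norm_nonneg order_trans by blast
qed

text \<open>Rescaling into the unit ball. The constant \<open>K\<close> bounds the set whose
  supremum is \<open>op_norm\<close>, and it settles the vectors of norm zero.\<close>

lemma op_bound_op_norm:
  assumes T: "op_bound G T K" "0 \<le> K"
    and hom: "\<And>a \<xi>. \<xi> \<in> l2 G \<Longrightarrow> T (\<lambda>h. a * \<xi> h) = (\<lambda>h. a * T \<xi> h)"
  shows "op_bound G T (op_norm G T)"
  unfolding op_bound_def
proof
  fix \<xi> assume \<xi>: "\<xi> \<in> l2 G"
  have T\<xi>: "T \<xi> \<in> l2 G" "l2_norm G (T \<xi>) \<le> K * l2_norm G \<xi>"
    using T(1) \<xi> by (auto simp: op_bound_def)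
  have "l2_norm G (T \<xi>) \<le> op_norm G T * l2_norm G \<xi>"
  proof (cases "l2_norm G \<xi> = 0")
    case True
    then show ?thesis
      using T\<xi> by simp
  next
    case False
    then have pos: "0 < l2_norm G \<xi>"
      using l2_norm_nonneg[of G \<xi>] by simp
    define a where "a = complex_of_real (1 / l2_norm G \<xi>)"
    have a: "cmod a = 1 / l2_norm G \<xi>"
      using pos unfolding a_def norm_of_real by simp
    have bdd: "bdd_above ((\<lambda>\<xi>. l2_norm G (T \<xi>)) ` {\<xi> \<in> l2 G. l2_norm G \<xi> \<le> 1})"
    proof (rule bdd_aboveI2)
      show "l2_norm G (T \<xi>) \<le> K" if "\<xi> \<in> {\<xi> \<in> l2 G. l2_norm G \<xi> \<le> 1}" for \<xi>
        using that T mult_left_mono[of "l2_norm G \<xi>" 1 K] by (force simp: op_bound_def)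
    qed
    have "l2_norm G (T (\<lambda>h. a * \<xi> h)) \<le> op_norm G T"
      unfolding op_norm_def using l2_scale[OF \<xi>, of a] a pos by (intro cSUP_upper bdd) simp
    then show ?thesis
      using hom[OF \<xi>] l2_scale(2)[OF T\<xi>(1), of a] a pos by (simp add: field_simps)
  qed
  then show "T \<xi> \<in> l2 G \<and> l2_norm G (T \<xi>) \<le> op_norm G T * l2_norm G \<xi>"
    using T\<xi> by simp
qed

section \<open>Kernels, operators and Fourier coefficients\<close>

context group
begin

text \<open>The inversion of the group carries left translations to the kernel
  \<open>c (inv x \<otimes> y)\<close>: for \<open>y = x \<otimes> g\<close> one has
  \<open>inv g \<otimes> inv x = inv y\<close>. The set \<open>Y\<close> must contain every such
  \<open>y\<close> at which \<open>\<zeta>\<close> is seen.\<close>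

lemma lin_comb_eq_conv:
  assumes E: "finite E" "E \<subseteq> carrier G" and x: "x \<in> carrier G"
    and Y: "finite Y" "Y \<subseteq> carrier G"
    and cover: "\<And>g. g \<in> E \<Longrightarrow> \<zeta> (inv g \<otimes> inv x) \<noteq> 0 \<Longrightarrow> x \<otimes> g \<in> Y"
  shows "lin_comb G E c \<zeta> (inv x)
    = (\<Sum>y\<in>Y. (if inv x \<otimes> y \<in> E then c (inv x \<otimes> y) else 0) * \<zeta> (inv y))"
proof -
  have "(\<Sum>y\<in>Y. (if inv x \<otimes> y \<in> E then c (inv x \<otimes> y) else 0) * \<zeta> (inv y))
     = (\<Sum>g\<in>(\<lambda>y. inv x \<otimes> y) ` Y. (if g \<in> E then c g else 0) * \<zeta> (inv g \<otimes> inv x))"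
  proof (subst sum.reindex)
    show "inj_on (\<lambda>y. inv x \<otimes> y) Y"
      using Y x by (intro inj_on_left_mult) auto
  qed (use Y x in \<open>auto intro!: sum.cong simp: inv_mult_group m_assoc subset_iff\<close>)
  also have "\<dots> = (\<Sum>g\<in>E. c g * \<zeta> (inv g \<otimes> inv x))"
  proof (rule sum.mono_neutral_cong)
    show "c g * \<zeta> (inv g \<otimes> inv x) = 0" if "g \<in> E - (\<lambda>y. inv x \<otimes> y) ` Y" for g
    proof -
      have "g = inv x \<otimes> (x \<otimes> g)"
        using that E x by (auto simp flip: m_assoc)
      then have "x \<otimes> g \<notin> Y"
        using that by blast
      then show ?thesis
        using cover that by auto
    qed
  qed (use E Y in auto)
  also have "\<dots> = lin_comb G E c \<zeta> (inv x)"
    using x by (simp add: lin_comb_def left_reg_def)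
  finally show ?thesis ..
qed

lemma lin_comb_outside: "h \<notin> carrier G \<Longrightarrow> lin_comb G E c \<xi> h = 0"
  by (simp add: lin_comb_def left_reg_def)

lemma op_bound_lin_comb:
  assumes E: "finite E" "E \<subseteq> carrier G"
    and bd: "conv_bound (\<lambda>g. if g \<in> E then c g else 0) K"
  shows "op_bound G (lin_comb G E c) K"
  unfolding op_bound_def
proof
  fix \<xi> assume \<xi>: "\<xi> \<in> l2 G"
  let ?T = "lin_comb G E c \<xi>"
  have "L2_set (\<lambda>h. cmod (?T h)) H \<le> K * l2_norm G \<xi>" if H: "finite H" "H \<subseteq> carrier G" for H
  proof -
    define X where "X = (\<lambda>h. inv h) ` H"
    define Y where "Y = (\<lambda>(x, g). x \<otimes> g) ` (X \<times> E)"
    have XY: "finite X" "X \<subseteq> carrier G" "finite Y" "Y \<subseteq> carrier G"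
      using H E by (auto simp: X_def Y_def)
    have injX: "inj_on (\<lambda>h. inv h) X" and injY: "inj_on (\<lambda>h. inv h) Y" and injH: "inj_on (\<lambda>h. inv h) H"
      using XY H by (auto intro!: inj_on_inv)
    have TX: "L2_set (\<lambda>x. cmod (?T (inv x))) X = L2_set (\<lambda>h. cmod (?T h)) H"
      unfolding X_def using H by (subst L2_set_reindex[OF injH]) (auto intro!: L2_set_cong simp: subset_iff)
    have \<xi>Y: "L2_set (\<lambda>y. cmod (\<xi> (inv y))) Y \<le> l2_norm G \<xi>"
      using XY by (subst L2_set_reindex[OF injY, symmetric]) (intro L2_set_le_l2_norm \<xi>, auto)
    have T: "?T (inv x) = (\<Sum>y\<in>Y. (if inv x \<otimes> y \<in> E then c (inv x \<otimes> y) else 0) * \<xi> (inv y))"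
      if "x \<in> X" for x
      using that XY E by (intro lin_comb_eq_conv) (auto simp: Y_def)
    \<comment> \<open>Test the form at the conjugate of the output itself; one factor of the norm of
      the output then cancels.\<close>
    have "of_real ((L2_set (\<lambda>x. cmod (?T (inv x))) X)\<^sup>2) = (\<Sum>x\<in>X. cnj (?T (inv x)) * ?T (inv x))"
      by (rule of_real_L2_set_power2)
    also have "\<dots> = (\<Sum>x\<in>X. \<Sum>y\<in>Y. cnj (?T (inv x)) * (if inv x \<otimes> y \<in> E then c (inv x \<otimes> y) else 0) * \<xi> (inv y))"
      by (intro sum.cong refl) (subst (2) T, simp_all add: sum_distrib_left mult.assoc)
    finally have "(L2_set (\<lambda>x. cmod (?T (inv x))) X)\<^sup>2 = cmod \<dots>"
      by (metis abs_of_nonneg norm_of_real zero_le_power2)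
    also have "\<dots> \<le> K * (L2_set (\<lambda>x. cmod (cnj (?T (inv x)))) X * L2_set (\<lambda>y. cmod (\<xi> (inv y))) Y)"
      by (rule conv_boundD[OF bd XY])
    also have "\<dots> \<le> K * (L2_set (\<lambda>x. cmod (?T (inv x))) X * l2_norm G \<xi>)"
      unfolding complex_mod_cnj
      by (rule mult_left_mono[OF mult_left_mono[OF \<xi>Y L2_set_nonneg] conv_bound_nonneg[OF bd]])
    finally have "L2_set (\<lambda>x. cmod (?T (inv x))) X * L2_set (\<lambda>x. cmod (?T (inv x))) X
        \<le> L2_set (\<lambda>x. cmod (?T (inv x))) X * (K * l2_norm G \<xi>)"
      by (simp add: power2_eq_square mult_ac)
    then have "L2_set (\<lambda>x. cmod (?T (inv x))) X \<le> K * l2_norm G \<xi>"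
      using conv_bound_nonneg[OF bd] l2_norm_nonneg[of G \<xi>] L2_set_nonneg[of "\<lambda>x. cmod (?T (inv x))" X]
      by (metis mult_le_cancel_left_pos mult_nonneg_nonneg order_le_less)
    then show ?thesis
      by (simp add: TX)
  qed
  then show "?T \<in> l2 G \<and> l2_norm G ?T \<le> K * l2_norm G \<xi>"
    using l2_bound[of G ?T "K * l2_norm G \<xi>"] lin_comb_outside by blast
qed

text \<open>Conversely, \<open>\<xi>\<close> restricted to \<open>Y\<close> and transported by
  inversion is a vector of \<open>l2 G\<close>, and the form pairs its image with
  \<open>\<eta>\<close>.\<close>

lemma conv_bound_lin_comb:
  assumes E: "finite E" "E \<subseteq> carrier G"
    and bd: "op_bound G (lin_comb G E c) K" and K: "0 \<le> K"
  shows "conv_bound (\<lambda>g. if g \<in> E then c g else 0) K"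
proof (rule conv_boundI)
  fix X Y \<eta> \<xi>
  assume XY: "finite X" "X \<subseteq> carrier G" "finite Y" "Y \<subseteq> carrier G"
  define \<zeta> :: "'a \<Rightarrow> complex" where "\<zeta> h = (if h \<in> (\<lambda>h. inv h) ` Y then \<xi> (inv h) else 0)" for h
  have injX: "inj_on (\<lambda>h. inv h) X" and injY: "inj_on (\<lambda>h. inv h) Y"
    using XY by (auto intro!: inj_on_inv)
  have \<zeta>Y: "\<zeta> (inv y) = \<xi> y" if "y \<in> Y" for y
    using that XY by (auto simp: \<zeta>_def)
  have \<zeta>: "\<zeta> \<in> l2 G" "l2_norm G \<zeta> = L2_set (\<lambda>h. cmod (\<zeta> h)) ((\<lambda>h. inv h) ` Y)"
    using l2_finite_support[of "(\<lambda>h. inv h) ` Y" G \<zeta>] XY by (auto simp: \<zeta>_def)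
  then have \<zeta>n: "l2_norm G \<zeta> = L2_set (\<lambda>h. cmod (\<xi> h)) Y"
    using \<zeta>Y by (simp add: L2_set_reindex[OF injY] cong: L2_set_cong_simp)
  have T: "lin_comb G E c \<zeta> (inv x) = (\<Sum>y\<in>Y. (if inv x \<otimes> y \<in> E then c (inv x \<otimes> y) else 0) * \<xi> y)"
    if x: "x \<in> X" for x
  proof -
    have "lin_comb G E c \<zeta> (inv x) = (\<Sum>y\<in>Y. (if inv x \<otimes> y \<in> E then c (inv x \<otimes> y) else 0) * \<zeta> (inv y))"
    proof (rule lin_comb_eq_conv[OF E _ XY(3,4)])
      show "x \<in> carrier G"
        using x XY by auto
      fix g assume g: "g \<in> E" "\<zeta> (inv g \<otimes> inv x) \<noteq> 0"
      then obtain y where "y \<in> Y" "inv (x \<otimes> g) = inv y"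
        using x XY E by (auto simp: \<zeta>_def inv_mult_group subset_iff split: if_splits)
      then show "x \<otimes> g \<in> Y"
        using x g XY E by (metis inv_inv m_closed subsetD)
    qed
    then show ?thesis
      by (simp add: \<zeta>Y cong: sum.cong)
  qed
  have bT: "lin_comb G E c \<zeta> \<in> l2 G" "l2_norm G (lin_comb G E c \<zeta>) \<le> K * L2_set (\<lambda>h. cmod (\<xi> h)) Y"
    using bd \<zeta>(1) \<zeta>n by (auto simp: op_bound_def)
  have "(\<Sum>x\<in>X. \<Sum>y\<in>Y. \<eta> x * (if inv x \<otimes> y \<in> E then c (inv x \<otimes> y) else 0) * \<xi> y)
     = (\<Sum>x\<in>X. \<eta> x * lin_comb G E c \<zeta> (inv x))"
    by (intro sum.cong refl) (simp add: T sum_distrib_left mult.assoc)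
  also have "cmod \<dots> \<le> L2_set (\<lambda>x. cmod (\<eta> x)) X * L2_set (\<lambda>x. cmod (lin_comb G E c \<zeta> (inv x))) X"
    by (rule norm_sum_mult_le_L2_set)
  also have "\<dots> \<le> L2_set (\<lambda>x. cmod (\<eta> x)) X * (K * L2_set (\<lambda>y. cmod (\<xi> y)) Y)"
  proof (rule mult_left_mono[OF order_trans[OF _ bT(2)] L2_set_nonneg])
    show "L2_set (\<lambda>x. cmod (lin_comb G E c \<zeta> (inv x))) X \<le> l2_norm G (lin_comb G E c \<zeta>)"
      using XY by (subst L2_set_reindex[OF injX, symmetric]) (intro L2_set_le_l2_norm bT, auto)
  qed
  finally show "cmod (\<Sum>x\<in>X. \<Sum>y\<in>Y. \<eta> x * (if inv x \<otimes> y \<in> E then c (inv x \<otimes> y) else 0) * \<xi> y)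
      \<le> K * (L2_set (\<lambda>x. cmod (\<eta> x)) X * L2_set (\<lambda>y. cmod (\<xi> y)) Y)"
    by (simp add: mult_ac)
qed

lemma lin_comb_extend:
  assumes "finite F" "E \<subseteq> F"
  shows "lin_comb G E c = lin_comb G F (\<lambda>g. if g \<in> E then c g else 0)"
  unfolding lin_comb_def using assms
  by (intro ext sum.mono_neutral_cong_left) auto

lemma op_diff_lin_comb:
  assumes "finite E" "finite F"
  shows "op_diff (lin_comb G E c) (lin_comb G F d)
    = lin_comb G (E \<union> F) (\<lambda>g. (if g \<in> E then c g else 0) - (if g \<in> F then d g else 0))"
  using assms
  by (subst lin_comb_extend[of "E \<union> F" E], simp, simp, subst lin_comb_extend[of "E \<union> F" F], simp, simp)
    (simp add: op_diff_def lin_comb_def left_diff_distrib sum_subtractf)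

lemma op_bound_op_diff_iff:
  assumes "finite E" "E \<subseteq> carrier G" "finite F" "F \<subseteq> carrier G" "0 \<le> K"
  shows "op_bound G (op_diff (lin_comb G E c) (lin_comb G F d)) K \<longleftrightarrow>
    conv_bound (\<lambda>g. (if g \<in> E then c g else 0) - (if g \<in> F then d g else 0)) K"
proof -
  have eq: "(\<lambda>g. if g \<in> E \<union> F then (if g \<in> E then c g else 0) - (if g \<in> F then d g else 0) else 0)
     = (\<lambda>g. (if g \<in> E then c g else 0) - (if g \<in> F then d g else 0))"
    by auto
  show ?thesis
    using op_bound_lin_comb[of "E \<union> F" "\<lambda>g. (if g \<in> E then c g else 0) - (if g \<in> F then d g else 0)" K]
      conv_bound_lin_comb[of "E \<union> F" "\<lambda>g. (if g \<in> E then c g else 0) - (if g \<in> F then d g else 0)" K] assms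
    unfolding eq op_diff_lin_comb[OF assms(1,3)] by auto
qed

lemma fourier_coeff_eq:
  assumes "g \<in> carrier G"
  shows "fourier_coeff G T g = T (delta \<one>) g"
proof -
  have "fourier_coeff G T g = (\<Sum>\<^sub>\<infinity>h\<in>carrier G. cnj (delta \<one> h) * left_reg G (inv g) (T (delta \<one>)) h)"
    by (simp add: fourier_coeff_def canonical_trace_def l2_inner_def)
  also have "\<dots> = (\<Sum>\<^sub>\<infinity>h\<in>{\<one>}. cnj (delta \<one> h) * left_reg G (inv g) (T (delta \<one>)) h)"
    by (rule infsum_cong_neutral) (auto simp: delta_def)
  also have "\<dots> = T (delta \<one>) g"
    using assms by (simp add: delta_def left_reg_def)
  finally show ?thesis .
qed

lemma delta_one_l2: "delta \<one> \<in> l2 G" "l2_norm G (delta \<one>) = 1"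
  using l2_finite_support[of "{\<one>}" G "delta \<one>"] by (auto simp: delta_def)

lemma lin_comb_delta_one:
  assumes "finite E" "E \<subseteq> carrier G" "g \<in> carrier G"
  shows "lin_comb G E c (delta \<one>) g = (if g \<in> E then c g else 0)"
proof -
  have "inv u \<otimes> g = \<one> \<longleftrightarrow> u = g" if "u \<in> carrier G" for u
    using that assms(3) by (metis inv_closed inv_equality inv_inv l_inv)
  then have "lin_comb G E c (delta \<one>) g = (\<Sum>u\<in>E. if u = g then c u else 0)"
    unfolding lin_comb_def using assms by (intro sum.cong refl) (auto simp: left_reg_def delta_def)
  then show ?thesis
    using assms by simp
qed

text \<open>The second bound concerns the Fourier coefficients of \<open>T\<close>, which need not
  have finite support. It is obtained as a limit from the finite combinations that approximate
  \<open>T\<close>: their coefficients converge pointwise, as one sees by applying the operators to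
  \<open>delta \<one>\<close>.\<close>

lemma reduced_C_star_approx:
  assumes T: "T \<in> reduced_C_star G" and \<epsilon>: "0 < \<epsilon>"
  shows "\<exists>F s. finite F \<and> F \<subseteq> carrier G \<and> op_bound G (op_diff T (lin_comb G F s)) \<epsilon> \<and>
    conv_bound (\<lambda>g. fourier_coeff G T g - (if g \<in> F then s g else 0)) \<epsilon>"
proof -
  have approx: "\<exists>F s. finite F \<and> F \<subseteq> carrier G \<and> op_bound G (op_diff T (lin_comb G F s)) \<epsilon>" if pos: "0 < \<epsilon>" for \<epsilon>
  proof -
    obtain S where "S \<in> left_reg_span G" "op_norm G (op_diff T S) < \<epsilon>"
      using T pos unfolding reduced_C_star_def by blast
    then obtain F s where F: "finite F" "F \<subseteq> carrier G" and n: "op_norm G (op_diff T (lin_comb G F s)) < \<epsilon>"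
      by (auto simp: left_reg_span_def)
    define L where "L = (\<Sum>g\<in>F. cmod (if g \<in> F then s g else 0))"
    have S: "op_bound G (lin_comb G F s) L"
      unfolding L_def using F by (intro op_bound_lin_comb conv_bound_l1) auto
    obtain K0 where K0: "\<And>\<xi>. \<xi> \<in> l2 G \<Longrightarrow> l2_norm G (T \<xi>) \<le> K0 * l2_norm G \<xi>"
      using T unfolding reduced_C_star_def bounded_op_def by blast
    have Tl2: "\<And>\<xi>. \<xi> \<in> l2 G \<Longrightarrow> T \<xi> \<in> l2 G"
      and Ths: "\<And>a \<xi>. \<xi> \<in> l2 G \<Longrightarrow> T (\<lambda>h. a * \<xi> h) = (\<lambda>h. a * T \<xi> h)"
      using T unfolding reduced_C_star_def bounded_op_def by blast+
    have "op_bound G (op_diff T (lin_comb G F s)) (\<bar>K0\<bar> + L)"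
      unfolding op_bound_def
    proof
      fix \<xi> assume \<xi>: "\<xi> \<in> l2 G"
      have S\<xi>: "lin_comb G F s \<xi> \<in> l2 G" "l2_norm G (lin_comb G F s \<xi>) \<le> L * l2_norm G \<xi>"
        using S \<xi> by (auto simp: op_bound_def)
      have "l2_norm G (T \<xi>) \<le> \<bar>K0\<bar> * l2_norm G \<xi>"
        using K0[OF \<xi>] l2_norm_nonneg[of G \<xi>] by (meson abs_ge_self mult_right_mono order_trans)
      then show "op_diff T (lin_comb G F s) \<xi> \<in> l2 G \<and>
          l2_norm G (op_diff T (lin_comb G F s) \<xi>) \<le> (\<bar>K0\<bar> + L) * l2_norm G \<xi>"
        using l2_diff[OF Tl2[OF \<xi>] S\<xi>(1)] S\<xi>(2) by (simp add: op_diff_def distrib_right)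
    qed
    then have "op_bound G (op_diff T (lin_comb G F s)) (op_norm G (op_diff T (lin_comb G F s)))"
    proof (rule op_bound_op_norm)
      show "0 \<le> \<bar>K0\<bar> + L"
        by (simp add: L_def sum_nonneg)
      fix a \<xi> assume "\<xi> \<in> l2 G"
      then show "op_diff T (lin_comb G F s) (\<lambda>h. a * \<xi> h) = (\<lambda>h. a * op_diff T (lin_comb G F s) \<xi> h)"
        by (auto simp: op_diff_def Ths lin_comb_def left_reg_def fun_eq_iff sum_distrib_left algebra_simps
            intro!: sum.cong)
    qed
    then have "op_bound G (op_diff T (lin_comb G F s)) \<epsilon>"
      using n l2_norm_nonneg unfolding op_bound_def
      by (meson less_eq_real_def mult_right_mono order_trans)
    then show ?thesis
      using F by blast
  qed
  obtain F s where F: "finite F" "F \<subseteq> carrier G" and S: "op_bound G (op_diff T (lin_comb G F s)) \<epsilon>"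
    using approx[OF \<epsilon>] by blast
  have "\<forall>n. \<exists>F' s'. finite F' \<and> F' \<subseteq> carrier G \<and> op_bound G (op_diff T (lin_comb G F' s')) (1 / Suc n)"
    using approx by simp
  then obtain F' s' where F': "\<And>n. finite (F' n)" "\<And>n. F' n \<subseteq> carrier G"
    and S': "\<And>n. op_bound G (op_diff T (lin_comb G (F' n) (s' n))) (1 / Suc n)"
    by metis
  have lim: "(\<lambda>n. if g \<in> F' n then s' n g else 0) \<longlonglongrightarrow> fourier_coeff G T g" if g: "g \<in> carrier G" for g
  proof (rule LIM_zero_cancel, rule Lim_null_comparison)
    show "\<forall>\<^sub>F n in sequentially. cmod ((if g \<in> F' n then s' n g else 0) - fourier_coeff G T g) \<le> 1 / Suc n"
    proof (intro always_eventually allI)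
      fix n
      let ?D = "op_diff T (lin_comb G (F' n) (s' n)) (delta \<one>)"
      have "cmod (?D g) \<le> l2_norm G ?D"
        using L2_set_le_l2_norm[of ?D G "{g}"] S'[of n] delta_one_l2 g by (auto simp: op_bound_def)
      also have "\<dots> \<le> 1 / Suc n"
        using S'[of n] delta_one_l2 by (auto simp: op_bound_def)
      finally show "cmod ((if g \<in> F' n then s' n g else 0) - fourier_coeff G T g) \<le> 1 / Suc n"
        using g F' by (simp add: op_diff_def lin_comb_delta_one fourier_coeff_eq norm_minus_commute)
    qed
    show "(\<lambda>n. 1 / real (Suc n)) \<longlonglongrightarrow> 0"
      by (rule LIMSEQ_Suc) (rule lim_1_over_n)
  qed
  have "conv_bound (\<lambda>g. fourier_coeff G T g - (if g \<in> F then s g else 0)) (0 + \<epsilon>)"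
  proof (rule conv_bound_LIMSEQ)
    show "conv_bound (\<lambda>g. (if g \<in> F' n then s' n g else 0) - (if g \<in> F then s g else 0)) (1 / Suc n + \<epsilon>)" for n
      using op_bound_add[OF op_bound_diff_commute[OF S'[of n]] S] F F' \<epsilon>
      by (subst op_bound_op_diff_iff[symmetric]) auto
    show "(\<lambda>n. (if g \<in> F' n then s' n g else 0) - (if g \<in> F then s g else 0))
        \<longlonglongrightarrow> fourier_coeff G T g - (if g \<in> F then s g else 0)" if "g \<in> carrier G" for g
      by (intro tendsto_intros lim that)
    show "(\<lambda>n. 1 / real (Suc n) + \<epsilon>) \<longlonglongrightarrow> 0 + \<epsilon>"
      by (intro tendsto_intros LIMSEQ_Suc[of "\<lambda>n. 1 / real n"] lim_1_over_n)
  qed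
  then show ?thesis
    using F S by auto
qed

lemma fourier_coeff_l2_bound:
  assumes "T \<in> reduced_C_star G"
  shows "\<exists>M. \<forall>H. finite H \<and> H \<subseteq> carrier G \<longrightarrow> (\<Sum>g\<in>H. (cmod (fourier_coeff G T g))\<^sup>2) \<le> M"
proof (intro exI allI impI)
  fix H assume H: "finite H \<and> H \<subseteq> carrier G"
  have T1: "T (delta \<one>) \<in> l2 G"
    using assms delta_one_l2 by (auto simp: reduced_C_star_def bounded_op_def)
  have "L2_set (\<lambda>g. cmod (fourier_coeff G T g)) H = L2_set (\<lambda>g. cmod (T (delta \<one>) g)) H"
    using H by (intro L2_set_cong) (auto simp: fourier_coeff_eq subset_iff)
  also have "\<dots> \<le> l2_norm G (T (delta \<one>))"
    using H by (intro L2_set_le_l2_norm T1) auto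
  finally show "(\<Sum>g\<in>H. (cmod (fourier_coeff G T g))\<^sup>2) \<le> (l2_norm G (T (delta \<one>)))\<^sup>2"
    using power_mono[of "L2_set (\<lambda>g. cmod (fourier_coeff G T g)) H" _ 2] by (simp add: L2_set_power2)
qed

end

section \<open>Random signs\<close>

text \<open>A choice of signs is encoded by the set where it is negative, so that expectations
  become sums over \<open>Pow B\<close>, left without the factor
  \<open>1 / 2 ^ card B\<close>.\<close>

definition flip :: "'a set \<Rightarrow> 'a \<Rightarrow> real" where
  "flip D g = (if g \<in> D then - 1 else 1)"

definition walsh :: "'a set \<Rightarrow> 'a set \<Rightarrow> real" where
  "walsh S D = (\<Prod>g\<in>S. flip D g)"

lemma sum_Pow_insert:
  fixes F :: "'a set \<Rightarrow> 'c :: comm_monoid_add"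
  assumes "finite B" "b \<notin> B"
  shows "(\<Sum>D\<in>Pow (insert b B). F D) = (\<Sum>D\<in>Pow B. F D + F (insert b D))"
proof -
  have "inj_on (insert b) (Pow B)"
    using assms(2) by (auto simp: inj_on_def)
  then have "(\<Sum>D\<in>insert b ` Pow B. F D) = (\<Sum>D\<in>Pow B. F (insert b D))"
    by (simp add: sum.reindex)
  moreover have "Pow B \<inter> insert b ` Pow B = {}"
    using assms(2) by auto
  ultimately show ?thesis
    using assms by (simp add: Pow_insert sum.union_disjoint sum.distrib)
qed

text \<open>Toggling the membership in \<open>D\<close> of one fixed element of \<open>S\<close>
  reverses the sign of \<open>walsh S D\<close>, so the terms cancel in pairs.\<close>

lemma sum_walsh:
  assumes "finite B" "S \<subseteq> B"
  shows "(\<Sum>D\<in>Pow B. walsh S D) = (if S = {} then 2 ^ card B else 0)"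
proof (cases "S = {}")
  case True
  then show ?thesis
    using assms by (simp add: walsh_def card_Pow)
next
  case False
  then obtain b where b: "b \<in> S"
    by blast
  have fin: "finite S" "finite (B - {b})"
    using assms finite_subset by auto
  have "walsh S D + walsh S (insert b D) = 0" if "D \<subseteq> B - {b}" for D
  proof -
    have "(\<Prod>g\<in>S - {b}. flip (insert b D) g) = (\<Prod>g\<in>S - {b}. flip D g)"
      by (intro prod.cong) (auto simp: flip_def)
    then show ?thesis
      using that b fin by (auto simp: walsh_def prod.remove[of S b] flip_def)
  qed
  then have "(\<Sum>D\<in>Pow (insert b (B - {b})). walsh S D) = 0"
    using fin by (subst sum_Pow_insert) auto
  moreover have "insert b (B - {b}) = B"
    using b assms by blast
  ultimately show ?thesis
    using False by simp
qed

lemma walsh_mult: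
  assumes "finite S" "finite S'"
  shows "walsh S D * walsh S' D = walsh (sym_diff S S') D"
proof -
  have sq: "(\<Prod>g\<in>S \<inter> S'. flip D g) * (\<Prod>g\<in>S \<inter> S'. flip D g) = 1"
    unfolding prod.distrib[symmetric] by (rule prod.neutral) (auto simp: flip_def)
  have "walsh S D = walsh (S - S') D * walsh (S \<inter> S') D"
    unfolding walsh_def using assms by (metis prod.Int_Diff mult.commute)
  moreover have "walsh S' D = walsh (S' - S) D * walsh (S \<inter> S') D"
    unfolding walsh_def using assms by (metis prod.Int_Diff mult.commute Int_commute)
  moreover have "walsh (sym_diff S S') D = walsh (S - S') D * walsh (S' - S) D"
    unfolding walsh_def using assms by (intro prod.union_disjoint) auto
  ultimately show ?thesis
    using sq by (simp add: walsh_def mult_ac)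
qed

lemma sum_walsh_mult:
  assumes "finite B" "S \<subseteq> B" "S' \<subseteq> B"
  shows "(\<Sum>D\<in>Pow B. walsh S D * walsh S' D) = (if S = S' then 2 ^ card B else 0)"
proof -
  have "(\<Sum>D\<in>Pow B. walsh S D * walsh S' D) = (\<Sum>D\<in>Pow B. walsh (sym_diff S S') D)"
    using assms by (intro sum.cong refl walsh_mult) (auto intro: finite_subset)
  also have "\<dots> = (if sym_diff S S' = {} then 2 ^ card B else 0)"
    using assms by (intro sum_walsh) auto
  finally show ?thesis
    by auto
qed

lemma walsh_parseval:
  fixes \<gamma> :: "'a set \<Rightarrow> complex"
  assumes "finite B"
  shows "(\<Sum>D\<in>Pow B. (cmod (\<Sum>S\<in>Pow B. \<gamma> S * of_real (walsh S D)))\<^sup>2) = 2 ^ card B * (\<Sum>S\<in>Pow B. (cmod (\<gamma> S))\<^sup>2)"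
proof -
  have "complex_of_real (\<Sum>D\<in>Pow B. (cmod (\<Sum>S\<in>Pow B. \<gamma> S * of_real (walsh S D)))\<^sup>2)
     = (\<Sum>D\<in>Pow B. \<Sum>S\<in>Pow B. \<Sum>S'\<in>Pow B. \<gamma> S * cnj (\<gamma> S') * of_real (walsh S D * walsh S' D))"
    by (simp only: of_real_sum complex_norm_square cnj_sum complex_cnj_mult sum_product)
      (intro sum.cong refl, simp add: mult_ac)
  also have "\<dots> = (\<Sum>S\<in>Pow B. \<Sum>S'\<in>Pow B. \<Sum>D\<in>Pow B. \<gamma> S * cnj (\<gamma> S') * of_real (walsh S D * walsh S' D))"
    by (subst sum.swap) (intro sum.cong refl sum.swap)
  also have "\<dots> = (\<Sum>S\<in>Pow B. \<Sum>S'\<in>Pow B. if S = S' then \<gamma> S * cnj (\<gamma> S') * 2 ^ card B else 0)"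
  proof (intro sum.cong refl)
    fix S S' assume "S \<in> Pow B" "S' \<in> Pow B"
    then have *: "complex_of_real (\<Sum>D\<in>Pow B. walsh S D * walsh S' D) = (if S = S' then 2 ^ card B else 0)"
      using sum_walsh_mult[OF assms, of S S'] by auto
    show "(\<Sum>D\<in>Pow B. \<gamma> S * cnj (\<gamma> S') * of_real (walsh S D * walsh S' D))
        = (if S = S' then \<gamma> S * cnj (\<gamma> S') * 2 ^ card B else 0)"
      unfolding sum_distrib_left[symmetric] of_real_sum[symmetric] * by simp
  qed
  also have "\<dots> = (\<Sum>S\<in>Pow B. \<gamma> S * cnj (\<gamma> S) * 2 ^ card B)"
    using assms by simp
  also have "\<dots> = complex_of_real (2 ^ card B * (\<Sum>S\<in>Pow B. (cmod (\<gamma> S))\<^sup>2))"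
    by (simp only: complex_norm_square[symmetric]) (simp add: sum_distrib_left mult_ac)
  finally show ?thesis
    by (simp only: of_real_eq_iff)
qed

text \<open>\<open>S\<close> enters \<open>walsh S D\<close> as a character for symmetric
  difference; hence the coefficients of a product are convolved.\<close>

lemma sum_walsh_product:
  fixes f g :: "'a set \<Rightarrow> 'c :: {comm_ring_1, real_algebra_1}"
  assumes "finite B"
  shows "(\<Sum>S\<in>Pow B. f S * of_real (walsh S D)) * (\<Sum>S\<in>Pow B. g S * of_real (walsh S D))
    = (\<Sum>T\<in>Pow B. (\<Sum>S\<in>Pow B. f S * g (sym_diff S T)) * of_real (walsh T D))"
proof -
  have "(\<Sum>S\<in>Pow B. f S * of_real (walsh S D)) * (\<Sum>S\<in>Pow B. g S * of_real (walsh S D))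
     = (\<Sum>S\<in>Pow B. \<Sum>S'\<in>Pow B. f S * g S' * of_real (walsh S D * walsh S' D))"
    by (simp only: sum_product) (intro sum.cong refl, simp add: mult_ac)
  also have "\<dots> = (\<Sum>S\<in>Pow B. \<Sum>S'\<in>Pow B. f S * g S' * of_real (walsh (sym_diff S S') D))"
    using assms by (intro sum.cong refl) (auto simp: walsh_mult finite_subset)
  also have "\<dots> = (\<Sum>S\<in>Pow B. \<Sum>T\<in>Pow B. f S * g (sym_diff S T) * of_real (walsh T D))"
  proof (rule sum.cong[OF refl])
    fix S assume S: "S \<in> Pow B"
    have inv: "sym_diff S (sym_diff S T) = T" for T
      by auto
    show "(\<Sum>S'\<in>Pow B. f S * g S' * of_real (walsh (sym_diff S S') D))
        = (\<Sum>T\<in>Pow B. f S * g (sym_diff S T) * of_real (walsh T D))"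
      by (rule sum.reindex_bij_witness[where i = "sym_diff S" and j = "sym_diff S"])
        (use S inv in auto)
  qed
  also have "\<dots> = (\<Sum>T\<in>Pow B. \<Sum>S\<in>Pow B. f S * g (sym_diff S T) * of_real (walsh T D))"
    by (rule sum.swap)
  finally show ?thesis
    by (simp only: sum_distrib_right)
qed

section \<open>Even moments of scalar random sums (Khintchine's inequality)\<close>

lemma power_add_power_diff:
  fixes x y :: real
  shows "(x + y) ^ (2 * p) + (x - y) ^ (2 * p)
    = 2 * (\<Sum>j\<le>p. real (2 * p choose (2 * j)) * y ^ (2 * j) * x ^ (2 * (p - j)))"
proof -
  let ?f = "\<lambda>k. real (2 * p choose k) * y ^ k * x ^ (2 * p - k) + real (2 * p choose k) * (- y) ^ k * x ^ (2 * p - k)"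
  have "(x + y) ^ (2 * p) + (x - y) ^ (2 * p) = (y + x) ^ (2 * p) + (- y + x) ^ (2 * p)"
    by (simp add: add.commute)
  also have "\<dots> = (\<Sum>k\<le>2 * p. ?f k)"
    by (simp only: binomial_ring sum.distrib)
  also have "\<dots> = (\<Sum>k\<in>(\<lambda>j. 2 * j) ` {..p}. ?f k)"
  proof (rule sum.mono_neutral_right)
    show "\<forall>k\<in>{..2 * p} - (\<lambda>j. 2 * j) ` {..p}. ?f k = 0"
    proof
      fix k assume k: "k \<in> {..2 * p} - (\<lambda>j. 2 * j) ` {..p}"
      have "odd k"
      proof
        assume "even k"
        then have "k = 2 * (k div 2)" "k div 2 \<le> p"
          using k by auto
        then show False
          using k by blast
      qed
      then show "?f k = 0"
        by simp
    qed
  qed auto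
  also have "\<dots> = (\<Sum>j\<le>p. ?f (2 * j))"
    by (subst sum.reindex) (auto simp: inj_on_def)
  also have "\<dots> = 2 * (\<Sum>j\<le>p. real (2 * p choose (2 * j)) * y ^ (2 * j) * x ^ (2 * (p - j)))"
    by (simp add: sum_distrib_left diff_mult_distrib diff_mult_distrib2 mult_ac)
  finally show ?thesis .
qed

text \<open>The product of the odd numbers below \<open>2 * p\<close>, which is the moment of order
  \<open>2 * p\<close> of a standard Gaussian variable.\<close>

definition gauss_moment :: "nat \<Rightarrow> real" where
  "gauss_moment p = fact (2 * p) / (2 ^ p * fact p)"

lemma two_power_fact_le: "2 ^ j * fact j \<le> (fact (2 * j) :: real)"
proof (induction j)
  case (Suc j)
  have "2 ^ Suc j * fact (Suc j) = (2 * real j + 2) * (2 ^ j * fact j :: real)"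
    by (simp add: algebra_simps)
  also have "\<dots> \<le> (2 * real j + 2) * fact (2 * j)"
    by (intro mult_left_mono Suc) auto
  also have "\<dots> \<le> (2 * real j + 2) * ((2 * real j + 1) * fact (2 * j))"
    by (intro mult_left_mono) (auto simp: mult_le_cancel_right1)
  also have "\<dots> = fact (2 * Suc j)"
    by (simp add: algebra_simps)
  finally show ?case .
qed simp

text \<open>The quotient of the two sides is \<open>gauss_moment j\<close>, which is at least one.
  This is the comparison that closes the induction in \<open>khintchine\<close>.\<close>

lemma gauss_moment_binomial:
  assumes "j \<le> p"
  shows "real (2 * p choose (2 * j)) * gauss_moment (p - j) \<le> gauss_moment p * real (p choose j)"
proof -
  have "real (2 * p choose (2 * j)) * gauss_moment (p - j)
      = fact (2 * p) / (fact (2 * j) * (2 ^ (p - j) * fact (p - j)))"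
    using assms by (subst binomial_fact) (simp_all add: gauss_moment_def diff_mult_distrib2)
  also have "\<dots> \<le> fact (2 * p) / ((2 ^ j * fact j) * (2 ^ (p - j) * fact (p - j)))"
    using two_power_fact_le[of j] by (intro divide_left_mono mult_right_mono) auto
  also have "\<dots> = fact (2 * p) / ((2 ^ j * 2 ^ (p - j)) * (fact j * fact (p - j)))"
    by (simp add: mult_ac)
  also have "2 ^ j * 2 ^ (p - j) = (2 :: real) ^ p"
    using assms by (simp flip: power_add)
  also have "fact (2 * p) / (2 ^ p * (fact j * fact (p - j))) = gauss_moment p * real (p choose j)"
    using assms by (simp add: binomial_fact gauss_moment_def)
  finally show ?thesis .
qed

lemma gauss_moment_le: "gauss_moment p \<le> real p ^ p"
proof -
  have "fact (2 * p) div fact (2 * p - p) \<le> (2 * p) ^ p"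
    by (rule fact_div_fact_le_pow) simp
  then have "real (fact (2 * p) div fact p) \<le> real ((2 * p) ^ p)"
    by (simp only: of_nat_le_iff mult_2 diff_add_inverse)
  moreover have "real (fact (2 * p) div fact p) = fact (2 * p) / fact p"
    by (subst real_of_nat_div) (auto intro: fact_dvd)
  ultimately have "fact (2 * p) / fact p \<le> (2 * real p) ^ p"
    by simp
  then show ?thesis
    by (simp add: gauss_moment_def power_mult_distrib field_simps)
qed

text \<open>Induction on \<open>B\<close>, summing over the sign of the new element: odd powers
  cancel, and \<open>gauss_moment_binomial\<close> turns the even ones into the binomial expansion
  of \<open>((r b)\<^sup>2 + v) ^ p\<close>.\<close>

lemma khintchine:
  fixes r :: "'a \<Rightarrow> real"
  assumes "finite B"
  shows "(\<Sum>D\<in>Pow B. (\<Sum>b\<in>B. flip D b * r b) ^ (2 * p)) \<le> 2 ^ card B * (gauss_moment p * (\<Sum>b\<in>B. (r b)\<^sup>2) ^ p)"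
  using assms
proof (induction B arbitrary: p rule: finite_induct)
  case empty
  then show ?case
    by (cases p) (auto simp: gauss_moment_def)
next
  case (insert b B)
  define s where "s D = (\<Sum>b\<in>B. flip D b * r b)" for D
  define v where "v = (\<Sum>b\<in>B. (r b)\<^sup>2)"
  have v0: "0 \<le> v"
    by (simp add: v_def sum_nonneg)
  have IH: "(\<Sum>D\<in>Pow B. s D ^ (2 * p)) \<le> 2 ^ card B * (gauss_moment p * v ^ p)" for p
    using insert.IH by (simp add: s_def v_def)
  have "(\<Sum>D\<in>Pow (insert b B). (\<Sum>b\<in>insert b B. flip D b * r b) ^ (2 * p))
     = (\<Sum>D\<in>Pow B. (s D + r b) ^ (2 * p) + (s D - r b) ^ (2 * p))"
  proof (subst sum_Pow_insert[OF insert.hyps], rule sum.cong[OF refl])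
    fix D assume D: "D \<in> Pow B"
    have "(\<Sum>b'\<in>B. flip (insert b D) b' * r b') = s D"
      unfolding s_def using insert.hyps by (intro sum.cong) (auto simp: flip_def)
    then show "(\<Sum>b\<in>insert b B. flip D b * r b) ^ (2 * p) + (\<Sum>b'\<in>insert b B. flip (insert b D) b' * r b') ^ (2 * p)
       = (s D + r b) ^ (2 * p) + (s D - r b) ^ (2 * p)"
      using D insert.hyps by (auto simp: flip_def[of _ b] s_def add.commute)
  qed
  also have "\<dots> = (\<Sum>D\<in>Pow B. 2 * (\<Sum>j\<le>p. real (2 * p choose (2 * j)) * r b ^ (2 * j) * s D ^ (2 * (p - j))))"
    by (simp only: power_add_power_diff)
  also have "\<dots> = 2 * (\<Sum>j\<le>p. real (2 * p choose (2 * j)) * r b ^ (2 * j) * (\<Sum>D\<in>Pow B. s D ^ (2 * (p - j))))"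
    by (simp only: sum_distrib_left) (rule sum.swap)
  also have "\<dots> \<le> 2 * (\<Sum>j\<le>p. real (2 * p choose (2 * j)) * r b ^ (2 * j) * (2 ^ card B * (gauss_moment (p - j) * v ^ (p - j))))"
    by (intro mult_left_mono sum_mono IH mult_nonneg_nonneg) (auto simp: power_mult)
  also have "\<dots> = 2 * 2 ^ card B * (\<Sum>j\<le>p. (real (2 * p choose (2 * j)) * gauss_moment (p - j)) * ((r b)\<^sup>2 ^ j * v ^ (p - j)))"
    by (simp only: power_mult[of "r b" 2]) (simp add: sum_distrib_left mult_ac)
  also have "\<dots> \<le> 2 * 2 ^ card B * (\<Sum>j\<le>p. (gauss_moment p * real (p choose j)) * ((r b)\<^sup>2 ^ j * v ^ (p - j)))"
    by (intro mult_left_mono sum_mono mult_right_mono gauss_moment_binomial mult_nonneg_nonneg zero_le_power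
        zero_le_power2 v0) auto
  also have "\<dots> = 2 * 2 ^ card B * (gauss_moment p * ((r b)\<^sup>2 + v) ^ p)"
    by (simp add: binomial_ring sum_distrib_left mult_ac)
  finally show ?case
    using insert.hyps by (simp add: v_def)
qed

definition signed :: "'a set \<Rightarrow> ('a \<Rightarrow> complex) \<Rightarrow> 'a set \<Rightarrow> 'a \<Rightarrow> complex" where
  "signed B a D g = (if g \<in> B then of_real (flip D g) * a g else 0)"

section \<open>Moments of random sums supported in balls\<close>

locale length_group = group G for G (structure) +
  fixes L :: "'a \<Rightarrow> nat"
  assumes L_one: "L \<one> = 0"
    and L_mult: "\<And>x y. x \<in> carrier G \<Longrightarrow> y \<in> carrier G \<Longrightarrow> L (x \<otimes> y) \<le> L x + L y"
    and L_inv: "\<And>x. x \<in> carrier G \<Longrightarrow> L (inv x) = L x"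
    and finite_ball: "\<And>n. finite {g \<in> carrier G. L g \<le> n}"
begin

definition lball :: "nat \<Rightarrow> 'a set" where
  "lball n = {g \<in> carrier G. L g \<le> n}"

text \<open>The inequality of Haagerup and Jolissaint. Taking \<open>A\<close> at least one allows
  \<open>A \<le> A ^ p\<close> when a root of order \<open>p\<close> is extracted.\<close>

definition rapid_decay :: bool where
  "rapid_decay \<longleftrightarrow> (\<exists>A\<ge>1. \<exists>s :: nat. \<forall>n c. (\<forall>g\<in>carrier G. n < L g \<longrightarrow> c g = 0) \<longrightarrow>
     conv_bound c (A * (real n + 1) ^ s * L2_set (\<lambda>g. cmod (c g)) (lball n)))"

lemma finite_lball [simp]: "finite (lball n)"
  by (simp add: lball_def finite_ball)

lemma lball_subset: "lball n \<subseteq> carrier G"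
  by (auto simp: lball_def)

lemma star_square_support:
  assumes "\<And>g. g \<in> carrier G \<Longrightarrow> n < L g \<Longrightarrow> c g = 0" "g \<in> carrier G" "2 * n < L g"
  shows "star_square c g = 0"
  unfolding star_square_def
proof (rule sum.neutral, rule ballI)
  fix u assume "u \<in> {u \<in> carrier G. c u \<noteq> 0}"
  then have u: "u \<in> carrier G" "L u \<le> n"
    using assms(1) not_le by blast+
  have "L g \<le> L (inv u) + L (u \<otimes> g)"
    using L_mult[of "inv u" "u \<otimes> g"] u assms(2) by (simp flip: m_assoc)
  then have "c (u \<otimes> g) = 0"
    using u assms L_inv[of u] by (intro assms(1)) auto
  then show "cnj (c u) * c (u \<otimes> g) = 0"
    by simp
qed

lemma star_square_iter_support:
  assumes "\<And>g. g \<in> carrier G \<Longrightarrow> n < L g \<Longrightarrow> c g = 0" "g \<in> carrier G" "2 ^ k * n < L g"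
  shows "(star_square ^^ k) c g = 0"
  using assms(2,3)
proof (induction k arbitrary: g)
  case (Suc k)
  show ?case
    using star_square_support[of "2 ^ k * n" "(star_square ^^ k) c" g] Suc by (simp add: mult.assoc)
qed (use assms(1) in simp)

text \<open>The C*-identity repeated \<open>k\<close> times. The bound on the support makes every
  iterate finitely supported.\<close>

lemma conv_bound_iter_root:
  assumes "\<And>g. g \<in> carrier G \<Longrightarrow> n < L g \<Longrightarrow> c g = 0"
    and "conv_bound ((star_square ^^ k) c) (K ^ (2 ^ k))" "0 \<le> K"
  shows "conv_bound c K"
  using assms(2)
proof (induction k)
  case (Suc k)
  have "conv_bound ((star_square ^^ k) c) (K ^ (2 ^ k))"
  proof (rule conv_bound_sqrt)
    show "conv_bound (star_square ((star_square ^^ k) c)) ((K ^ (2 ^ k))\<^sup>2)"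
      using Suc.prems by (simp add: power2_eq_square mult_2 power_add)
    show "(star_square ^^ k) c g = 0" if "g \<in> carrier G" "g \<notin> lball (2 ^ k * n)" for g
      using star_square_iter_support[OF assms(1)] that by (auto simp: lball_def not_le)
  qed (use assms(3) lball_subset in auto)
  then show ?case
    by (rule Suc.IH)
qed simp

text \<open>
  The coefficients of the iterated squares of a random sum are polynomials in the signs.  Their Walsh
  coefficients, summed over the group, are dominated by those of a power of a scalar random sum,
  because a product of group elements contributes to a single coefficient.
\<close>

lemma walsh_dominated:
  fixes a :: "'a \<Rightarrow> complex"
  assumes B: "B \<subseteq> lball n"
  shows "\<exists>\<alpha> \<beta>.
    (\<forall>D g. D \<subseteq> B \<longrightarrow> g \<in> carrier G \<longrightarrow> (star_square ^^ k) (signed B a D) g = (\<Sum>S\<in>Pow B. \<alpha> g S * of_real (walsh S D))) \<and>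
    (\<forall>D. D \<subseteq> B \<longrightarrow> (\<Sum>b\<in>B. flip D b * cmod (a b)) ^ (2 ^ k) = (\<Sum>S\<in>Pow B. \<beta> S * walsh S D)) \<and>
    (\<forall>S F. S \<subseteq> B \<longrightarrow> finite F \<longrightarrow> F \<subseteq> carrier G \<longrightarrow> (\<Sum>g\<in>F. cmod (\<alpha> g S)) \<le> \<beta> S)"
proof (induction k)
  have finB: "finite B"
    using B finite_lball finite_subset by blast
  case 0
  \<comment> \<open>In degree one, the element \<open>g\<close> carries the sign of \<open>g\<close>
    and no other.\<close>
  let ?\<alpha> = "\<lambda>g S. if g \<in> B \<and> S = {g} then a g else 0"
  let ?\<beta> = "\<lambda>S. \<Sum>b\<in>B. if S = {b} then cmod (a b) else 0"
  have "signed B a D g = (\<Sum>S\<in>Pow B. ?\<alpha> g S * of_real (walsh S D))" for D g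
  proof -
    have "(\<Sum>S\<in>Pow B. ?\<alpha> g S * of_real (walsh S D))
       = (\<Sum>S\<in>Pow B. if S = {g} then (if g \<in> B then a g * of_real (walsh {g} D) else 0) else 0)"
      by (intro sum.cong) auto
    then show ?thesis
      using finB by (simp add: signed_def walsh_def)
  qed
  moreover have "(\<Sum>b\<in>B. flip D b * cmod (a b)) = (\<Sum>S\<in>Pow B. ?\<beta> S * walsh S D)" for D
  proof -
    have "(\<Sum>S\<in>Pow B. ?\<beta> S * walsh S D) = (\<Sum>b\<in>B. \<Sum>S\<in>Pow B. if S = {b} then cmod (a b) * walsh {b} D else 0)"
      by (subst sum.swap) (auto simp: sum_distrib_right intro!: sum.cong)
    then show ?thesis
      using finB by (simp add: walsh_def mult.commute)
  qed
  moreover have "(\<Sum>g\<in>F. cmod (?\<alpha> g S)) \<le> ?\<beta> S" if "finite F" for S F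
  proof -
    have "(\<Sum>g\<in>F. cmod (?\<alpha> g S)) = (\<Sum>g\<in>F \<inter> B. if S = {g} then cmod (a g) else 0)"
      using that by (intro sum.mono_neutral_cong_right) auto
    also have "\<dots> \<le> ?\<beta> S"
      using finB by (intro sum_mono2) auto
    finally show ?thesis .
  qed
  ultimately show ?case
    by (intro exI[of _ ?\<alpha>] exI[of _ ?\<beta>] conjI allI impI) simp_all
next
  have finB: "finite B"
    using B finite_lball finite_subset by blast
  case (Suc k)
  obtain \<alpha> \<beta> where
    \<alpha>\<beta>: "\<forall>D g. D \<subseteq> B \<longrightarrow> g \<in> carrier G \<longrightarrow> (star_square ^^ k) (signed B a D) g = (\<Sum>S\<in>Pow B. \<alpha> g S * of_real (walsh S D))"
      "\<forall>D. D \<subseteq> B \<longrightarrow> (\<Sum>b\<in>B. flip D b * cmod (a b)) ^ (2 ^ k) = (\<Sum>S\<in>Pow B. \<beta> S * walsh S D)"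
      "\<forall>S F. S \<subseteq> B \<longrightarrow> finite F \<longrightarrow> F \<subseteq> carrier G \<longrightarrow> (\<Sum>g\<in>F. cmod (\<alpha> g S)) \<le> \<beta> S"
    using Suc.IH by (elim exE conjE)
  have \<alpha>: "\<And>D g. D \<subseteq> B \<Longrightarrow> g \<in> carrier G \<Longrightarrow> (star_square ^^ k) (signed B a D) g = (\<Sum>S\<in>Pow B. \<alpha> g S * of_real (walsh S D))"
    and \<beta>: "\<And>D. D \<subseteq> B \<Longrightarrow> (\<Sum>b\<in>B. flip D b * cmod (a b)) ^ (2 ^ k) = (\<Sum>S\<in>Pow B. \<beta> S * walsh S D)"
    and dom: "\<And>S F. S \<subseteq> B \<Longrightarrow> finite F \<Longrightarrow> F \<subseteq> carrier G \<Longrightarrow> (\<Sum>g\<in>F. cmod (\<alpha> g S)) \<le> \<beta> S"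
    using \<alpha>\<beta> by simp_all
  let ?N = "lball (2 ^ k * n)"
  have \<beta>0: "0 \<le> \<beta> S" if "S \<subseteq> B" for S
    using dom[of S "{}"] that by simp
  define \<alpha>' where "\<alpha>' g T = (\<Sum>u\<in>?N. \<Sum>S\<in>Pow B. cnj (\<alpha> u S) * \<alpha> (u \<otimes> g) (sym_diff S T))" for g T
  define \<beta>' where "\<beta>' T = (\<Sum>S\<in>Pow B. \<beta> S * \<beta> (sym_diff S T))" for T
  have "(star_square ^^ Suc k) (signed B a D) g = (\<Sum>T\<in>Pow B. \<alpha>' g T * of_real (walsh T D))"
    if D: "D \<subseteq> B" and g: "g \<in> carrier G" for D g
  proof -
    have sup: "signed B a D g = 0" if "g \<in> carrier G" "n < L g" for g
      using that B by (auto simp: signed_def lball_def)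
    have "(star_square ^^ Suc k) (signed B a D) g
        = (\<Sum>u\<in>?N. cnj ((star_square ^^ k) (signed B a D) u) * (star_square ^^ k) (signed B a D) (u \<otimes> g))"
      unfolding funpow.simps comp_def
      by (intro star_square_eq lball_subset star_square_iter_support[OF sup]) (auto simp: lball_def finite_ball)
    also have "\<dots> = (\<Sum>u\<in>?N. (\<Sum>S\<in>Pow B. cnj (\<alpha> u S) * of_real (walsh S D)) * (\<Sum>S\<in>Pow B. \<alpha> (u \<otimes> g) S * of_real (walsh S D)))"
      using lball_subset g by (intro sum.cong refl) (auto simp: \<alpha>[OF D] subset_iff)
    also have "\<dots> = (\<Sum>u\<in>?N. \<Sum>T\<in>Pow B. (\<Sum>S\<in>Pow B. cnj (\<alpha> u S) * \<alpha> (u \<otimes> g) (sym_diff S T)) * of_real (walsh T D))"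
      by (simp only: sum_walsh_product[OF finB])
    also have "\<dots> = (\<Sum>T\<in>Pow B. \<alpha>' g T * of_real (walsh T D))"
      unfolding \<alpha>'_def by (subst sum.swap) (simp only: sum_distrib_right)
    finally show ?thesis .
  qed
  moreover have "(\<Sum>b\<in>B. flip D b * cmod (a b)) ^ (2 ^ Suc k) = (\<Sum>T\<in>Pow B. \<beta>' T * walsh T D)" if "D \<subseteq> B" for D
    using sum_walsh_product[OF finB, of \<beta> D \<beta>] by (simp add: \<beta>'_def mult_2 power_add \<beta>[OF that])
  moreover have "(\<Sum>g\<in>F. cmod (\<alpha>' g T)) \<le> \<beta>' T" if T: "T \<subseteq> B" and F: "finite F" "F \<subseteq> carrier G" for T F
  proof -
    have "(\<Sum>g\<in>F. cmod (\<alpha>' g T)) \<le> (\<Sum>g\<in>F. \<Sum>u\<in>?N. \<Sum>S\<in>Pow B. cmod (\<alpha> u S) * cmod (\<alpha> (u \<otimes> g) (sym_diff S T)))"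
      unfolding \<alpha>'_def by (intro sum_mono sum_norm_le) (simp add: norm_mult)
    also have "\<dots> = (\<Sum>u\<in>?N. \<Sum>g\<in>F. \<Sum>S\<in>Pow B. cmod (\<alpha> u S) * cmod (\<alpha> (u \<otimes> g) (sym_diff S T)))"
      by (rule sum.swap)
    also have "\<dots> = (\<Sum>u\<in>?N. \<Sum>S\<in>Pow B. \<Sum>g\<in>F. cmod (\<alpha> u S) * cmod (\<alpha> (u \<otimes> g) (sym_diff S T)))"
      by (rule sum.cong[OF refl], rule sum.swap)
    also have "\<dots> = (\<Sum>S\<in>Pow B. \<Sum>u\<in>?N. \<Sum>g\<in>F. cmod (\<alpha> u S) * cmod (\<alpha> (u \<otimes> g) (sym_diff S T)))"
      by (rule sum.swap)
    also have "\<dots> = (\<Sum>S\<in>Pow B. \<Sum>u\<in>?N. cmod (\<alpha> u S) * (\<Sum>g\<in>F. cmod (\<alpha> (u \<otimes> g) (sym_diff S T))))"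
      by (simp only: sum_distrib_left)
    also have "\<dots> \<le> (\<Sum>S\<in>Pow B. \<Sum>u\<in>?N. cmod (\<alpha> u S) * \<beta> (sym_diff S T))"
    proof (intro sum_mono mult_left_mono)
      fix S u assume S: "S \<in> Pow B" and "u \<in> ?N"
      then have u: "u \<in> carrier G"
        using lball_subset by blast
      \<comment> \<open>Translation by \<open>u\<close> is injective, so the inner sum runs over
        distinct group elements and the induction hypothesis bounds it independently of
        \<open>u\<close>.\<close>
      have "inj_on (\<lambda>g. u \<otimes> g) F"
        using F u by (intro inj_on_left_mult)
      then have "(\<Sum>g\<in>F. cmod (\<alpha> (u \<otimes> g) (sym_diff S T))) = (\<Sum>h\<in>(\<lambda>g. u \<otimes> g) ` F. cmod (\<alpha> h (sym_diff S T)))"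
        by (simp add: sum.reindex)
      also have "\<dots> \<le> \<beta> (sym_diff S T)"
        using F u S T by (intro dom) auto
      finally show "(\<Sum>g\<in>F. cmod (\<alpha> (u \<otimes> g) (sym_diff S T))) \<le> \<beta> (sym_diff S T)" .
    qed auto
    also have "\<dots> \<le> \<beta>' T"
      unfolding \<beta>'_def sum_distrib_right[symmetric] using T lball_subset
      by (intro sum_mono mult_right_mono dom \<beta>0) auto
    finally show ?thesis .
  qed
  ultimately show ?case
    by (intro exI[of _ \<alpha>'] exI[of _ \<beta>'] conjI allI impI)
qed

text \<open>If every choice of signs failed, so would the average over all choices. Parseval turns
  the average into a sum of squared Walsh coefficients, the domination replaces them by those of a
  scalar random sum, Parseval leads back to the moment of order \<open>2 * 2 ^ k\<close> of that
  sum, and Khintchine bounds it.\<close>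

lemma exists_signs_moment:
  fixes a :: "'a \<Rightarrow> complex"
  assumes B: "B \<subseteq> lball n"
  shows "\<exists>D\<subseteq>B. (L2_set (\<lambda>g. cmod ((star_square ^^ k) (signed B a D) g))
      (lball (2 ^ k * n)))\<^sup>2 \<le> real (2 ^ k) ^ (2 ^ k) * (\<Sum>b\<in>B. (cmod (a b))\<^sup>2) ^ (2 ^ k)"
proof (rule ccontr)
  let ?N = "lball (2 ^ k * n)" and ?p = "2 ^ k :: nat"
  define M where "M = real ?p ^ ?p * (\<Sum>b\<in>B. (cmod (a b))\<^sup>2) ^ ?p"
  assume "\<not> ?thesis"
  then have contr: "M < (\<Sum>g\<in>?N. (cmod ((star_square ^^ k) (signed B a D) g))\<^sup>2)" if "D \<subseteq> B" for D
    using that unfolding L2_set_power2 M_def by (meson not_le)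
  have finB: "finite B"
    using B finite_lball finite_subset by blast
  obtain \<alpha> \<beta> where
    \<alpha>\<beta>: "\<forall>D g. D \<subseteq> B \<longrightarrow> g \<in> carrier G \<longrightarrow> (star_square ^^ k) (signed B a D) g = (\<Sum>S\<in>Pow B. \<alpha> g S * of_real (walsh S D))"
      "\<forall>D. D \<subseteq> B \<longrightarrow> (\<Sum>b\<in>B. flip D b * cmod (a b)) ^ (2 ^ k) = (\<Sum>S\<in>Pow B. \<beta> S * walsh S D)"
      "\<forall>S F. S \<subseteq> B \<longrightarrow> finite F \<longrightarrow> F \<subseteq> carrier G \<longrightarrow> (\<Sum>g\<in>F. cmod (\<alpha> g S)) \<le> \<beta> S"
    using walsh_dominated[OF B, of k a] by (elim exE conjE)
  have \<alpha>: "\<And>D g. D \<subseteq> B \<Longrightarrow> g \<in> carrier G \<Longrightarrow> (star_square ^^ k) (signed B a D) g = (\<Sum>S\<in>Pow B. \<alpha> g S * of_real (walsh S D))"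
    and \<beta>: "\<And>D. D \<subseteq> B \<Longrightarrow> (\<Sum>b\<in>B. flip D b * cmod (a b)) ^ (2 ^ k) = (\<Sum>S\<in>Pow B. \<beta> S * walsh S D)"
    and dom: "\<And>S F. S \<subseteq> B \<Longrightarrow> finite F \<Longrightarrow> F \<subseteq> carrier G \<Longrightarrow> (\<Sum>g\<in>F. cmod (\<alpha> g S)) \<le> \<beta> S"
    using \<alpha>\<beta> by simp_all
  have "2 ^ card B * M = (\<Sum>D\<in>Pow B. M)"
    using finB by (simp add: card_Pow)
  also have "\<dots> < (\<Sum>D\<in>Pow B. \<Sum>g\<in>?N. (cmod ((star_square ^^ k) (signed B a D) g))\<^sup>2)"
    using finB contr by (intro sum_strict_mono) auto
  also have "\<dots> = (\<Sum>D\<in>Pow B. \<Sum>g\<in>?N. (cmod (\<Sum>S\<in>Pow B. \<alpha> g S * of_real (walsh S D)))\<^sup>2)"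
    using lball_subset by (intro sum.cong refl) (auto simp: \<alpha> subset_iff)
  also have "\<dots> = (\<Sum>g\<in>?N. 2 ^ card B * (\<Sum>S\<in>Pow B. (cmod (\<alpha> g S))\<^sup>2))"
    by (subst sum.swap) (simp only: walsh_parseval[OF finB])
  also have "\<dots> = 2 ^ card B * (\<Sum>S\<in>Pow B. \<Sum>g\<in>?N. (cmod (\<alpha> g S))\<^sup>2)"
    by (subst sum.swap) (simp add: sum_distrib_left)
  also have "\<dots> \<le> 2 ^ card B * (\<Sum>S\<in>Pow B. (\<beta> S)\<^sup>2)"
  proof (intro mult_left_mono sum_mono)
    fix S assume S: "S \<in> Pow B"
    \<comment> \<open>The l2-norm over the group is at most the l1-norm, which is what
      \<open>dom\<close> controls.\<close>
    have "L2_set (\<lambda>g. cmod (\<alpha> g S)) ?N \<le> \<beta> S"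
      using S by (intro order_trans[OF L2_set_le_sum dom] lball_subset) auto
    then show "(\<Sum>g\<in>?N. (cmod (\<alpha> g S))\<^sup>2) \<le> (\<beta> S)\<^sup>2"
      using power_mono[of "L2_set (\<lambda>g. cmod (\<alpha> g S)) ?N" "\<beta> S" 2] by (simp add: L2_set_power2)
  qed auto
  also have "\<dots> = (\<Sum>D\<in>Pow B. (cmod (\<Sum>S\<in>Pow B. of_real (\<beta> S) * of_real (walsh S D)))\<^sup>2)"
    by (simp add: walsh_parseval[OF finB])
  also have "\<dots> = (\<Sum>D\<in>Pow B. ((\<Sum>b\<in>B. flip D b * cmod (a b)) ^ ?p)\<^sup>2)"
    by (intro sum.cong refl)
      (simp only: Pow_iff \<beta> of_real_mult[symmetric] of_real_sum[symmetric] norm_of_real power2_abs)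
  also have "\<dots> = (\<Sum>D\<in>Pow B. (\<Sum>b\<in>B. flip D b * cmod (a b)) ^ (2 * ?p))"
    by (simp only: power_even_eq)
  also have "\<dots> \<le> 2 ^ card B * (gauss_moment ?p * (\<Sum>b\<in>B. (cmod (a b))\<^sup>2) ^ ?p)"
    by (rule khintchine[OF finB])
  also have "\<dots> \<le> 2 ^ card B * M"
    unfolding M_def by (intro mult_left_mono mult_right_mono gauss_moment_le) (auto intro!: zero_le_power sum_nonneg)
  finally show False
    by simp
qed

end

section \<open>Rounding multipliers\<close>

context group
begin

text \<open>Removing the last of \<open>s + 1\<close> digits changes a weight by
  \<open>1 / 2 ^ (s + 1)\<close> at the odd numerators only, hence costs
  \<open>Q / 2 ^ (s + 1)\<close> with well chosen signs. These costs form a geometric series, so the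
  number of digits does not enter the final bound \<open>Q\<close>.\<close>

lemma dyadic_rounding:
  fixes a :: "'a \<Rightarrow> complex"
  assumes "finite B"
    and signs: "\<And>B'. B' \<subseteq> B \<Longrightarrow> \<exists>D\<subseteq>B'. conv_bound (signed B' a D) Q"
    and k: "\<And>g. k g \<le> (2 :: nat) ^ s"
  shows "\<exists>E\<subseteq>B. conv_bound (\<lambda>g. if g \<in> B then ((if g \<in> E then 1 else 0) - of_real (real (k g) / 2 ^ s)) * a g else 0)
    (Q * (1 - 1 / 2 ^ s))"
  using k
proof (induction s arbitrary: k)
  case 0
  have "k g = 0 \<or> k g = 1" for g
    using 0[of g] by auto
  then have "(if g \<in> B then ((if g \<in> {g \<in> B. k g = 1} then 1 else 0) - of_real (real (k g) / 2 ^ 0)) * a g else 0) = 0" for g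
    by (auto simp: split: if_splits)
  then show ?case
    using conv_bound_zero by (intro exI[of _ "{g \<in> B. k g = 1}"] conjI) (auto simp only: mem_Collect_eq subset_eq, simp)
next
  case (Suc s)
  define B' where "B' = {g \<in> B. odd (k g)}"
  obtain D where D: "D \<subseteq> B'" "conv_bound (signed B' a D) Q"
    using signs[of B'] by (auto simp: B'_def)
  \<comment> \<open>Odd numerators are rounded down on \<open>D\<close> and up elsewhere, so that
    the change is exactly the sign \<open>flip D\<close> times half a unit of the coarser
    grid.\<close>
  define k' where "k' g = (if odd (k g) \<and> g \<notin> D then Suc (k g div 2) else k g div 2)" for g
  have "k' g \<le> 2 ^ s" for g
    using Suc.prems[of g] by (auto simp: k'_def elim!: oddE)
  then obtain E where E: "E \<subseteq> B"
    "conv_bound (\<lambda>g. if g \<in> B then ((if g \<in> E then 1 else 0) - of_real (real (k' g) / 2 ^ s)) * a g else 0)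
      (Q * (1 - 1 / 2 ^ s))"
    using Suc.IH[of k'] by blast
  have step: "real (k' g) / 2 ^ s - real (k g) / 2 ^ Suc s = (if odd (k g) then flip D g / 2 ^ Suc s else 0)" for g
  proof (cases "odd (k g)")
    case True
    then obtain j where "k g = 2 * j + 1"
      by (elim oddE)
    then show ?thesis
      by (auto simp: k'_def flip_def field_simps)
  next
    case False
    then obtain j where "k g = 2 * j"
      by (metis evenE)
    then show ?thesis
      by (auto simp: k'_def field_simps)
  qed
  have "conv_bound (\<lambda>g. (if g \<in> B then ((if g \<in> E then 1 else 0) - of_real (real (k' g) / 2 ^ s)) * a g else 0)
        + of_real (1 / 2 ^ Suc s) * signed B' a D g)
      (Q * (1 - 1 / 2 ^ s) + cmod (of_real (1 / 2 ^ Suc s)) * Q)"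
    by (intro conv_bound_add conv_bound_scale E D)
  moreover have "Q * (1 - 1 / 2 ^ s) + cmod (of_real (1 / 2 ^ Suc s)) * Q = Q * (1 - 1 / 2 ^ Suc s)"
    unfolding norm_of_real by (simp add: field_simps)
  moreover have "(if g \<in> B then ((if g \<in> E then 1 else 0) - of_real (real (k' g) / 2 ^ s)) * a g else 0)
        + of_real (1 / 2 ^ Suc s) * signed B' a D g
      = (if g \<in> B then ((if g \<in> E then 1 else 0) - of_real (real (k g) / 2 ^ Suc s)) * a g else 0)" for g
  proof -
    have "real (k g) / 2 ^ Suc s = real (k' g) / 2 ^ s - (if odd (k g) then flip D g / 2 ^ Suc s else 0)"
      using step[of g] by linarith
    then show ?thesis
      by (simp only:) (auto simp: signed_def B'_def algebra_simps)
  qed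
  ultimately show ?case
    using E(1) by (intro exI[of _ E]) auto
qed

lemma random_rounding:
  fixes a :: "'a \<Rightarrow> complex"
  assumes B: "finite B" "B \<subseteq> carrier G"
    and signs: "\<forall>B'\<subseteq>B. \<exists>D\<subseteq>B'. conv_bound (signed B' a D) Q"
    and m: "\<forall>g\<in>B. 0 \<le> m g \<and> m g \<le> (1 :: real)" and \<delta>: "0 < \<delta>"
  shows "\<exists>E\<subseteq>B. conv_bound (\<lambda>g. if g \<in> B then ((if g \<in> E then 1 else 0) - of_real (m g)) * a g else 0) (Q + \<delta>)"
proof -
  \<comment> \<open>Replacing \<open>m\<close> by a multiple of \<open>1 / 2 ^ s\<close> costs at
    most \<open>A / 2 ^ s\<close> in l1-norm, which dominates the norm of the kernel;
    \<open>s\<close> is chosen to make this at most \<open>\<delta>\<close>.\<close>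
  define A where "A = (\<Sum>g\<in>B. cmod (a g))"
  obtain s where s: "A / \<delta> < 2 ^ s"
    using real_arch_pow[of 2] by auto
  define k where "k g = (if g \<in> B then nat \<lfloor>m g * 2 ^ s\<rfloor> else 0)" for g
  have k: "k g \<le> 2 ^ s" for g
  proof (cases "g \<in> B")
    case True
    then have "\<lfloor>m g * 2 ^ s\<rfloor> \<le> 2 ^ s"
      using bspec[OF m True] by (simp add: floor_le_iff) (smt (verit) mult_left_le_one_le mult_right_mono zero_le_power)
    then show ?thesis
      using True by (simp add: k_def nat_le_iff)
  qed (simp add: k_def)
  have near: "\<bar>real (k g) / 2 ^ s - m g\<bar> \<le> 1 / 2 ^ s" if "g \<in> B" for g
  proof -
    have "0 \<le> m g * 2 ^ s"
      using bspec[OF m that] by simp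
    then have "real (k g) = of_int \<lfloor>m g * 2 ^ s\<rfloor>"
      using that by (simp add: k_def)
    then have "\<bar>real (k g) - m g * 2 ^ s\<bar> \<le> 1"
      by linarith
    then have "\<bar>(real (k g) - m g * 2 ^ s) / 2 ^ s\<bar> \<le> 1 / 2 ^ s"
      by (simp add: abs_divide divide_right_mono)
    then show ?thesis
      by (simp add: diff_divide_distrib)
  qed
  have "\<exists>E\<subseteq>B. conv_bound (\<lambda>g. if g \<in> B then ((if g \<in> E then 1 else 0) - of_real (real (k g) / 2 ^ s)) * a g else 0)
    (Q * (1 - 1 / 2 ^ s))"
    by (rule dyadic_rounding[OF B(1) _ k]) (simp add: signs)
  then obtain E where E: "E \<subseteq> B" "conv_bound (\<lambda>g. if g \<in> B then ((if g \<in> E then 1 else 0) - of_real (real (k g) / 2 ^ s)) * a g else 0)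
    (Q * (1 - 1 / 2 ^ s))"
    by (elim exE conjE)
  let ?r = "\<lambda>g. if g \<in> B then of_real (real (k g) / 2 ^ s - m g) * a g else 0"
  have "conv_bound ?r (\<Sum>g\<in>B. cmod (?r g))"
    using B by (intro conv_bound_l1) auto
  moreover have "(\<Sum>g\<in>B. cmod (?r g)) \<le> \<delta>"
  proof -
    have "(\<Sum>g\<in>B. cmod (?r g)) \<le> (\<Sum>g\<in>B. 1 / 2 ^ s * cmod (a g))"
    proof (intro sum_mono)
      fix g assume "g \<in> B"
      then show "cmod (?r g) \<le> 1 / 2 ^ s * cmod (a g)"
        using mult_right_mono[OF near[of g] norm_ge_zero[of "a g"]]
        by (simp add: norm_mult del: of_real_diff of_real_divide)
    qed
    also have "\<dots> = A / 2 ^ s"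
      by (simp add: A_def sum_divide_distrib)
    also have "\<dots> \<le> \<delta>"
      using s \<delta> by (simp add: field_simps)
    finally show ?thesis .
  qed
  ultimately have r: "conv_bound ?r \<delta>"
    using conv_bound_mono by blast
  have Q: "0 \<le> Q"
    using signs conv_bound_nonneg by blast
  have sum: "conv_bound (\<lambda>g. (if g \<in> B then ((if g \<in> E then 1 else 0) - of_real (real (k g) / 2 ^ s)) * a g else 0) + ?r g)
      (Q * (1 - 1 / 2 ^ s) + \<delta>)"
    by (intro conv_bound_add E r)
  have eq: "(if g \<in> B then ((if g \<in> E then 1 else 0) - of_real (real (k g) / 2 ^ s)) * a g else 0) + ?r g
      = (if g \<in> B then ((if g \<in> E then 1 else 0) - of_real (m g)) * a g else 0)" for g
    by (simp add: algebra_simps)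
  have "Q * (1 - 1 / 2 ^ s) + \<delta> \<le> Q + \<delta>"
    using Q by (simp add: mult_left_le)
  from conv_bound_mono[OF sum this] show ?thesis
    unfolding eq using E(1) by (intro exI[of _ E] conjI)
qed

end

section \<open>From random signs to the criterion for the Revesz property\<close>

context length_group
begin

lemma power_commutes_exponents: "((x :: 'c :: monoid_mult) ^ m) ^ n = (x ^ n) ^ m"
  by (simp only: power_mult[symmetric] mult.commute[of m n])

text \<open>Take \<open>p\<close> to be the power of two with \<open>i < p\<close> and
  \<open>p \<le> 2 * i\<close>. The iterate of order \<open>p\<close> lives in the ball of radius
  \<open>p * 2 ^ i\<close>, and the root of order \<open>p\<close> of the loss by rapid decay there
  is at most \<open>A * 8 ^ s\<close>, because \<open>p\<close> exceeds \<open>i\<close>. The same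
  root of the moment gives \<open>sqrt p\<close>, which is \<open>O(sqrt i)\<close> because
  \<open>p \<le> 2 * i\<close>.\<close>

lemma random_signs:
  assumes rapid_decay
  shows "\<exists>C\<ge>0. \<forall>i\<ge>1. \<forall>a B. B \<subseteq> lball (2 ^ i) \<longrightarrow>
    (\<exists>D\<subseteq>B. conv_bound (signed B a D) (C * sqrt i * L2_set (\<lambda>g. cmod (a g)) B))"
proof -
  obtain A s where A: "1 \<le> A" and rd: "\<forall>n c. (\<forall>g\<in>carrier G. n < L g \<longrightarrow> c g = 0) \<longrightarrow>
     conv_bound c (A * (real n + 1) ^ s * L2_set (\<lambda>g. cmod (c g)) (lball n))"
    using assms unfolding rapid_decay_def by (elim exE conjE)
  have "\<exists>D\<subseteq>B. conv_bound (signed B a D) ((A * 8 ^ s * sqrt 2) * sqrt i * L2_set (\<lambda>g. cmod (a g)) B)"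
    if i: "1 \<le> i" and B: "B \<subseteq> lball (2 ^ i)" for i a B
  proof -
    obtain j where j: "2 ^ j \<le> i" "i < 2 ^ (j + 1)"
      using ex_power_ivl1[of 2 i] i by auto
    define k where "k = Suc j"
    define p :: nat where "p = 2 ^ k"
    have p: "i \<le> p" "p \<le> 2 * i" "1 \<le> p"
      using j by (auto simp: p_def k_def)
    define \<sigma> where "\<sigma> = L2_set (\<lambda>g. cmod (a g)) B"
    have \<sigma>: "0 \<le> \<sigma>"
      by (simp add: \<sigma>_def)
    obtain D where D: "D \<subseteq> B"
      "(L2_set (\<lambda>g. cmod ((star_square ^^ k) (signed B a D) g)) (lball (p * 2 ^ i)))\<^sup>2
        \<le> real p ^ p * (\<Sum>b\<in>B. (cmod (a b))\<^sup>2) ^ p"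
      using exists_signs_moment[OF B, of k a] unfolding p_def by (elim exE conjE)
    let ?y = "(star_square ^^ k) (signed B a D)"
    have sup: "signed B a D g = 0" if "g \<in> carrier G" "2 ^ i < L g" for g
      using that B by (auto simp: signed_def lball_def)
    have ysup: "?y g = 0" if "g \<in> carrier G" "p * 2 ^ i < L g" for g
      by (rule star_square_iter_support[of "2 ^ i"]) (use sup that in \<open>auto simp: p_def\<close>)
    have "(L2_set (\<lambda>g. cmod (?y g)) (lball (p * 2 ^ i)))\<^sup>2 \<le> ((sqrt p * \<sigma>) ^ p)\<^sup>2"
    proof -
      have eq: "(sqrt p * \<sigma>)\<^sup>2 = real p * (\<Sum>b\<in>B. (cmod (a b))\<^sup>2)"
        by (simp add: power_mult_distrib \<sigma>_def L2_set_power2)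
      have "((sqrt p * \<sigma>) ^ p)\<^sup>2 = ((sqrt p * \<sigma>)\<^sup>2) ^ p"
        by (rule power_commutes_exponents)
      then show ?thesis
        using D(2) unfolding eq by (simp only: power_mult_distrib)
    qed
    then have y: "L2_set (\<lambda>g. cmod (?y g)) (lball (p * 2 ^ i)) \<le> (sqrt p * \<sigma>) ^ p"
      by (rule power2_le_imp_le) (use \<sigma> in simp)
    \<comment> \<open>The exponent \<open>p\<close> dominates both the factor \<open>p\<close> and
      the scale \<open>i\<close>, so the radius is at most exponential in \<open>p\<close>.\<close>
    have "p + 1 \<le> 2 ^ p"
      using less_exp[of p] by linarith
    moreover have "(2 :: nat) ^ i \<le> 2 ^ p"
      using p by simp
    ultimately have "(p + 1) * 2 ^ i \<le> 2 ^ p * 2 ^ p"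
      by (rule mult_le_mono)
    moreover have "p * 2 ^ i + 1 \<le> (p + 1) * 2 ^ i"
      by simp
    moreover have "(2 :: nat) ^ p * 2 ^ p = 4 ^ p"
      using power_mult_distrib[of "2 :: nat" 2 p] by simp
    moreover have "(4 :: nat) ^ p \<le> 8 ^ p"
      by (intro power_mono) auto
    ultimately have "p * 2 ^ i + 1 \<le> 8 ^ p"
      by linarith
    then have "real (p * 2 ^ i + 1) \<le> real (8 ^ p)"
      by (simp only: of_nat_le_iff)
    then have exp: "real (p * 2 ^ i) + 1 \<le> 8 ^ p"
      by simp
    have power_swap: "((8 :: real) ^ p) ^ s = (8 ^ s) ^ p"
      by (rule power_commutes_exponents)
    have K: "A * (real (p * 2 ^ i) + 1) ^ s * L2_set (\<lambda>g. cmod (?y g)) (lball (p * 2 ^ i))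
        \<le> A ^ p * (8 ^ p) ^ s * (sqrt p * \<sigma>) ^ p"
      using A p exp y self_le_power[of A p] by (intro mult_mono power_mono) auto
    also have "\<dots> = (A * 8 ^ s * (sqrt p * \<sigma>)) ^ p"
      by (simp only: power_mult_distrib power_swap)
    finally have Kle: "A * (real (p * 2 ^ i) + 1) ^ s * L2_set (\<lambda>g. cmod (?y g)) (lball (p * 2 ^ i))
        \<le> (A * 8 ^ s * (sqrt p * \<sigma>)) ^ p" .
    have "conv_bound ?y (A * (real (p * 2 ^ i) + 1) ^ s * L2_set (\<lambda>g. cmod (?y g)) (lball (p * 2 ^ i)))"
      by (rule rd[rule_format]) (rule ysup)
    note root = conv_bound_mono[OF this Kle]
    have "conv_bound (signed B a D) (A * 8 ^ s * (sqrt p * \<sigma>))"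
      by (rule conv_bound_iter_root[of "2 ^ i" _ k]) (use root A \<sigma> sup in \<open>auto simp: p_def\<close>)
    moreover have "A * 8 ^ s * (sqrt p * \<sigma>) \<le> (A * 8 ^ s * sqrt 2) * sqrt i * \<sigma>"
    proof -
      have "sqrt p \<le> sqrt (2 * real i)"
        using p(2) by (intro real_sqrt_le_mono) linarith
      then have "sqrt p * \<sigma> \<le> sqrt 2 * sqrt i * \<sigma>"
        using \<sigma> by (intro mult_right_mono) (simp_all add: real_sqrt_mult)
      then have "A * 8 ^ s * (sqrt p * \<sigma>) \<le> A * 8 ^ s * (sqrt 2 * sqrt i * \<sigma>)"
        using A by (intro mult_left_mono) auto
      then show ?thesis
        by (simp add: mult_ac)
    qed
    ultimately show ?thesis
      using D(1) conv_bound_mono unfolding \<sigma>_def by blast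
  qed
  then show ?thesis
    using A by (intro exI[of _ "A * 8 ^ s * sqrt 2"]) auto
qed

text \<open>Each shell spans two dyadic levels, so consecutive shells overlap and the sum telescopes
  in steps of two.\<close>

lemma sum_shift_difference:
  fixes S :: "nat \<Rightarrow> real"
  assumes "m \<le> n"
  shows "(\<Sum>i\<in>{m..<n}. S (i + 2) - S i) = S (n + 1) + S n - S (m + 1) - S m"
  using assms by (induction n rule: dec_induct) auto

text \<open>The energies of the shells are summable, whereas the reciprocals of the scales are not.\<close>

lemma exists_low_energy_scale:
  fixes c :: "'a \<Rightarrow> complex"
  assumes M: "\<forall>H. finite H \<and> H \<subseteq> carrier G \<longrightarrow> (\<Sum>g\<in>H. (cmod (c g))\<^sup>2) \<le> M"
    and I: "\<forall>m0 :: nat. \<exists>m\<ge>m0. m \<le> 2 * card {i \<in> I. m \<le> i \<and> i < 4 * m}" and \<delta>: "0 < \<delta>"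
  shows "\<exists>i\<in>I. m0 \<le> i \<and> real i * (L2_set (\<lambda>g. cmod (c g)) (lball (2 ^ (i + 2)) - lball (2 ^ i)))\<^sup>2 \<le> \<delta>"
proof (rule ccontr)
  assume contr: "\<not> ?thesis"
  define S where "S i = (\<Sum>g\<in>lball (2 ^ i). (cmod (c g))\<^sup>2)" for i :: nat
  have sub: "lball (2 ^ i) \<subseteq> lball (2 ^ j)" if "i \<le> j" for i j :: nat
  proof -
    have "(2 :: nat) ^ i \<le> 2 ^ j"
      using that by simp
    then show ?thesis
      by (auto simp: lball_def intro: order_trans)
  qed
  have mono: "incseq S"
    unfolding S_def incseq_def by (intro allI impI sum_mono2 sub) auto
  moreover have "S i \<le> M" for i
    unfolding S_def using M lball_subset by simp
  ultimately obtain S' where S': "S \<longlonglongrightarrow> S'" "\<And>i. S i \<le> S'"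
    using incseq_convergent[of S M] by auto
  define e where "e i = (L2_set (\<lambda>g. cmod (c g)) (lball (2 ^ (i + 2)) - lball (2 ^ i)))\<^sup>2" for i :: nat
  have e: "e i = S (i + 2) - S i" for i
    unfolding e_def S_def L2_set_power2 using sub[of i "i + 2"] by (intro sum_diff) auto
  \<comment> \<open>Two boundary terms survive the telescoping, each below
    \<open>\<delta> / 16\<close> far out.\<close>
  obtain m1 where m1: "\<And>m. m1 \<le> m \<Longrightarrow> \<bar>S m - S'\<bar> < \<delta> / 16"
    using LIMSEQ_D[OF S'(1), of "\<delta> / 16"] \<delta> by auto
  obtain m where m: "Suc (max m0 m1) \<le> m" and card: "m \<le> 2 * card {i \<in> I. m \<le> i \<and> i < 4 * m}"
    using I by blast
  have big: "\<delta> / (4 * real m) \<le> e i" if "i \<in> {i \<in> I. m \<le> i \<and> i < 4 * m}" for i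
  proof -
    have "\<delta> < real i * e i"
      using contr that m by (auto simp: e_def not_le)
    also have "\<dots> \<le> (4 * real m) * e i"
      using that by (intro mult_right_mono) (auto simp: e_def)
    finally show ?thesis
      using m by (simp add: field_simps)
  qed
  \<comment> \<open>At least \<open>m / 2\<close> scales below \<open>4 * m\<close> lie in
    \<open>I\<close>, each with energy at least \<open>\<delta> / (4 * m)\<close>.\<close>
  have "\<delta> / 8 = (real m / 2) * (\<delta> / (4 * real m))"
    using m by (simp add: field_simps)
  also have "\<dots> \<le> real (card {i \<in> I. m \<le> i \<and> i < 4 * m}) * (\<delta> / (4 * real m))"
    using card \<delta> by (intro mult_right_mono) auto
  also have "\<dots> \<le> (\<Sum>i\<in>{i \<in> I. m \<le> i \<and> i < 4 * m}. e i)"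
    using big by (intro sum_bounded_below) auto
  also have "\<dots> \<le> (\<Sum>i\<in>{m..<4 * m}. e i)"
    by (intro sum_mono2) (auto simp: e_def)
  also have "\<dots> = S (4 * m + 1) + S (4 * m) - S (m + 1) - S m"
    by (simp only: e) (rule sum_shift_difference, simp)
  also have "\<dots> < \<delta> / 8"
  proof -
    have "\<bar>S (m + 1) - S'\<bar> < \<delta> / 16" "\<bar>S m - S'\<bar> < \<delta> / 16" "S (4 * m + 1) \<le> S'" "S (4 * m) \<le> S'"
      using m1 m S'(2) by auto
    then show ?thesis
      by linarith
  qed
  finally show False
    by simp
qed

text \<open>The hypothesis on \<open>I\<close> asks for a positive proportion of scales in suitable
  ranges arbitrarily far out; this keeps the sum of \<open>1 / i\<close> over \<open>I\<close>
  divergent and leaves room for multipliers that are good only at some scales.\<close>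

theorem revesz_criterion:
  fixes V :: "nat \<Rightarrow> 'a \<Rightarrow> real"
  assumes rapid_decay
    and I: "\<forall>m0 :: nat. \<exists>m\<ge>m0. m \<le> 2 * card {i \<in> I. m \<le> i \<and> i < 4 * m}"
    and V01: "\<And>i g. i \<in> I \<Longrightarrow> g \<in> carrier G \<Longrightarrow> 0 \<le> V i g \<and> V i g \<le> 1"
    and V1: "\<And>i g. i \<in> I \<Longrightarrow> g \<in> carrier G \<Longrightarrow> L g \<le> 2 ^ i \<Longrightarrow> V i g = 1"
    and V0: "\<And>i g. i \<in> I \<Longrightarrow> g \<in> carrier G \<Longrightarrow> 2 ^ (i + 2) < L g \<Longrightarrow> V i g = 0"
    and V: "\<And>i c K. i \<in> I \<Longrightarrow> conv_bound c K \<Longrightarrow> conv_bound (\<lambda>g. of_real (V i g) * c g) (M * K)"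
    and M: "0 \<le> M"
  shows "revesz_property G"
proof -
  obtain C where C: "0 \<le> C" and signs: "\<forall>i\<ge>1. \<forall>a B. B \<subseteq> lball (2 ^ i) \<longrightarrow>
    (\<exists>D\<subseteq>B. conv_bound (signed B a D) (C * sqrt i * L2_set (\<lambda>g. cmod (a g)) B))"
    using random_signs[OF assms(1)] by (elim exE conjE)
  have step: "\<exists>E. finite E \<and> F0 \<subseteq> E \<and> E \<subseteq> carrier G \<and> op_bound G (op_diff (lin_comb G E (fourier_coeff G T)) T) \<epsilon>"
    if T: "T \<in> reduced_C_star G" and \<epsilon>: "0 < \<epsilon>" and F0: "finite F0" "F0 \<subseteq> carrier G" for T \<epsilon> F0
  proof -
    define f where "f = fourier_coeff G T"
    \<comment> \<open>The errors are \<open>M\<close> times \<open>\<epsilon>'\<close> for the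
      multiplier, two for the rounding and its slack, and one for passing from the finite
      combination to \<open>T\<close>.\<close>
    define \<epsilon>' where "\<epsilon>' = \<epsilon> / (M + 3)"
    have \<epsilon>': "0 < \<epsilon>'" "(M + 3) * \<epsilon>' = \<epsilon>"
      using \<epsilon> M by (auto simp: \<epsilon>'_def field_simps)
    obtain F s where F: "finite F" "F \<subseteq> carrier G" and TS: "op_bound G (op_diff T (lin_comb G F s)) \<epsilon>'"
      and fs: "conv_bound (\<lambda>g. f g - (if g \<in> F then s g else 0)) \<epsilon>'"
      using reduced_C_star_approx[OF T \<epsilon>'(1)] unfolding f_def by blast
    \<comment> \<open>This makes \<open>i\<close> positive and puts \<open>F\<close> and
      \<open>F0\<close> inside the ball of radius \<open>i\<close>, hence inside that of radius
      \<open>2 ^ i\<close>.\<close>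
    define n0 where "n0 = Suc (\<Sum>g\<in>F \<union> F0. L g)"
    obtain MM where MM: "\<forall>H. finite H \<and> H \<subseteq> carrier G \<longrightarrow> (\<Sum>g\<in>H. (cmod (f g))\<^sup>2) \<le> MM"
      using fourier_coeff_l2_bound[OF T] unfolding f_def by (elim exE)
    \<comment> \<open>The random signs on the shell cost at most \<open>2 * C * sqrt i\<close> times
      the l2-norm there, so this energy makes the cost at most \<open>\<epsilon>'\<close>. The
      summand \<open>1\<close> covers \<open>C = 0\<close>.\<close>
    obtain i where i: "i \<in> I" "n0 \<le> i" and low:
      "real i * (L2_set (\<lambda>g. cmod (f g)) (lball (2 ^ (i + 2)) - lball (2 ^ i)))\<^sup>2 \<le> (\<epsilon>' / (2 * C + 1))\<^sup>2"
      using exists_low_energy_scale[OF MM I, of "(\<epsilon>' / (2 * C + 1))\<^sup>2" n0] \<epsilon>' C by auto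
    define B where "B = lball (2 ^ (i + 2)) - lball (2 ^ i)"
    have B: "finite B" "B \<subseteq> carrier G"
      using lball_subset by (auto simp: B_def)
    have small: "g \<in> lball (2 ^ i)" if "g \<in> F \<union> F0" for g
    proof -
      have "L g \<le> (\<Sum>g\<in>F \<union> F0. L g)"
        using that F F0 by (intro member_le_sum) auto
      also have "\<dots> \<le> i"
        using i by (simp add: n0_def)
      also have "\<dots> \<le> 2 ^ i"
        using less_exp[of i] by simp
      finally show ?thesis
        using that F F0 by (auto simp: lball_def)
    qed
    have V01': "\<forall>g\<in>B. 0 \<le> V i g \<and> V i g \<le> 1"
      using V01[OF i(1)] B by blast
    have Q: "\<forall>B'\<subseteq>B. \<exists>D\<subseteq>B'. conv_bound (signed B' f D) \<epsilon>'"
    proof (intro allI impI)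
      fix B' assume that: "B' \<subseteq> B"
      \<comment> \<open>The shell lies in the ball of scale \<open>i + 2\<close>; the shift is
        absorbed by a factor of two since \<open>i\<close> is positive.\<close>
      have "C * sqrt (i + 2) * L2_set (\<lambda>g. cmod (f g)) B' \<le> C * (2 * sqrt i) * L2_set (\<lambda>g. cmod (f g)) B"
      proof (intro mult_mono L2_set_subset_mono that B C)
        have "sqrt (i + 2) \<le> sqrt (4 * real i)"
          using i by (intro real_sqrt_le_mono) (simp add: n0_def)
        then show "sqrt (i + 2) \<le> 2 * sqrt i"
          by (simp add: real_sqrt_mult)
      qed (use C in auto)
      also have "\<dots> = 2 * C * sqrt (real i * (L2_set (\<lambda>g. cmod (f g)) B)\<^sup>2)"
        by (simp add: real_sqrt_mult)
      also have "\<dots> \<le> 2 * C * sqrt ((\<epsilon>' / (2 * C + 1))\<^sup>2)"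
        using C low unfolding B_def by (intro mult_left_mono real_sqrt_le_mono) auto
      also have "sqrt ((\<epsilon>' / (2 * C + 1))\<^sup>2) = \<epsilon>' / (2 * C + 1)"
        using C \<epsilon>' by (intro real_sqrt_unique) auto
      also have "2 * C * (\<epsilon>' / (2 * C + 1)) \<le> \<epsilon>'"
        using C \<epsilon>' by (simp add: field_simps)
      finally have le: "C * sqrt (i + 2) * L2_set (\<lambda>g. cmod (f g)) B' \<le> \<epsilon>'" .
      have "B' \<subseteq> lball (2 ^ (i + 2))"
        using that by (auto simp: B_def)
      then show "\<exists>D\<subseteq>B'. conv_bound (signed B' f D) \<epsilon>'"
        using signs[rule_format, of "i + 2" B' f] conv_bound_mono[OF _ le] by auto
    qed
    obtain E' where E': "E' \<subseteq> B" and
      round: "conv_bound (\<lambda>g. if g \<in> B then ((if g \<in> E' then 1 else 0) - of_real (V i g)) * f g else 0) (\<epsilon>' + \<epsilon>')"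
      using random_rounding[OF B Q V01' \<epsilon>'(1)] by (elim exE conjE)
    define E where "E = lball (2 ^ i) \<union> E'"
    have E: "finite E" "E \<subseteq> carrier G" "F \<union> F0 \<subseteq> E"
      using E' B small lball_subset by (auto simp: E_def intro: finite_subset)
    \<comment> \<open>The multiplier leaves \<open>s\<close> unchanged because \<open>F\<close> lies
      in the inner ball, and the rounding correction replaces \<open>V i\<close> by the indicator of
      \<open>E\<close> on the shell. The total is therefore the difference of two finite
      sums.\<close>
    have "conv_bound (\<lambda>g. of_real (V i g) * (f g - (if g \<in> F then s g else 0))
        + (if g \<in> B then ((if g \<in> E' then 1 else 0) - of_real (V i g)) * f g else 0)) (M * \<epsilon>' + (\<epsilon>' + \<epsilon>'))"
      by (intro conv_bound_add V i round fs)
    moreover have "of_real (V i g) * (f g - (if g \<in> F then s g else 0))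
        + (if g \<in> B then ((if g \<in> E' then 1 else 0) - of_real (V i g)) * f g else 0)
        = (if g \<in> E then f g else 0) - (if g \<in> F then s g else 0)" if g: "g \<in> carrier G" for g
    proof -
      consider (inner) "L g \<le> 2 ^ i" | (shell) "g \<in> B" | (outer) "2 ^ (i + 2) < L g"
        using g by (cases "L g \<le> 2 ^ i"; cases "2 ^ (i + 2) < L g") (auto simp: B_def lball_def)
      then show ?thesis
      proof cases
        case inner
        then show ?thesis
          using g V1[OF i(1) g] by (auto simp: E_def B_def lball_def)
      next
        case shell
        then have "g \<notin> F" "g \<notin> lball (2 ^ i)"
          using small by (auto simp: B_def)
        then show ?thesis
          using shell by (auto simp: E_def algebra_simps)
      next
        case outer
        have "(2 :: nat) ^ i \<le> 2 ^ (i + 2)"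
          by simp
        then have "g \<notin> lball (2 ^ i)"
          using outer unfolding lball_def by fastforce
        moreover have "g \<notin> B"
          using outer by (auto simp: B_def lball_def)
        ultimately show ?thesis
          using V0[OF i(1) g outer] E' small by (auto simp: E_def)
      qed
    qed
    ultimately have "conv_bound (\<lambda>g. (if g \<in> E then f g else 0) - (if g \<in> F then s g else 0)) (M * \<epsilon>' + (\<epsilon>' + \<epsilon>'))"
      by (rule conv_bound_cong[THEN iffD1, rotated])
    then have "op_bound G (op_diff (lin_comb G E f) (lin_comb G F s)) (M * \<epsilon>' + (\<epsilon>' + \<epsilon>'))"
      using E F M \<epsilon>' by (subst op_bound_op_diff_iff) auto
    then have "op_bound G (op_diff (lin_comb G E f) T) ((M * \<epsilon>' + (\<epsilon>' + \<epsilon>')) + \<epsilon>')"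
      by (rule op_bound_add[OF _ op_bound_diff_commute[OF TS]])
    also have "(M * \<epsilon>' + (\<epsilon>' + \<epsilon>')) + \<epsilon>' = \<epsilon>"
      using \<epsilon>'(2) by (simp add: algebra_simps)
    finally show ?thesis
      using E unfolding f_def by blast
  qed
  show ?thesis
    unfolding revesz_property_def
  proof
    fix T assume T: "T \<in> reduced_C_star G"
    let ?D = "\<lambda>E. op_diff (lin_comb G E (fourier_coeff G T)) T"
    \<comment> \<open>Each set is chosen to contain its predecessor and a ball; the balls make the
      union the whole group.\<close>
    have "\<exists>E. \<forall>n. (finite (E n) \<and> lball n \<subseteq> E n \<and> E n \<subseteq> carrier G \<and> op_bound G (?D (E n)) (1 / Suc n)) \<and> E n \<subseteq> E (Suc n)"
    proof (rule dependent_nat_choice)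
      show "\<exists>E. finite E \<and> lball 0 \<subseteq> E \<and> E \<subseteq> carrier G \<and> op_bound G (?D E) (1 / Suc 0)"
        by (intro step T lball_subset) auto
      fix E n
      assume E: "finite E \<and> lball n \<subseteq> E \<and> E \<subseteq> carrier G \<and> op_bound G (?D E) (1 / Suc n)"
      obtain E' where "finite E'" "E \<union> lball (Suc n) \<subseteq> E'" "E' \<subseteq> carrier G" "op_bound G (?D E') (1 / Suc (Suc n))"
        using step[OF T, of "1 / Suc (Suc n)" "E \<union> lball (Suc n)"] E lball_subset by auto
      then show "\<exists>E'. (finite E' \<and> lball (Suc n) \<subseteq> E' \<and> E' \<subseteq> carrier G \<and> op_bound G (?D E') (1 / Suc (Suc n))) \<and> E \<subseteq> E'"
        by blast
    qed
    then obtain E where "\<forall>n. (finite (E n) \<and> lball n \<subseteq> E n \<and> E n \<subseteq> carrier G \<and> op_bound G (?D (E n)) (1 / Suc n)) \<and> E n \<subseteq> E (Suc n)"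
      by (elim exE)
    then have E: "\<And>n. finite (E n)" "\<And>n. lball n \<subseteq> E n" "\<And>n. E n \<subseteq> carrier G" "\<And>n. E n \<subseteq> E (Suc n)"
      and D: "\<And>n. op_bound G (?D (E n)) (1 / Suc n)"
      by simp_all
    have "(\<Union>n. E n) = carrier G"
    proof
      show "carrier G \<subseteq> (\<Union>n. E n)"
      proof
        fix g assume "g \<in> carrier G"
        then have "g \<in> lball (L g)"
          by (simp add: lball_def)
        then show "g \<in> (\<Union>n. E n)"
          using E(2) by blast
      qed
    qed (use E(3) in blast)
    moreover have "(\<lambda>n. op_norm G (?D (E n))) \<longlonglongrightarrow> 0"
    proof (rule tendsto_sandwich)
      show "\<forall>\<^sub>F n in sequentially. 0 \<le> op_norm G (?D (E n))"
        by (intro always_eventually allI op_norm_nonneg[OF D]) simp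
      show "\<forall>\<^sub>F n in sequentially. op_norm G (?D (E n)) \<le> 1 / Suc n"
        by (intro always_eventually allI op_norm_le[OF D]) simp
      show "(\<lambda>n. 1 / real (Suc n)) \<longlonglongrightarrow> 0"
        by (rule LIMSEQ_Suc) (rule lim_1_over_n)
    qed simp
    ultimately show "\<exists>E :: nat \<Rightarrow> 'a set. (\<forall>j. finite (E j) \<and> E j \<subseteq> E (Suc j)) \<and> (\<Union>j. E j) = carrier G \<and>
        (\<lambda>j. op_norm G (?D (E j))) \<longlonglongrightarrow> 0"
      by (intro exI[of _ E] conjI allI E)
  qed
qed

end

section \<open>Word metrics and polynomial growth\<close>

lemma (in group) foldr_mult_closed:
  "set ws \<subseteq> carrier G \<Longrightarrow> foldr (\<otimes>) ws \<one> \<in> carrier G"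
  by (induction ws) auto

lemma (in group) foldr_mult_append:
  "set us \<subseteq> carrier G \<Longrightarrow> set vs \<subseteq> carrier G \<Longrightarrow>
    foldr (\<otimes>) (us @ vs) \<one> = foldr (\<otimes>) us \<one> \<otimes> foldr (\<otimes>) vs \<one>"
  by (induction us) (simp_all add: foldr_mult_closed m_assoc)

lemma (in group) inv_foldr_mult:
  "set ws \<subseteq> carrier G \<Longrightarrow> inv (foldr (\<otimes>) ws \<one>) = foldr (\<otimes>) (rev (map (\<lambda>x. inv x) ws)) \<one>"
proof (induction ws)
  case (Cons w ws)
  have "set (rev (map (\<lambda>x. inv x) ws)) \<subseteq> carrier G"
    using Cons.prems by auto
  then have "foldr (\<otimes>) (rev (map (\<lambda>x. inv x) ws) @ [inv w]) \<one>
      = foldr (\<otimes>) (rev (map (\<lambda>x. inv x) ws)) \<one> \<otimes> foldr (\<otimes>) [inv w] \<one>"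
    using Cons.prems by (intro foldr_mult_append) auto
  then show ?case
    using Cons by (simp add: inv_mult_group foldr_mult_closed)
qed simp

locale word_group = group G for G (structure) +
  fixes S :: "'a set"
  assumes finite_generators: "finite S" and symmetric: "symmetric_generating_set G S"
begin

abbreviation wl :: "'a \<Rightarrow> nat" where
  "wl \<equiv> word_length G S"

abbreviation word :: "'a list \<Rightarrow> 'a" where
  "word ws \<equiv> foldr (\<otimes>) ws \<one>"

lemma generators_carrier: "S \<subseteq> carrier G"
  using symmetric by (simp add: symmetric_generating_set_def)

lemma word_carrier: "set ws \<subseteq> S \<Longrightarrow> set ws \<subseteq> carrier G"
  using generators_carrier by blast

lemma ex_word:
  assumes "g \<in> carrier G"
  shows "\<exists>ws. set ws \<subseteq> S \<and> g = word ws"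
proof -
  have "g \<in> generate G S"
    using assms symmetric by (simp add: symmetric_generating_set_def)
  then show ?thesis
  proof (induction rule: generate.induct)
    case one
    then show ?case
      by (intro exI[of _ "[]"]) simp
  next
    case (incl h)
    then show ?case
      using generators_carrier by (intro exI[of _ "[h]"]) auto
  next
    case (inv h)
    then show ?case
      using symmetric generators_carrier
      by (intro exI[of _ "[inv h]"]) (auto simp: symmetric_generating_set_def)
  next
    case (eng h1 h2)
    then obtain us vs where "set us \<subseteq> S" "h1 = word us" "set vs \<subseteq> S" "h2 = word vs"
      by blast
    then show ?case
      by (intro exI[of _ "us @ vs"]) (simp add: foldr_mult_append word_carrier del: foldr_append)
  qed
qed

lemma word_in_ball: "set ws \<subseteq> S \<Longrightarrow> length ws \<le> n \<Longrightarrow> word ws \<in> word_ball G S n"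
  by (auto simp: word_ball_def)

lemma wl_word_le: "set ws \<subseteq> S \<Longrightarrow> wl (word ws) \<le> length ws"
  unfolding word_length_def by (intro Least_le word_in_ball) auto

lemma ex_geodesic_word:
  assumes "g \<in> carrier G"
  shows "\<exists>ws. set ws \<subseteq> S \<and> g = word ws \<and> length ws = wl g"
proof -
  obtain us where "set us \<subseteq> S" "g = word us"
    using ex_word[OF assms] by blast
  then have "g \<in> word_ball G S (length us)"
    by (simp add: word_in_ball)
  then have "g \<in> word_ball G S (wl g)"
    unfolding word_length_def by (rule LeastI)
  then obtain ws where "set ws \<subseteq> S" "g = word ws" "length ws \<le> wl g"
    by (auto simp: word_ball_def)
  then show ?thesis
    using wl_word_le[of ws] by auto
qed

lemma word_ball_eq: "word_ball G S n = {g \<in> carrier G. wl g \<le> n}"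
proof (rule equalityI; rule subsetI)
  fix g assume "g \<in> word_ball G S n"
  then obtain ws where ws: "set ws \<subseteq> S" "g = word ws" "length ws \<le> n"
    by (auto simp: word_ball_def)
  then show "g \<in> {g \<in> carrier G. wl g \<le> n}"
    using wl_word_le[of ws] by (simp add: foldr_mult_closed word_carrier)
next
  fix g assume g: "g \<in> {g \<in> carrier G. wl g \<le> n}"
  then obtain ws where "set ws \<subseteq> S" "g = word ws" "length ws = wl g"
    using ex_geodesic_word by blast
  then show "g \<in> word_ball G S n"
    using g word_in_ball[of ws n] by auto
qed

lemma finite_word_ball: "finite (word_ball G S n)"
proof -
  have "word_ball G S n = word ` {ws. set ws \<subseteq> S \<and> length ws \<le> n}"
    by (auto simp: word_ball_def)
  then show ?thesis
    using finite_lists_length_le[OF finite_generators] by simp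
qed

lemma wl_mult:
  assumes "x \<in> carrier G" "y \<in> carrier G"
  shows "wl (x \<otimes> y) \<le> wl x + wl y"
proof -
  obtain us vs where us: "set us \<subseteq> S" "x = word us" "length us = wl x"
    and vs: "set vs \<subseteq> S" "y = word vs" "length vs = wl y"
    using ex_geodesic_word assms by blast
  have "x \<otimes> y = word (us @ vs)"
    using us vs by (simp add: foldr_mult_append word_carrier del: foldr_append)
  then show ?thesis
    using wl_word_le[of "us @ vs"] us vs by (simp del: foldr_append)
qed

lemma wl_inv_le:
  assumes "x \<in> carrier G"
  shows "wl (inv x) \<le> wl x"
proof -
  obtain ws where ws: "set ws \<subseteq> S" "x = word ws" "length ws = wl x"
    using ex_geodesic_word assms by blast
  have "set (rev (map (\<lambda>x. inv x) ws)) \<subseteq> S"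
    using ws symmetric by (auto simp: symmetric_generating_set_def)
  from wl_word_le[OF this] show ?thesis
    using ws by (simp add: inv_foldr_mult word_carrier)
qed

sublocale length_group G wl
proof
  have "wl (word []) \<le> length ([] :: 'a list)"
    by (rule wl_word_le) simp
  then show "wl \<one> = 0"
    by simp
  show "wl (x \<otimes> y) \<le> wl x + wl y" if "x \<in> carrier G" "y \<in> carrier G" for x y
    using that by (rule wl_mult)
  show "wl (inv x) = wl x" if "x \<in> carrier G" for x
    using that wl_inv_le[of x] wl_inv_le[of "inv x"] by simp
  show "finite {g \<in> carrier G. wl g \<le> n}" for n
    using finite_word_ball[of n] by (simp add: word_ball_eq)
qed

lemma word_ball_eq_lball: "word_ball G S n = lball n"
  by (simp add: word_ball_eq lball_def)

text \<open>Cut a geodesic word after \<open>j\<close> letters; by the triangle inequality neither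
  piece can be shortened.\<close>

lemma wl_split:
  assumes "g \<in> carrier G" "j \<le> wl g"
  shows "\<exists>u v. u \<in> carrier G \<and> v \<in> carrier G \<and> g = u \<otimes> v \<and> wl u = j \<and> wl v = wl g - j"
proof -
  obtain ws where ws: "set ws \<subseteq> S" "g = word ws" "length ws = wl g"
    using ex_geodesic_word assms by blast
  define u where "u = word (take j ws)"
  define v where "v = word (drop j ws)"
  have sub: "set (take j ws) \<subseteq> S" "set (drop j ws) \<subseteq> S"
    using ws(1) by (auto dest: in_set_takeD in_set_dropD)
  have uv: "u \<in> carrier G" "v \<in> carrier G"
    unfolding u_def v_def using sub by (auto intro!: foldr_mult_closed word_carrier)
  have g: "g = u \<otimes> v"
    using foldr_mult_append[of "take j ws" "drop j ws"] sub ws(2)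
    by (simp add: u_def v_def word_carrier del: foldr_append)
  have "wl u \<le> j" "wl v \<le> wl g - j"
    using wl_word_le[OF sub(1)] wl_word_le[OF sub(2)] ws(3) by (simp_all add: u_def v_def)
  then show ?thesis
    using uv g wl_mult[OF uv] assms(2) by (intro exI[of _ u] exI[of _ v]) auto
qed

end

section \<open>Overlaps of balls as multipliers, and doubling scales\<close>

context length_group
begin

lemma card_lball_pos: "0 < card (lball n)"
proof -
  have "\<one> \<in> lball n"
    by (simp add: lball_def L_one)
  then show ?thesis
    using card_gt_0_iff finite_lball by blast
qed

lemma lball_mono: "m \<le> n \<Longrightarrow> lball m \<subseteq> lball n"
  by (auto simp: lball_def)

text \<open>Cauchy-Schwarz bounds the l1-norm by the l2-norm times the square root of the size of
  the ball.\<close>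

lemma rapid_decay_polynomial_growth:
  assumes growth: "\<And>n. real (card (lball n)) \<le> C * (real n + 1) ^ d" and C: "1 \<le> C"
  shows rapid_decay
  unfolding rapid_decay_def
proof (intro exI[of _ C] exI[of _ d] conjI allI impI C)
  fix n c assume sup: "\<forall>g\<in>carrier G. n < L g \<longrightarrow> c g = (0 :: complex)"
  have "conv_bound c (\<Sum>g\<in>lball n. cmod (c g))"
    using sup by (intro conv_bound_l1 lball_subset) (auto simp: lball_def finite_ball)
  moreover have "(\<Sum>g\<in>lball n. cmod (c g)) \<le> C * (real n + 1) ^ d * L2_set (\<lambda>g. cmod (c g)) (lball n)"
  proof -
    have "(\<Sum>g\<in>lball n. cmod (c g)) = (\<Sum>g\<in>lball n. \<bar>1\<bar> * \<bar>cmod (c g)\<bar>)"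
      by simp
    also have "\<dots> \<le> L2_set (\<lambda>_. 1) (lball n) * L2_set (\<lambda>g. cmod (c g)) (lball n)"
      by (rule L2_set_mult_ineq)
    also have "L2_set (\<lambda>_. 1) (lball n) = sqrt (real (card (lball n)))"
      by (simp add: L2_set_constant)
    also have "sqrt (real (card (lball n))) * L2_set (\<lambda>g. cmod (c g)) (lball n)
        \<le> C * (real n + 1) ^ d * L2_set (\<lambda>g. cmod (c g)) (lball n)"
    proof (rule mult_right_mono)
      have "sqrt (real (card (lball n))) \<le> real (card (lball n))"
        using card_lball_pos[of n] by (intro real_le_lsqrt) (simp_all add: power2_eq_square)
      then show "sqrt (real (card (lball n))) \<le> C * (real n + 1) ^ d"
        using growth[of n] by linarith
    qed simp
    finally show ?thesis .
  qed
  ultimately show "conv_bound c (C * (real n + 1) ^ d * L2_set (\<lambda>g. cmod (c g)) (lball n))"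
    by (rule conv_bound_mono)
qed

text \<open>
  A matrix coefficient of the regular representation at the indicator functions of two balls: it is
  equal to one on a ball, and it is a bounded multiplier at the scales at which the growth is doubling.
\<close>

definition ball_overlap :: "nat \<Rightarrow> 'a \<Rightarrow> real" where
  "ball_overlap n g = real (card {s \<in> lball n. inv g \<otimes> s \<in> lball (2 * n)}) / real (card (lball n))"

lemma ball_overlap_bounds: "0 \<le> ball_overlap n g" "ball_overlap n g \<le> 1"
  using card_mono[of "lball n" "{s \<in> lball n. inv g \<otimes> s \<in> lball (2 * n)}"] card_lball_pos[of n]
  by (auto simp: ball_overlap_def)

lemma ball_overlap_eq_1:
  assumes "g \<in> carrier G" "L g \<le> n"
  shows "ball_overlap n g = 1"
proof -
  have "inv g \<otimes> s \<in> lball (2 * n)" if "s \<in> lball n" for s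
    using L_mult[of "inv g" s] L_inv[of g] assms that by (auto simp: lball_def)
  then have "{s \<in> lball n. inv g \<otimes> s \<in> lball (2 * n)} = lball n"
    by blast
  then show ?thesis
    using card_lball_pos[of n] by (simp add: ball_overlap_def card_gt_0_iff)
qed

lemma ball_overlap_eq_0:
  assumes g: "g \<in> carrier G" "3 * n < L g"
  shows "ball_overlap n g = 0"
proof -
  have "inv g \<otimes> s \<notin> lball (2 * n)" if "s \<in> lball n" for s
  proof
    assume s2: "inv g \<otimes> s \<in> lball (2 * n)"
    have s: "s \<in> carrier G" "L s \<le> n"
      using that by (auto simp: lball_def)
    have "s \<otimes> inv (inv g \<otimes> s) = g"
      using s g by (simp add: inv_mult_group flip: m_assoc)
    then have "L g \<le> L s + L (inv g \<otimes> s)"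
      using L_mult[of s "inv (inv g \<otimes> s)"] L_inv[of "inv g \<otimes> s"] s g by simp
    then show False
      using s s2 g by (simp add: lball_def)
  qed
  then have "{s \<in> lball n. inv g \<otimes> s \<in> lball (2 * n)} = {}"
    by blast
  then show ?thesis
    by (simp add: ball_overlap_def)
qed

text \<open>Translating by \<open>x\<close>, the overlap counts the points of the ball of radius
  \<open>n\<close> about \<open>x\<close> that lie in the ball of radius \<open>2 * n\<close> about
  \<open>y\<close>. It is thus an inner product of two indicators, each divided by the square root
  of the size of the smaller ball; their squared norms are at most \<open>1\<close> and
  \<open>M\<close>.\<close>

lemma conv_bound_ball_overlap:
  assumes c: "conv_bound c K" and dbl: "real (card (lball (2 * n))) \<le> M * real (card (lball n))"
  shows "conv_bound (\<lambda>g. of_real (ball_overlap n g) * c g) (M * K)"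
proof (rule conv_bound_schur[OF c])
  let ?b = "real (card (lball n))"
  have b: "0 < ?b"
    using card_lball_pos by simp
  have sub: "card (lball n) \<le> card (lball (2 * n))"
    by (intro card_mono finite_lball lball_mono) simp
  then have M1: "1 \<le> M"
    using dbl b by (smt (verit) mult_le_cancel_right1 of_nat_le_iff)
  then show "0 \<le> M"
    by simp
  let ?P = "\<lambda>s x. if inv x \<otimes> s \<in> lball n then 1 / sqrt ?b else 0"
  let ?Q = "\<lambda>s y. if inv y \<otimes> s \<in> lball (2 * n) then 1 / sqrt ?b else 0"
  have count: "(\<Sum>s\<in>\<Omega>. (if inv x \<otimes> s \<in> lball m then 1 / sqrt ?b else 0)\<^sup>2) \<le> real (card (lball m)) / ?b"
    if "finite \<Omega>" "\<Omega> \<subseteq> carrier G" "x \<in> carrier G" for \<Omega> x m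
  proof -
    have "(\<Sum>s\<in>\<Omega>. (if inv x \<otimes> s \<in> lball m then 1 / sqrt ?b else 0)\<^sup>2)
        = (\<Sum>s\<in>\<Omega>. if inv x \<otimes> s \<in> lball m then 1 / ?b else 0)"
      by (intro sum.cong) (auto simp: power_divide)
    also have "\<dots> = real (card {s \<in> \<Omega>. inv x \<otimes> s \<in> lball m}) / ?b"
      using that by (simp flip: sum.inter_filter)
    also have "card {s \<in> \<Omega>. inv x \<otimes> s \<in> lball m} \<le> card (lball m)"
      using that by (intro card_inj_on_le[of "\<lambda>s. inv x \<otimes> s"] inj_on_left_mult) auto
    finally show ?thesis
      using b by (simp add: divide_right_mono)
  qed
  fix X Y assume XY: "finite X" "X \<subseteq> carrier G" "finite Y" "Y \<subseteq> carrier G"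
  define \<Omega> where "\<Omega> = (\<lambda>(x, s). x \<otimes> s) ` (X \<times> lball n)"
  have \<Omega>: "finite \<Omega>" "\<Omega> \<subseteq> carrier G"
    using XY lball_subset[of n] by (auto simp: \<Omega>_def subset_iff)
  have "ball_overlap n (inv x \<otimes> y) = (\<Sum>s\<in>\<Omega>. ?P s x * ?Q s y)" if x: "x \<in> X" and y: "y \<in> Y" for x y
  proof -
    have xy: "x \<in> carrier G" "y \<in> carrier G"
      using x y XY by auto
    have "(\<Sum>s\<in>\<Omega>. ?P s x * ?Q s y) = (\<Sum>s\<in>\<Omega>. if inv x \<otimes> s \<in> lball n \<and> inv y \<otimes> s \<in> lball (2 * n) then 1 / ?b else 0)"
      by (intro sum.cong) auto
    also have "\<dots> = real (card {s \<in> \<Omega>. inv x \<otimes> s \<in> lball n \<and> inv y \<otimes> s \<in> lball (2 * n)}) / ?b"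
      using \<Omega> by (simp flip: sum.inter_filter)
    also have "{s \<in> \<Omega>. inv x \<otimes> s \<in> lball n \<and> inv y \<otimes> s \<in> lball (2 * n)}
        = (\<lambda>s. x \<otimes> s) ` {s \<in> lball n. inv (inv x \<otimes> y) \<otimes> s \<in> lball (2 * n)}"
    proof (rule equalityI; rule subsetI)
      fix w assume w: "w \<in> {s \<in> \<Omega>. inv x \<otimes> s \<in> lball n \<and> inv y \<otimes> s \<in> lball (2 * n)}"
      then have "w \<in> carrier G"
        using \<Omega> by auto
      then have "w = x \<otimes> (inv x \<otimes> w)" "inv (inv x \<otimes> y) \<otimes> (inv x \<otimes> w) = inv y \<otimes> w"
        using xy by (simp_all add: inv_mult_group m_assoc) (simp_all flip: m_assoc)
      then show "w \<in> (\<lambda>s. x \<otimes> s) ` {s \<in> lball n. inv (inv x \<otimes> y) \<otimes> s \<in> lball (2 * n)}"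
        using w by (intro image_eqI[of _ _ "inv x \<otimes> w"]) auto
    next
      fix w assume "w \<in> (\<lambda>s. x \<otimes> s) ` {s \<in> lball n. inv (inv x \<otimes> y) \<otimes> s \<in> lball (2 * n)}"
      then obtain s where s: "w = x \<otimes> s" "s \<in> lball n" "inv (inv x \<otimes> y) \<otimes> s \<in> lball (2 * n)"
        by auto
      then have "s \<in> carrier G"
        using lball_subset by auto
      then have "inv x \<otimes> w = s" "inv y \<otimes> w = inv (inv x \<otimes> y) \<otimes> s"
        using xy s(1) by (simp_all add: inv_mult_group flip: m_assoc)
      then show "w \<in> {s \<in> \<Omega>. inv x \<otimes> s \<in> lball n \<and> inv y \<otimes> s \<in> lball (2 * n)}"
        using s x by (auto simp: \<Omega>_def)
    qed
    also have "card ((\<lambda>s. x \<otimes> s) ` {s \<in> lball n. inv (inv x \<otimes> y) \<otimes> s \<in> lball (2 * n)})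
        = card {s \<in> lball n. inv (inv x \<otimes> y) \<otimes> s \<in> lball (2 * n)}"
      using xy lball_subset by (intro card_image inj_on_left_mult) auto
    finally show ?thesis
      by (simp add: ball_overlap_def)
  qed
  moreover have "(\<Sum>s\<in>\<Omega>. (?P s x)\<^sup>2) \<le> M" if "x \<in> X" for x
  proof -
    have "x \<in> carrier G"
      using that XY by auto
    from count[OF \<Omega> this, of n] show ?thesis
      by (rule order_trans) (use b M1 in \<open>simp add: card_gt_0_iff\<close>)
  qed
  moreover have "(\<Sum>s\<in>\<Omega>. (?Q s y)\<^sup>2) \<le> M" if "y \<in> Y" for y
  proof -
    have "y \<in> carrier G"
      using that XY by auto
    from count[OF \<Omega> this, of "2 * n"] show ?thesis
      using b dbl by (smt (verit) divide_le_eq)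
  qed
  ultimately show "\<exists>\<Omega> :: 'a set. finite \<Omega> \<and> (\<forall>x\<in>X. \<forall>y\<in>Y. ball_overlap n (inv x \<otimes> y) = (\<Sum>s\<in>\<Omega>. ?P s x * ?Q s y)) \<and>
      (\<forall>x\<in>X. (\<Sum>s\<in>\<Omega>. (?P s x)\<^sup>2) \<le> M) \<and> (\<forall>y\<in>Y. (\<Sum>s\<in>\<Omega>. (?Q s y)\<^sup>2) \<le> M)"
    by (intro exI[of _ \<Omega>] conjI ballI \<Omega>(1))
qed

text \<open>The threshold \<open>4 ^ d\<close> is the square of the factor \<open>2 ^ d\<close> that
  growth of degree \<open>d\<close> allows on average. If fewer than half of \<open>m\<close> scales
  between \<open>m\<close> and \<open>4 * m\<close> were good, at least \<open>5 * m / 2\<close>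
  would be bad, and the ball of radius \<open>2 ^ (4 * m)\<close> would have at least
  \<open>2 ^ (5 * d * m)\<close> elements, against about \<open>2 ^ (4 * d * m)\<close>
  allowed.\<close>

lemma doubling_scales:
  assumes growth: "\<And>n. real (card (lball n)) \<le> C * (real n + 1) ^ d" and d: "1 \<le> d"
  defines "I \<equiv> {i. card (lball (2 * 2 ^ i)) \<le> 4 ^ d * card (lball (2 ^ i))}"
  shows "\<exists>m\<ge>m0. m \<le> 2 * card {i \<in> I. m \<le> i \<and> i < 4 * m}"
proof -
  obtain j where j: "C < 2 ^ j"
    using real_arch_pow[of 2 C] by auto
  \<comment> \<open>The gap of \<open>d * m\<close> between the two exponents has to exceed the
    contribution \<open>j + d\<close> of the constant \<open>C\<close> and of the \<open>+ 1\<close>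
    in the growth bound.\<close>
  define m where "m = Suc (max m0 j)"
  have "m \<le> 2 * card {i \<in> I. m \<le> i \<and> i < 4 * m}"
  proof (rule ccontr)
    assume contr: "\<not> ?thesis"
    let ?b = "\<lambda>i. real (card (lball (2 ^ i)))"
    have bad: "(4 ^ d) ^ card ({m..<n} - I) * ?b m \<le> ?b n" if "m \<le> n" for n
      using that
    proof (induction n rule: dec_induct)
      case base
      then show ?case
        by simp
    next
      case (step n)
      have eq: "{m..<Suc n} = insert n {m..<n}"
        using step.hyps by auto
      have mono: "?b n \<le> ?b (Suc n)"
        by (intro of_nat_mono card_mono finite_lball lball_mono) simp
      show ?case
      proof (cases "n \<in> I")
        case True
        then have "{m..<Suc n} - I = {m..<n} - I"
          using eq by auto
        then show ?thesis
          using step.IH mono by simp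
      next
        case False
        then have "card ({m..<Suc n} - I) = Suc (card ({m..<n} - I))"
          by (simp add: eq insert_Diff_if)
        moreover have "4 ^ d * ?b n \<le> ?b (Suc n)"
        proof -
          have "4 ^ d * card (lball (2 ^ n)) \<le> card (lball (2 * 2 ^ n))"
            using False by (simp add: I_def)
          then have "real (4 ^ d * card (lball (2 ^ n))) \<le> real (card (lball (2 * 2 ^ n)))"
            by (simp only: of_nat_le_iff)
          then show ?thesis
            by simp
        qed
        moreover have "4 ^ d * ((4 ^ d) ^ card ({m..<n} - I) * ?b m) \<le> 4 ^ d * ?b n"
          using step.IH by (intro mult_left_mono) auto
        ultimately show ?thesis
          by (simp only: power_Suc mult.assoc)
      qed
    qed
    have "card {m..<4 * m} = card ({m..<4 * m} \<inter> I) + card ({m..<4 * m} - I)"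
      by (metis card_Int_Diff finite_atLeastLessThan)
    moreover have "{m..<4 * m} \<inter> I = {i \<in> I. m \<le> i \<and> i < 4 * m}"
      by auto
    ultimately have J: "5 * m \<le> 2 * card ({m..<4 * m} - I)"
      using contr by simp
    have "(2 :: real) ^ (d * (5 * m)) \<le> 2 ^ (d * (2 * card ({m..<4 * m} - I)))"
      using J by (intro power_increasing mult_left_mono) auto
    also have "\<dots> = (4 ^ d) ^ card ({m..<4 * m} - I)"
    proof -
      have "(4 :: real) = 2 ^ 2"
        by simp
      then show ?thesis
        by (simp only: power_mult[symmetric] mult_ac)
    qed
    also have "\<dots> \<le> (4 ^ d) ^ card ({m..<4 * m} - I) * ?b m"
      using card_lball_pos[of "2 ^ m"] by simp
    also have "\<dots> \<le> ?b (4 * m)"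
      by (rule bad) simp
    also have "\<dots> \<le> C * (real (2 ^ (4 * m)) + 1) ^ d"
      by (rule growth)
    also have "\<dots> \<le> C * (2 ^ (4 * m + 1)) ^ d"
    proof (intro mult_left_mono power_mono)
      show "0 \<le> C"
        using growth[of 0] by simp
    qed auto
    also have "\<dots> < 2 ^ j * (2 ^ (4 * m + 1)) ^ d"
      using j by (intro mult_strict_right_mono) auto
    also have "\<dots> = 2 ^ (j + (4 * m + 1) * d)"
      by (simp only: power_add power_mult)
    finally have "d * (5 * m) < j + (4 * m + 1) * d"
      by simp
    then have "d * m < j + d"
      by (simp add: algebra_simps)
    moreover have "j + d \<le> d * m"
    proof -
      have "Suc j \<le> m"
        by (simp add: m_def)
      then have "d * Suc j \<le> d * m"
        by (rule mult_left_mono) simp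
      moreover have "1 * j \<le> d * j"
        by (rule mult_le_mono1[OF d])
      ultimately show ?thesis
        unfolding mult_Suc_right by linarith
    qed
    ultimately show False
      by simp
  qed
  then show ?thesis
    by (intro exI[of _ m]) (simp add: m_def)
qed

lemma revesz_polynomial_growth:
  assumes growth: "\<And>n. real (card (lball n)) \<le> C * (real n + 1) ^ d" and C: "1 \<le> C" and d: "1 \<le> d"
  shows "revesz_property G"
proof (rule revesz_criterion)
  let ?I = "{i. card (lball (2 * 2 ^ i)) \<le> 4 ^ d * card (lball (2 ^ i))}"
  show rapid_decay
    by (rule rapid_decay_polynomial_growth[OF growth C])
  show "\<forall>m0 :: nat. \<exists>m\<ge>m0. m \<le> 2 * card {i \<in> ?I. m \<le> i \<and> i < 4 * m}"
    by (intro allI doubling_scales[OF growth d])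
  show "conv_bound (\<lambda>g. of_real (ball_overlap (2 ^ i) g) * c g) (4 ^ d * K)"
    if "i \<in> ?I" "conv_bound c K" for i c K
  proof (rule conv_bound_ball_overlap[OF that(2)])
    have "real (card (lball (2 * 2 ^ i))) \<le> real (4 ^ d * card (lball (2 ^ i)))"
      using that(1) by (simp only: of_nat_le_iff mem_Collect_eq)
    then show "real (card (lball (2 * 2 ^ i))) \<le> 4 ^ d * real (card (lball (2 ^ i)))"
      by simp
  qed
qed (auto simp: ball_overlap_bounds ball_overlap_eq_1 intro: ball_overlap_eq_0)

end

theorem revesz_polynomial_growth_group:
  fixes G (structure)
  assumes "group G" "polynomial_growth G"
  shows "revesz_property G"
proof -
  obtain S C d where S: "finite S" "symmetric_generating_set G S" and C: "C \<ge> (1 :: real)" and d: "d \<ge> (0 :: real)"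
    and growth: "\<And>R. real (card (word_ball G S R)) \<le> C * (real R + 1) powr d"
    using assms(2) unfolding polynomial_growth_def by blast
  interpret word_group G S
    by (intro word_group.intro word_group_axioms.intro assms S)
  show ?thesis
  proof (rule revesz_polynomial_growth)
    fix n
    have "real (card (lball n)) \<le> C * (real n + 1) powr d"
      using growth[of n] by (simp add: word_ball_eq_lball)
    \<comment> \<open>The successor makes the exponent positive also for
      \<open>d = 0\<close>.\<close>
    also have "\<dots> \<le> C * (real n + 1) powr real (Suc (nat \<lceil>d\<rceil>))"
      using C d by (intro mult_left_mono powr_mono) linarith+
    also have "\<dots> = C * (real n + 1) ^ Suc (nat \<lceil>d\<rceil>)"
      by (subst powr_realpow) auto
    finally show "real (card (lball n)) \<le> C * (real n + 1) ^ Suc (nat \<lceil>d\<rceil>)" .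
  qed (use C in auto)
qed

section \<open>Hyperbolic groups\<close>

text \<open>Gromov's inequality at the identity as base point, multiplied by two so that it can be
  stated in integers. Geodesics enter only through the splitting of lengths.\<close>

locale hyperbolic_length_group = length_group +
  fixes D :: nat
  assumes split: "\<And>g j. g \<in> carrier G \<Longrightarrow> j \<le> L g \<Longrightarrow>
      \<exists>u v. u \<in> carrier G \<and> v \<in> carrier G \<and> g = u \<otimes> v \<and> L u = j \<and> L v = L g - j"
    and hyperbolic: "\<And>x y z. x \<in> carrier G \<Longrightarrow> y \<in> carrier G \<Longrightarrow> z \<in> carrier G \<Longrightarrow>
      min (int (L x) + int (L y) - int (L (inv x \<otimes> y))) (int (L y) + int (L z) - int (L (inv y \<otimes> z))) - int D
        \<le> int (L x) + int (L z) - int (L (inv x \<otimes> z))"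
begin

definition dst :: "'a \<Rightarrow> 'a \<Rightarrow> int" where
  "dst x y = int (L (inv x \<otimes> y))"

abbreviation len :: "'a \<Rightarrow> int" where
  "len x \<equiv> int (L x)"

lemma dst_nonneg: "0 \<le> dst x y"
  by (simp add: dst_def)

lemma dst_commute:
  assumes "x \<in> carrier G" "y \<in> carrier G"
  shows "dst x y = dst y x"
  using assms L_inv[of "inv x \<otimes> y"] by (simp add: dst_def inv_mult_group)

lemma dst_triangle:
  assumes "x \<in> carrier G" "y \<in> carrier G" "z \<in> carrier G"
  shows "dst x z \<le> dst x y + dst y z"
proof -
  have "inv x \<otimes> z = (inv x \<otimes> y) \<otimes> (inv y \<otimes> z)"
    using assms by (simp add: m_assoc) (simp flip: m_assoc)
  then show ?thesis
    using L_mult[of "inv x \<otimes> y" "inv y \<otimes> z"] assms by (simp add: dst_def)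
qed

lemma dst_one: "x \<in> carrier G \<Longrightarrow> dst x \<one> = len x" "x \<in> carrier G \<Longrightarrow> dst \<one> x = len x"
  by (simp_all add: dst_def L_inv)

lemma len_triangle:
  assumes "x \<in> carrier G" "y \<in> carrier G"
  shows "len x \<le> dst x y + len y" "dst x y \<le> len x + len y"
  using dst_triangle[of x y \<one>] dst_triangle[of x \<one> y] assms by (simp_all add: dst_one)

lemma dst_hyperbolic:
  assumes "x \<in> carrier G" "y \<in> carrier G" "z \<in> carrier G"
  shows "min (len x + len y - dst x y) (len y + len z - dst y z) - int D \<le> len x + len z - dst x z"
  using hyperbolic[OF assms] by (simp add: dst_def)

lemma ex_between:
  assumes "x \<in> carrier G" "y \<in> carrier G" "0 \<le> j" "j \<le> dst x y"
  shows "\<exists>w. w \<in> carrier G \<and> dst x w = j \<and> dst w y = dst x y - j"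
proof -
  have "nat j \<le> L (inv x \<otimes> y)"
    using assms by (simp add: dst_def nat_le_iff)
  then obtain u v where uv: "u \<in> carrier G" "v \<in> carrier G" "inv x \<otimes> y = u \<otimes> v" "L u = nat j"
    "L v = L (inv x \<otimes> y) - nat j"
    using split[of "inv x \<otimes> y" "nat j"] assms by auto
  have "inv x \<otimes> (x \<otimes> u) = u"
    using assms uv by (simp flip: m_assoc)
  moreover have "inv (x \<otimes> u) \<otimes> y = v"
    using assms uv by (simp add: inv_mult_group m_assoc) (simp flip: m_assoc)
  ultimately show ?thesis
    using assms uv \<open>nat j \<le> _\<close> by (intro exI[of _ "x \<otimes> u"]) (auto simp: dst_def)
qed

text \<open>
  The points near the geodesics from \<open>x\<close> to the identity, at distance about \<open>k\<close> from \<open>x\<close>; past the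
  identity, the points near the identity.
\<close>

definition near :: "'a \<Rightarrow> int \<Rightarrow> 'a set" where
  "near x k = {w \<in> carrier G. dst x w \<le> k \<and> len w \<le> max (len x - k) 0 + int (D + 2)}"

lemma near_nonneg: "w \<in> near x k \<Longrightarrow> 0 \<le> k"
  using dst_nonneg[of x w] by (simp add: near_def)

lemma near_subset_lball: "max (len x - k) 0 + int (D + 2) \<le> int n \<Longrightarrow> near x k \<subseteq> lball n"
  by (auto simp: near_def lball_def)

lemma near_carrier: "near x k \<subseteq> carrier G"
  by (auto simp: near_def)

lemma finite_near: "finite (near x k)"
proof -
  have "near x k \<subseteq> lball (nat (max (len x - k) 0 + int (D + 2)))"
    by (rule near_subset_lball) simp
  then show ?thesis
    using finite_lball finite_subset by blast
qed

definition near_bound :: nat where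
  "near_bound = card (lball (3 * D + 4))"

lemma near_bound_pos: "1 \<le> near_bound"
  using card_lball_pos[of "3 * D + 4"] by (simp add: near_bound_def)

text \<open>With \<open>c\<close> the height of the set, each of its points has doubled Gromov
  product at least \<open>2 * c\<close> with \<open>x\<close>, so any two have doubled product at
  least \<open>2 * c - D\<close>. Their lengths are at most \<open>c + D + 2\<close>, hence their
  distance is at most \<open>3 * D + 4\<close>.\<close>

lemma card_near:
  assumes x: "x \<in> carrier G"
  shows "card (near x k) \<le> near_bound"
proof (cases "near x k = {}")
  case False
  then obtain v where v: "v \<in> near x k"
    by blast
  define c where "c = max (len x - k) 0"
  have close: "2 * c \<le> len w + len x - dst w x" "len w \<le> c + int (D + 2)" "w \<in> carrier G" if "w \<in> near x k" for w
  proof -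
    have w: "w \<in> carrier G" "dst x w \<le> k" "len w \<le> c + int (D + 2)"
      using that by (auto simp: near_def c_def)
    show "w \<in> carrier G" "len w \<le> c + int (D + 2)"
      by fact+
    show "2 * c \<le> len w + len x - dst w x"
      using len_triangle[OF x w(1)] dst_commute[OF x w(1)] w(2) by (auto simp: c_def max_def)
  qed
  have "inv v \<otimes> w \<in> lball (3 * D + 4)" if w: "w \<in> near x k" for w
  proof -
    have "2 * c - int D \<le> len v + len w - dst v w"
      using dst_hyperbolic[of v x w] close[OF v] close[OF w] x dst_commute[of w x] by auto
    then have "dst v w \<le> 3 * int D + 4"
      using close[OF v] close[OF w] by linarith
    then show ?thesis
      using close[OF v] close[OF w] by (simp add: lball_def dst_def)
  qed
  then show ?thesis
    unfolding near_bound_def using close(3)[OF v] near_carrier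
    by (intro card_inj_on_le[of "\<lambda>w. inv v \<otimes> w"] inj_on_left_mult) auto
qed simp

text \<open>
  A pair of points at distance at most \<open>n\<close> is joined through a point near both geodesics to the identity,
  at the height at which the two geodesics, extended to total length \<open>n\<close>, are level.  The parameter \<open>m\<close>
  is twice that height.
\<close>

lemma near_meet_iff:
  assumes x: "x \<in> carrier G" and y: "y \<in> carrier G"
  shows "near x (len x - (m + 1) div 2) \<inter> near y (len y - m div 2) \<noteq> {} \<longleftrightarrow> dst x y \<le> len x + len y - m"
proof
  assume "near x (len x - (m + 1) div 2) \<inter> near y (len y - m div 2) \<noteq> {}"
  then obtain w where w: "w \<in> carrier G" "dst x w \<le> len x - (m + 1) div 2" "dst y w \<le> len y - m div 2"
    by (auto simp: near_def)
  have "(m + 1) div 2 + m div 2 = m"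
    by presburger
  then show "dst x y \<le> len x + len y - m"
    using dst_triangle[OF x w(1) y] dst_commute[OF y w(1)] w by linarith
next
  assume le: "dst x y \<le> len x + len y - m"
  define k where "k = len x - (m + 1) div 2"
  define l where "l = len y - m div 2"
  have kl: "k + l = len x + len y - m" "2 * k \<le> 2 * len x - m" "2 * len x - m - 1 \<le> 2 * k"
    unfolding k_def l_def by presburger+
  \<comment> \<open>Half of the slack by which \<open>k + l\<close> exceeds the distance. The point
    \<open>w\<close> is taken on a geodesic from \<open>x\<close> to \<open>y\<close>, leaving
    \<open>t\<close> to spare on both sides; this is then spent moving towards the identity.\<close>
  define t where "t = (k + l - dst x y) div 2"
  have t: "2 * t \<le> k + l - dst x y" "k + l - dst x y - 1 \<le> 2 * t" "0 \<le> t"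
    using le kl(1) unfolding t_def by (presburger, presburger, simp)
  have tri: "len x \<le> dst x y + len y" "len y \<le> dst x y + len x"
    using len_triangle[OF x y] len_triangle[OF y x] dst_commute[OF x y] by simp_all
  have "0 \<le> k - t" "k - t \<le> dst x y"
    using kl t tri by linarith+
  then obtain w where w: "w \<in> carrier G" "dst x w = k - t" "dst w y = dst x y - (k - t)"
    using ex_between[OF x y] by blast
  \<comment> \<open>Hyperbolicity: a point of the side from \<open>x\<close> to \<open>y\<close> is
    close to one of the other two sides. The parity errors that follow stay within the extra
    \<open>2\<close> in \<open>near\<close>.\<close>
  have "len w \<le> max (len y - (dst x y - (k - t))) (len x - (k - t)) + int D"
    using dst_hyperbolic[OF x w(1) y] w by linarith
  then have lw: "len w - t \<le> max (m div 2 + 1) ((m + 1) div 2) + int D"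
    using t unfolding k_def l_def by linarith
  \<comment> \<open>The move stops at the identity if \<open>w\<close> is closer than
    \<open>t\<close>.\<close>
  define r where "r = min t (len w)"
  have "0 \<le> r" "r \<le> dst w \<one>"
    using t w by (auto simp: r_def dst_one)
  then obtain v where v: "v \<in> carrier G" "dst w v = r" "dst v \<one> = dst w \<one> - r"
    using ex_between[OF w(1) one_closed] by blast
  have lv: "len v = max (len w - t) 0"
    using v w by (simp add: dst_one r_def)
  have "dst x v \<le> k"
    using dst_triangle[OF x w(1) v(1)] w v by (simp add: r_def)
  moreover have "dst y v \<le> l"
    using dst_triangle[OF y w(1) v(1)] dst_commute[OF y w(1)] w v t by (simp add: r_def)
  moreover have "len v \<le> max (len x - k) 0 + int (D + 2)" "len v \<le> max (len y - l) 0 + int (D + 2)"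
    using lv lw unfolding k_def l_def by (simp_all add: max_def split: if_splits) presburger+
  ultimately have "v \<in> near x k \<inter> near y l"
    using v(1) by (simp add: near_def)
  then show "near x (len x - (m + 1) div 2) \<inter> near y (len y - m div 2) \<noteq> {}"
    unfolding k_def l_def by blast
qed

text \<open>Haagerup's inequality. Each pair \<open>x\<close>, \<open>y\<close> at distance
  \<open>n\<close> is routed through a point \<open>w\<close> near both geodesics to the identity,
  with \<open>n + 1\<close> possible levels \<open>k\<close>. For fixed \<open>k\<close> and
  \<open>w\<close>, Cauchy-Schwarz separates \<open>c\<close> from the vectors, and each value of
  \<open>c\<close> is repeated a bounded number of times. The sets of \<open>x\<close> and of
  \<open>y\<close> attached to the different \<open>w\<close> have bounded overlap, so the sum over
  \<open>w\<close> is bounded too.\<close>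

lemma conv_bound_sphere:
  assumes c: "\<And>g. g \<in> carrier G \<Longrightarrow> L g \<noteq> n \<Longrightarrow> c g = 0"
  shows "conv_bound c (real (near_bound\<^sup>2) * (real n + 1) * L2_set (\<lambda>g. cmod (c g)) (lball n))"
proof (rule conv_boundI)
  fix X Y \<eta> \<xi>
  assume XY: "finite X" "X \<subseteq> carrier G" "finite Y" "Y \<subseteq> carrier G"
  let ?N = near_bound
  define W where "W = (\<Union>x\<in>X. \<Union>k\<in>{0..int n}. near x k)"
  have W: "finite W" "W \<subseteq> carrier G"
    using XY finite_near subsetD[OF near_carrier] by (auto simp: W_def)
  define Xw where "Xw k w = {x \<in> X. w \<in> near x k}" for k w
  define Yw where "Yw k w = {y \<in> Y. w \<in> near y (int n - k)}" for k w
  have finw: "finite (Xw k w)" "finite (Yw k w)" for k w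
    using XY by (auto simp: Xw_def Yw_def)
  define a where "a x y = cmod (\<eta> x) * cmod (c (inv x \<otimes> y)) * cmod (\<xi> y)" for x y
  have a0: "0 \<le> a x y" for x y
    by (simp add: a_def)
  \<comment> \<open>Several routes may exist for one pair; overcounting is harmless as all terms are
    nonnegative.\<close>
  have cover: "a x y \<le> (\<Sum>k\<in>{0..int n}. \<Sum>w\<in>W. if w \<in> near x k \<and> w \<in> near y (int n - k) then a x y else 0)"
    if x: "x \<in> X" and y: "y \<in> Y" for x y
  proof (cases "a x y = 0")
    case False
    have xy: "x \<in> carrier G" "y \<in> carrier G"
      using x y XY by auto
    then have d: "dst x y = int n"
      using False c[of "inv x \<otimes> y"] by (auto simp: a_def dst_def)
    define m where "m = len x + len y - int n"
    define k where "k = len x - (m + 1) div 2"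
    have kl: "int n - k = len y - m div 2"
      unfolding k_def m_def by presburger
    obtain w where w: "w \<in> near x k" "w \<in> near y (int n - k)"
      using near_meet_iff[OF xy, of m] d unfolding kl unfolding k_def m_def by auto
    have k: "k \<in> {0..int n}"
      using near_nonneg[OF w(1)] near_nonneg[OF w(2)] by simp
    have wW: "w \<in> W"
      unfolding W_def using x k w(1) by blast
    have "a x y = (if w \<in> near x k \<and> w \<in> near y (int n - k) then a x y else 0)"
      using w by simp
    also have "\<dots> \<le> (\<Sum>w\<in>W. if w \<in> near x k \<and> w \<in> near y (int n - k) then a x y else 0)"
      by (rule member_le_sum[OF wW]) (use W a0 in auto)
    also have "\<dots> \<le> (\<Sum>k\<in>{0..int n}. \<Sum>w\<in>W. if w \<in> near x k \<and> w \<in> near y (int n - k) then a x y else 0)"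
      by (rule member_le_sum[OF k]) (use a0 in \<open>auto intro!: sum_nonneg\<close>)
    finally show ?thesis .
  qed (auto intro!: sum_nonneg a0)
  have block: "(\<Sum>x\<in>Xw k w. \<Sum>y\<in>Yw k w. a x y) \<le> sqrt (real ?N) * L2_set (\<lambda>g. cmod (c g)) (lball n) *
      (L2_set (\<lambda>x. cmod (\<eta> x)) (Xw k w) * L2_set (\<lambda>y. cmod (\<xi> y)) (Yw k w))" for k w
  proof -
    let ?P = "Xw k w \<times> Yw k w"
    let ?f = "\<lambda>(x, y). cmod (c (inv x \<otimes> y))" and ?g = "\<lambda>(x, y). cmod (\<eta> x) * cmod (\<xi> y)"
    have fin: "finite ?P"
      using finw by simp
    have "(\<Sum>x\<in>Xw k w. \<Sum>y\<in>Yw k w. a x y) = (\<Sum>p\<in>?P. \<bar>?f p\<bar> * \<bar>?g p\<bar>)"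
      by (auto simp: sum.cartesian_product a_def abs_mult intro!: sum.cong)
    also have "\<dots> \<le> L2_set ?f ?P * L2_set ?g ?P"
      by (rule L2_set_mult_ineq)
    also have "L2_set ?g ?P = L2_set (\<lambda>x. cmod (\<eta> x)) (Xw k w) * L2_set (\<lambda>y. cmod (\<xi> y)) (Yw k w)"
      by (simp add: L2_set_def sum_product sum.cartesian_product power_mult_distrib case_prod_unfold
          flip: real_sqrt_mult)
    finally have le: "(\<Sum>x\<in>Xw k w. \<Sum>y\<in>Yw k w. a x y)
        \<le> L2_set ?f ?P * (L2_set (\<lambda>x. cmod (\<eta> x)) (Xw k w) * L2_set (\<lambda>y. cmod (\<xi> y)) (Yw k w))" .
    \<comment> \<open>For given \<open>g\<close>, the pair is determined by
      \<open>inv x \<otimes> w\<close>, and this point lies in \<open>near g (int n - k)\<close>: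
      its length is the distance from \<open>x\<close> to \<open>w\<close>, its distance from
      \<open>g\<close> that from \<open>y\<close> to \<open>w\<close>.\<close>
    have fiber: "card {p \<in> ?P. inv (fst p) \<otimes> snd p = g} \<le> ?N" if g: "g \<in> carrier G" "L g = n" for g
    proof -
      have "card {p \<in> ?P. inv (fst p) \<otimes> snd p = g} \<le> card (near g (int n - k))"
      proof (rule card_inj_on_le[of "\<lambda>p. inv (fst p) \<otimes> w"])
        show "inj_on (\<lambda>p. inv (fst p) \<otimes> w) {p \<in> ?P. inv (fst p) \<otimes> snd p = g}"
        proof (rule inj_onI)
          fix p q assume p: "p \<in> {p \<in> ?P. inv (fst p) \<otimes> snd p = g}" and q: "q \<in> {p \<in> ?P. inv (fst p) \<otimes> snd p = g}"
            and eq: "inv (fst p) \<otimes> w = inv (fst q) \<otimes> w"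
          have car: "fst p \<in> carrier G" "snd p \<in> carrier G" "fst q \<in> carrier G" "snd q \<in> carrier G" "w \<in> carrier G"
            using p q XY by (auto simp: Xw_def Yw_def near_def)
          then have "inv (fst p) = inv (fst q)"
            using eq by simp
          then have 1: "fst p = fst q"
            using car inv_inv by metis
          have "inv (fst p) \<otimes> snd p = inv (fst p) \<otimes> snd q"
            using p q 1 by simp
          then have "snd p = snd q"
            using car by (metis Units_l_cancel Units_eq inv_closed)
          then show "p = q"
            using 1 by (simp add: prod_eq_iff)
        qed
        show "(\<lambda>p. inv (fst p) \<otimes> w) ` {p \<in> ?P. inv (fst p) \<otimes> snd p = g} \<subseteq> near g (int n - k)"
        proof clarify
          fix x y assume xy: "x \<in> Xw k w" "y \<in> Yw k w" and ge: "g = inv (fst (x, y)) \<otimes> snd (x, y)"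
          have car: "x \<in> carrier G" "y \<in> carrier G" "w \<in> carrier G"
            using xy XY by (auto simp: Xw_def Yw_def near_def)
          have "inv g \<otimes> (inv x \<otimes> w) = inv y \<otimes> w"
            using car by (simp add: ge inv_mult_group m_assoc) (simp flip: m_assoc)
          then have "dst g (inv x \<otimes> w) = dst y w"
            by (simp add: dst_def)
          moreover have "len (inv x \<otimes> w) = dst x w"
            by (simp add: dst_def)
          moreover have "dst x w \<le> k" "dst y w \<le> int n - k"
            using xy by (auto simp: Xw_def Yw_def near_def)
          ultimately show "inv (fst (x, y)) \<otimes> w \<in> near (inv (fst (x, y)) \<otimes> snd (x, y)) (int n - k)"
            using car g by (simp add: near_def flip: ge) (simp add: ge)
        qed
      qed (rule finite_near)
      also have "\<dots> \<le> ?N"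
        using g by (intro card_near)
      finally show ?thesis .
    qed
    have "(L2_set ?f ?P)\<^sup>2 = (\<Sum>p\<in>?P. (cmod (c (inv (fst p) \<otimes> snd p)))\<^sup>2)"
      by (simp add: L2_set_power2 case_prod_unfold)
    also have "\<dots> = (\<Sum>p\<in>?P. \<Sum>g\<in>lball n. if inv (fst p) \<otimes> snd p = g then (cmod (c g))\<^sup>2 else 0)"
    proof (intro sum.cong refl)
      fix p assume "p \<in> ?P"
      then have "inv (fst p) \<otimes> snd p \<in> carrier G"
        using XY by (auto simp: Xw_def Yw_def subset_iff)
      then have "c (inv (fst p) \<otimes> snd p) = 0" if "inv (fst p) \<otimes> snd p \<notin> lball n"
        using that by (intro c) (auto simp: lball_def)
      then show "(cmod (c (inv (fst p) \<otimes> snd p)))\<^sup>2 = (\<Sum>g\<in>lball n. if inv (fst p) \<otimes> snd p = g then (cmod (c g))\<^sup>2 else 0)"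
        by auto
    qed
    also have "\<dots> = (\<Sum>g\<in>lball n. \<Sum>p\<in>?P. if inv (fst p) \<otimes> snd p = g then (cmod (c g))\<^sup>2 else 0)"
      by (rule sum.swap)
    also have "\<dots> = (\<Sum>g\<in>lball n. real (card {p \<in> ?P. inv (fst p) \<otimes> snd p = g}) * (cmod (c g))\<^sup>2)"
      using fin by (simp flip: sum.inter_filter)
    also have "\<dots> \<le> (\<Sum>g\<in>lball n. real ?N * (cmod (c g))\<^sup>2)"
    proof (intro sum_mono)
      fix g assume "g \<in> lball n"
      then have "g \<in> carrier G"
        by (simp add: lball_def)
      then show "real (card {p \<in> ?P. inv (fst p) \<otimes> snd p = g}) * (cmod (c g))\<^sup>2 \<le> real ?N * (cmod (c g))\<^sup>2"
        using fiber[of g] c[of g] by (cases "L g = n") (auto intro!: mult_right_mono)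
    qed
    also have "\<dots> = (sqrt (real ?N) * L2_set (\<lambda>g. cmod (c g)) (lball n))\<^sup>2"
      by (simp add: power_mult_distrib L2_set_power2 sum_distrib_left)
    finally have "L2_set ?f ?P \<le> sqrt (real ?N) * L2_set (\<lambda>g. cmod (c g)) (lball n)"
      by (rule power2_le_imp_le) simp
    from order_trans[OF le mult_right_mono[OF this]] show ?thesis
      by simp
  qed
  \<comment> \<open>Each \<open>x\<close> and each \<open>y\<close> belongs to at most
    \<open>near_bound\<close> of the pieces.\<close>
  have level: "(\<Sum>w\<in>W. L2_set (\<lambda>x. cmod (\<eta> x)) (Xw k w) * L2_set (\<lambda>y. cmod (\<xi> y)) (Yw k w))
      \<le> real ?N * (L2_set (\<lambda>x. cmod (\<eta> x)) X * L2_set (\<lambda>y. cmod (\<xi> y)) Y)" for k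
  proof -
    have cx: "card {w \<in> W. w \<in> near x k} \<le> ?N" if "x \<in> X" for x
      using that XY by (intro order_trans[OF card_mono card_near[of x k]] finite_near) auto
    have cy: "card {w \<in> W. w \<in> near y (int n - k)} \<le> ?N" if "y \<in> Y" for y
      using that XY by (intro order_trans[OF card_mono card_near[of y "int n - k"]] finite_near) auto
    have "(\<Sum>w\<in>W. L2_set (\<lambda>x. cmod (\<eta> x)) (Xw k w) * L2_set (\<lambda>y. cmod (\<xi> y)) (Yw k w))
        \<le> L2_set (\<lambda>w. L2_set (\<lambda>x. cmod (\<eta> x)) (Xw k w)) W * L2_set (\<lambda>w. L2_set (\<lambda>y. cmod (\<xi> y)) (Yw k w)) W"
      using L2_set_mult_ineq[of "\<lambda>w. L2_set (\<lambda>x. cmod (\<eta> x)) (Xw k w)" "\<lambda>w. L2_set (\<lambda>y. cmod (\<xi> y)) (Yw k w)" W]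
      by simp
    also have "\<dots> \<le> (sqrt (real ?N) * L2_set (\<lambda>x. cmod (\<eta> x)) X) * (sqrt (real ?N) * L2_set (\<lambda>y. cmod (\<xi> y)) Y)"
    proof (rule mult_mono)
      show "L2_set (\<lambda>w. L2_set (\<lambda>x. cmod (\<eta> x)) (Xw k w)) W \<le> sqrt (real ?N) * L2_set (\<lambda>x. cmod (\<eta> x)) X"
        by (rule power2_le_imp_le)
          (use sum_L2_set_power2_le[of X W "\<lambda>w x. w \<in> near x k" ?N "\<lambda>x. cmod (\<eta> x)"] XY W cx in
            \<open>simp_all add: L2_set_power2[of _ W] power_mult_distrib Xw_def\<close>)
      show "L2_set (\<lambda>w. L2_set (\<lambda>y. cmod (\<xi> y)) (Yw k w)) W \<le> sqrt (real ?N) * L2_set (\<lambda>y. cmod (\<xi> y)) Y"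
        by (rule power2_le_imp_le)
          (use sum_L2_set_power2_le[of Y W "\<lambda>w y. w \<in> near y (int n - k)" ?N "\<lambda>y. cmod (\<xi> y)"] XY W cy in
            \<open>simp_all add: L2_set_power2[of _ W] power_mult_distrib Yw_def\<close>)
    qed auto
    also have "\<dots> = real ?N * (L2_set (\<lambda>x. cmod (\<eta> x)) X * L2_set (\<lambda>y. cmod (\<xi> y)) Y)"
      by simp
    finally show ?thesis .
  qed
  let ?C = "L2_set (\<lambda>g. cmod (c g)) (lball n)" and ?R = "L2_set (\<lambda>x. cmod (\<eta> x)) X * L2_set (\<lambda>y. cmod (\<xi> y)) Y"
  have "cmod (\<Sum>x\<in>X. \<Sum>y\<in>Y. \<eta> x * c (inv x \<otimes> y) * \<xi> y) \<le> (\<Sum>x\<in>X. \<Sum>y\<in>Y. a x y)"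
    by (intro sum_norm_le) (simp add: a_def norm_mult)
  also have "\<dots> \<le> (\<Sum>x\<in>X. \<Sum>y\<in>Y. \<Sum>k\<in>{0..int n}. \<Sum>w\<in>W. if w \<in> near x k \<and> w \<in> near y (int n - k) then a x y else 0)"
    by (intro sum_mono cover)
  also have "\<dots> = (\<Sum>x\<in>X. \<Sum>k\<in>{0..int n}. \<Sum>y\<in>Y. \<Sum>w\<in>W. if w \<in> near x k \<and> w \<in> near y (int n - k) then a x y else 0)"
    by (rule sum.cong[OF refl], rule sum.swap)
  also have "\<dots> = (\<Sum>k\<in>{0..int n}. \<Sum>x\<in>X. \<Sum>y\<in>Y. \<Sum>w\<in>W. if w \<in> near x k \<and> w \<in> near y (int n - k) then a x y else 0)"
    by (rule sum.swap)
  also have "\<dots> = (\<Sum>k\<in>{0..int n}. \<Sum>x\<in>X. \<Sum>w\<in>W. \<Sum>y\<in>Y. if w \<in> near x k \<and> w \<in> near y (int n - k) then a x y else 0)"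
    by (rule sum.cong[OF refl], rule sum.cong[OF refl], rule sum.swap)
  also have "\<dots> = (\<Sum>k\<in>{0..int n}. \<Sum>w\<in>W. \<Sum>x\<in>X. \<Sum>y\<in>Y. if w \<in> near x k \<and> w \<in> near y (int n - k) then a x y else 0)"
    by (rule sum.cong[OF refl], rule sum.swap)
  also have "\<dots> = (\<Sum>k\<in>{0..int n}. \<Sum>w\<in>W. \<Sum>x\<in>Xw k w. \<Sum>y\<in>Yw k w. a x y)"
  proof (intro sum.cong[OF refl])
    fix k w
    have "(\<Sum>y\<in>Y. if w \<in> near x k \<and> w \<in> near y (int n - k) then a x y else 0)
        = (if w \<in> near x k then \<Sum>y\<in>Yw k w. a x y else 0)" for x
      using XY by (simp add: Yw_def sum.inter_filter)
    then show "(\<Sum>x\<in>X. \<Sum>y\<in>Y. if w \<in> near x k \<and> w \<in> near y (int n - k) then a x y else 0)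
        = (\<Sum>x\<in>Xw k w. \<Sum>y\<in>Yw k w. a x y)"
      using XY by (simp add: Xw_def sum.inter_filter)
  qed
  also have "\<dots> \<le> (\<Sum>k\<in>{0..int n}. \<Sum>w\<in>W. sqrt (real ?N) * ?C *
      (L2_set (\<lambda>x. cmod (\<eta> x)) (Xw k w) * L2_set (\<lambda>y. cmod (\<xi> y)) (Yw k w)))"
    by (intro sum_mono block)
  also have "\<dots> = (\<Sum>k\<in>{0..int n}. sqrt (real ?N) * ?C *
      (\<Sum>w\<in>W. L2_set (\<lambda>x. cmod (\<eta> x)) (Xw k w) * L2_set (\<lambda>y. cmod (\<xi> y)) (Yw k w)))"
    by (simp only: sum_distrib_left)
  also have "\<dots> \<le> (\<Sum>k\<in>{0..int n}. sqrt (real ?N) * ?C * (real ?N * ?R))"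
    by (intro sum_mono mult_left_mono level) auto
  also have "\<dots> = (real n + 1) * (sqrt (real ?N) * ?C * (real ?N * ?R))"
    by simp
  also have "\<dots> \<le> (real n + 1) * (real ?N * ?C * (real ?N * ?R))"
  proof (intro mult_left_mono mult_right_mono)
    show "sqrt (real ?N) \<le> real ?N"
      using near_bound_pos by (intro real_le_lsqrt) (simp_all add: power2_eq_square)
  qed auto
  finally show "cmod (\<Sum>x\<in>X. \<Sum>y\<in>Y. \<eta> x * c (inv x \<otimes> y) * \<xi> y) \<le> real (?N\<^sup>2) * (real n + 1) * ?C * ?R"
    by (simp add: power2_eq_square mult_ac)
qed

text \<open>There are \<open>n + 1\<close> spheres in the ball and each costs a factor
  \<open>n + 1\<close>, whence the exponent \<open>2\<close>.\<close>

lemma rapid_decay_hyperbolic: rapid_decay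
  unfolding rapid_decay_def
proof (intro exI[of _ "real (near_bound\<^sup>2)"] exI[of _ 2] conjI allI impI)
  show "1 \<le> real (near_bound\<^sup>2)"
    using near_bound_pos by (simp flip: of_nat_power)
  fix n c assume sup: "\<forall>g\<in>carrier G. n < L g \<longrightarrow> c g = (0 :: complex)"
  let ?c = "\<lambda>j g. if L g = j then c g else 0" and ?N = "real (near_bound\<^sup>2)"
  let ?B = "?N * (real n + 1) * L2_set (\<lambda>g. cmod (c g)) (lball n)"
  have "conv_bound (?c j) ?B" if "j \<in> {..n}" for j
  proof (rule conv_bound_mono[OF conv_bound_sphere[of j]])
    show "?N * (real j + 1) * L2_set (\<lambda>g. cmod (?c j g)) (lball j) \<le> ?B"
    proof (intro mult_mono order_refl)
      have "L2_set (\<lambda>g. cmod (?c j g)) (lball j) \<le> L2_set (\<lambda>g. cmod (c g)) (lball j)"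
        by (rule L2_set_mono) auto
      also have "\<dots> \<le> L2_set (\<lambda>g. cmod (c g)) (lball n)"
        using that by (intro L2_set_subset_mono lball_mono) auto
      finally show "L2_set (\<lambda>g. cmod (?c j g)) (lball j) \<le> L2_set (\<lambda>g. cmod (c g)) (lball n)" .
    qed (use that in auto)
  qed auto
  then have "conv_bound (\<lambda>g. \<Sum>j\<le>n. ?c j g) (\<Sum>j\<le>n. ?B)"
    by (intro conv_bound_sum) auto
  moreover have "(\<Sum>j\<le>n. ?c j g) = c g" if "g \<in> carrier G" for g
    using sup that by auto
  ultimately have "conv_bound c (\<Sum>j\<le>n. ?B)"
    by (rule conv_bound_cong[THEN iffD1, rotated])
  then show "conv_bound c (?N * (real n + 1)\<^sup>2 * L2_set (\<lambda>g. cmod (c g)) (lball n))"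
    by (simp add: power2_eq_square mult_ac add.commute)
qed

end

section \<open>Averages of balls as multipliers of hyperbolic groups\<close>

lemma sum_Pow_alternating:
  assumes "finite T"
  shows "(\<Sum>S\<in>Pow T. (- 1 :: real) ^ card S) = (if T = {} then 1 else 0)"
proof -
  have "walsh T S = (- 1) ^ card S" if "S \<in> Pow T" for S
  proof -
    have "walsh T S = (\<Prod>g\<in>T \<inter> S. - 1)"
      unfolding walsh_def flip_def by (simp only: prod.inter_restrict[OF assms])
    also have "T \<inter> S = S"
      using that by blast
    finally show ?thesis
      by simp
  qed
  then have "(\<Sum>S\<in>Pow T. (- 1 :: real) ^ card S) = (\<Sum>S\<in>Pow T. walsh T S)"
    by simp
  then show ?thesis
    using sum_walsh[OF assms order_refl] by auto
qed

text \<open>Each term factors into a condition on \<open>A\<close> and a condition on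
  \<open>B\<close>; this is what makes the relation that two sets meet accessible to
  \<open>conv_bound_schur\<close>. The set \<open>U\<close> supplies one finite range for the index
  \<open>S\<close>.\<close>

lemma sum_common_subsets:
  assumes U: "finite U" and AB: "A \<inter> B \<subseteq> U"
  shows "(\<Sum>S\<in>Pow U. if S \<noteq> {} \<and> S \<subseteq> A \<and> S \<subseteq> B then - ((- 1 :: real) ^ card S) else 0)
    = (if A \<inter> B = {} then 0 else 1)"
proof -
  have fin: "finite (A \<inter> B)"
    using AB U finite_subset by blast
  have "(\<Sum>S\<in>Pow U. if S \<noteq> {} \<and> S \<subseteq> A \<and> S \<subseteq> B then - ((- 1 :: real) ^ card S) else 0)
      = (\<Sum>S\<in>Pow (A \<inter> B) - {{}}. - ((- 1) ^ card S))"
    using U AB by (intro sum.mono_neutral_cong_right) auto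
  also have "\<dots> = - ((\<Sum>S\<in>Pow (A \<inter> B). (- 1) ^ card S) - 1)"
    by (subst sum.remove[OF finite_Pow_iff[THEN iffD2, OF fin], of "{}"]) (simp_all add: sum_negf)
  finally show ?thesis
    using sum_Pow_alternating[OF fin] by simp
qed

context hyperbolic_length_group
begin

definition window :: "nat \<Rightarrow> int set" where
  "window N = {int N..<2 * int N}"

text \<open>An average of indicators of balls of radius \<open>s + t\<close>. A single radius would
  be a constraint involving \<open>x\<close> and \<open>y\<close> together; with two window
  variables, \<open>s\<close> can be tested on \<open>x\<close> alone and \<open>t\<close> on
  \<open>y\<close> alone.\<close>

definition plateau :: "nat \<Rightarrow> 'a \<Rightarrow> real" where
  "plateau N g = real (card {p \<in> window N \<times> window N. len g \<le> fst p + snd p}) / (real N)\<^sup>2"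

lemma card_window: "card (window N \<times> window N) = N\<^sup>2" "finite (window N)"
  by (simp_all add: window_def card_cartesian_product power2_eq_square)

lemma plateau_bounds: "0 \<le> plateau N g" "plateau N g \<le> 1"
proof -
  have "card {p \<in> window N \<times> window N. len g \<le> fst p + snd p} \<le> N\<^sup>2"
    unfolding card_window(1)[symmetric] by (intro card_mono) (auto simp: card_window(2))
  then have "real (card {p \<in> window N \<times> window N. len g \<le> fst p + snd p}) \<le> real (N\<^sup>2)"
    by (simp only: of_nat_le_iff)
  then show "plateau N g \<le> 1"
    by (simp add: plateau_def divide_le_eq)
qed (simp add: plateau_def)

lemma plateau_eq_1:
  assumes "L g \<le> 2 * N" "0 < N"
  shows "plateau N g = 1"
proof -
  have "{p \<in> window N \<times> window N. len g \<le> fst p + snd p} = window N \<times> window N"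
    using assms by (auto simp: window_def)
  then show ?thesis
    using assms by (simp add: plateau_def card_window(1) del: card_cartesian_product)
qed

lemma plateau_eq_0: "4 * N < L g \<Longrightarrow> plateau N g = 0"
proof -
  assume "4 * N < L g"
  then have empty: "{p \<in> window N \<times> window N. len g \<le> fst p + snd p} = {}"
    by (auto simp: window_def)
  show ?thesis
    unfolding plateau_def empty by simp
qed

text \<open>In the index, \<open>m\<close> is the height parameter of \<open>near_meet_iff\<close>,
  \<open>S\<close> is the subset in the inclusion-exclusion, and \<open>a\<close> offsets the levels
  \<open>k\<close> of \<open>x\<close> and \<open>l\<close> of \<open>y\<close> from the window
  variables: \<open>s = k + a\<close> and \<open>t = l - a\<close>. Thus
  \<open>s + t = k + l\<close> holds although neither factor sees the other point.\<close>

definition left_factor :: "nat \<Rightarrow> int \<times> int \<times> 'a set \<Rightarrow> 'a \<Rightarrow> real" where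
  "left_factor N = (\<lambda>(a, m, S) x. if S \<noteq> {} \<and> S \<subseteq> near x (len x - (m + 1) div 2) \<and>
      len x - (m + 1) div 2 + a \<in> window N then 1 / real N else 0)"

definition right_factor :: "nat \<Rightarrow> int \<times> int \<times> 'a set \<Rightarrow> 'a \<Rightarrow> real" where
  "right_factor N = (\<lambda>(a, m, S) y. if S \<subseteq> near y (len y - m div 2) \<and>
      len y - m div 2 - a \<in> window N then - ((- 1) ^ card S) / real N else 0)"

text \<open>There are at most \<open>4 * N\<close> values of \<open>a\<close>, for each of them
  \<open>2 * N\<close> values of \<open>m\<close>, and then \<open>2 ^ b\<close> subsets, with terms
  of size at most \<open>1 / N\<^sup>2\<close>. The normalisation cancels \<open>N\<close>, and the
  ranges of \<open>m\<close> and \<open>S\<close> do not matter.\<close>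

lemma sum_window_le:
  assumes "finite I" "finite J" "finite U" "0 < N" and card: "real (card I) \<le> 4 * real N"
    and T: "\<And>m. card (T m) \<le> b" "\<And>m. finite (T m)"
    and f: "\<And>a m S. f a m S \<noteq> 0 \<Longrightarrow> S \<subseteq> T m \<and> h a < m \<and> m \<le> h a + 2 * int N"
      "\<And>a m S. f a m S \<le> 1 / (real N)\<^sup>2"
  shows "(\<Sum>a\<in>I. \<Sum>m\<in>J. \<Sum>S\<in>Pow U. f a m S) \<le> 8 * 2 ^ b"
proof -
  let ?c = "2 ^ b / (real N)\<^sup>2"
  have one: "(\<Sum>S\<in>Pow U. f a m S) \<le> (if m \<in> {h a <.. h a + 2 * int N} then ?c else 0)" for a m
  proof (cases "m \<in> {h a <.. h a + 2 * int N}")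
    case True
    have "(\<Sum>S\<in>Pow U. f a m S) \<le> (\<Sum>S\<in>Pow U. if S \<in> Pow (T m) then 1 / (real N)\<^sup>2 else 0)"
    proof (rule sum_mono)
      fix S
      show "f a m S \<le> (if S \<in> Pow (T m) then 1 / (real N)\<^sup>2 else 0)"
        using f(1)[of a m S] f(2)[of a m S] by (cases "f a m S = 0") auto
    qed
    also have "\<dots> = (\<Sum>S\<in>Pow U \<inter> Pow (T m). 1 / (real N)\<^sup>2)"
      using assms by (simp only: sum.inter_restrict finite_Pow_iff)
    also have "\<dots> = real (card (Pow U \<inter> Pow (T m))) * (1 / (real N)\<^sup>2)"
      by simp
    also have "\<dots> \<le> 2 ^ b * (1 / (real N)\<^sup>2)"
    proof (rule mult_right_mono)
      have "card (Pow U \<inter> Pow (T m)) \<le> card (Pow (T m))"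
        using T(2) by (intro card_mono) auto
      also have "\<dots> = 2 ^ card (T m)"
        using T(2) by (simp add: card_Pow)
      also have "\<dots> \<le> 2 ^ b"
        using T(1) by (intro power_increasing) auto
      finally have "real (card (Pow U \<inter> Pow (T m))) \<le> real (2 ^ b)"
        by (simp only: of_nat_le_iff)
      then show "real (card (Pow U \<inter> Pow (T m))) \<le> 2 ^ b"
        by simp
    qed simp
    finally show ?thesis
      using True by simp
  next
    case False
    then have "f a m S = 0" for S
      using f(1)[of a m S] by auto
    then show ?thesis
      using False by simp
  qed
  have two: "(\<Sum>m\<in>J. \<Sum>S\<in>Pow U. f a m S) \<le> 2 * real N * ?c" for a
  proof -
    have "(\<Sum>m\<in>J. \<Sum>S\<in>Pow U. f a m S) \<le> (\<Sum>m\<in>J. if m \<in> {h a <.. h a + 2 * int N} then ?c else 0)"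
      by (intro sum_mono one)
    also have "\<dots> = (\<Sum>m\<in>J \<inter> {h a <.. h a + 2 * int N}. ?c)"
      using assms by (simp only: sum.inter_restrict)
    also have "\<dots> \<le> (\<Sum>m\<in>{h a <.. h a + 2 * int N}. ?c)"
      by (intro sum_mono2) auto
    finally show ?thesis
      by simp
  qed
  have "(\<Sum>a\<in>I. \<Sum>m\<in>J. \<Sum>S\<in>Pow U. f a m S) \<le> (\<Sum>a\<in>I. 2 * real N * ?c)"
    by (intro sum_mono two)
  also have "\<dots> = real (card I) * (2 * real N * ?c)"
    by simp
  also have "\<dots> \<le> 4 * real N * (2 * real N * ?c)"
    by (intro mult_right_mono card) auto
  also have "\<dots> = 8 * 2 ^ b"
    using assms(4) by (simp add: power2_eq_square)
  finally show ?thesis .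
qed

text \<open>For fixed \<open>a\<close> and \<open>m\<close>, the sum over \<open>S\<close> is the
  indicator that the two near sets meet, that is, of \<open>dst x y \<le> k + l\<close>. It remains
  to match the pairs \<open>a\<close>, \<open>m\<close> with the window pairs.\<close>

lemma plateau_factorization:
  assumes N: "0 < N" and x: "x \<in> carrier G" and y: "y \<in> carrier G"
    and K: "4 * N + L x + L y \<le> K" and U: "U = lball (K + D + 3)"
  shows "plateau N (inv x \<otimes> y) = (\<Sum>s\<in>{- 2 * int N<..<2 * int N} \<times> {- int K..int K} \<times> Pow U.
    left_factor N s x * right_factor N s y)"
proof -
  let ?A = "{- 2 * int N<..<2 * int N}" and ?M = "{- int K..int K}"
  let ?k = "\<lambda>m. len x - (m + 1) div 2" and ?l = "\<lambda>m. len y - m div 2"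
  have kl: "?k m + ?l m = len x + len y - m" for m
    by presburger
  have inner: "(\<Sum>S\<in>Pow U. left_factor N (a, m, S) x * right_factor N (a, m, S) y)
      = (if ?k m + a \<in> window N \<and> ?l m - a \<in> window N \<and> dst x y \<le> ?k m + ?l m then 1 / (real N)\<^sup>2 else 0)"
    if "m \<in> ?M" for a m
  proof (cases "?k m + a \<in> window N \<and> ?l m - a \<in> window N")
    case True
    have "near x (?k m) \<subseteq> U"
      unfolding U using that by (intro near_subset_lball) auto
    then have sub: "near x (?k m) \<inter> near y (?l m) \<subseteq> U"
      by blast
    have "(\<Sum>S\<in>Pow U. left_factor N (a, m, S) x * right_factor N (a, m, S) y)
      = (\<Sum>S\<in>Pow U. (if S \<noteq> {} \<and> S \<subseteq> near x (?k m) \<and> S \<subseteq> near y (?l m) then - ((- 1 :: real) ^ card S) else 0) / (real N)\<^sup>2)"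
      using True by (intro sum.cong) (auto simp: left_factor_def right_factor_def power2_eq_square)
    also have "\<dots> = (if near x (?k m) \<inter> near y (?l m) = {} then 0 else 1) / (real N)\<^sup>2"
      unfolding sum_divide_distrib[symmetric] using sub by (subst sum_common_subsets) (auto simp: U finite_ball lball_def)
    finally show ?thesis
      using True near_meet_iff[OF x y, of m] unfolding kl by auto
  qed (auto simp: left_factor_def right_factor_def intro!: sum.neutral)
  define Z where "Z = {p \<in> ?A \<times> ?M. ?k (snd p) + fst p \<in> window N \<and> ?l (snd p) - fst p \<in> window N \<and>
    dst x y \<le> ?k (snd p) + ?l (snd p)}"
  have "(\<Sum>s\<in>?A \<times> ?M \<times> Pow U. left_factor N s x * right_factor N s y)
      = (\<Sum>a\<in>?A. \<Sum>m\<in>?M. \<Sum>S\<in>Pow U. left_factor N (a, m, S) x * right_factor N (a, m, S) y)"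
    by (simp add: sum.cartesian_product)
  also have "\<dots> = (\<Sum>a\<in>?A. \<Sum>m\<in>?M. if ?k m + a \<in> window N \<and> ?l m - a \<in> window N \<and> dst x y \<le> ?k m + ?l m then 1 / (real N)\<^sup>2 else 0)"
    by (intro sum.cong refl inner)
  also have "\<dots> = (\<Sum>p\<in>?A \<times> ?M. if ?k (snd p) + fst p \<in> window N \<and> ?l (snd p) - fst p \<in> window N \<and>
      dst x y \<le> ?k (snd p) + ?l (snd p) then 1 / (real N)\<^sup>2 else 0)"
    by (simp only: sum.cartesian_product case_prod_unfold)
  also have "\<dots> = (\<Sum>p\<in>Z. 1 / (real N)\<^sup>2)"
    unfolding Z_def by (intro sum.inter_filter[symmetric]) auto
  also have "\<dots> = real (card Z) / (real N)\<^sup>2"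
    by simp
  \<comment> \<open>Given \<open>x\<close> and \<open>y\<close>, the pair \<open>s\<close>,
    \<open>t\<close> recovers \<open>m\<close> from its sum and then \<open>a\<close> from
    \<open>s\<close>.\<close>
  also have "card Z = card {p \<in> window N \<times> window N. dst x y \<le> fst p + snd p}"
  proof (rule bij_betw_same_card[of "\<lambda>p. (?k (snd p) + fst p, ?l (snd p) - fst p)"],
      rule bij_betw_byWitness[where f' = "\<lambda>p. (fst p - ?k (len x + len y - fst p - snd p), len x + len y - fst p - snd p)"])
    show "\<forall>p\<in>Z. (fst (?k (snd p) + fst p, ?l (snd p) - fst p) -
        ?k (len x + len y - fst (?k (snd p) + fst p, ?l (snd p) - fst p) - snd (?k (snd p) + fst p, ?l (snd p) - fst p)),
        len x + len y - fst (?k (snd p) + fst p, ?l (snd p) - fst p) - snd (?k (snd p) + fst p, ?l (snd p) - fst p)) = p"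
    proof
      fix p assume "p \<in> Z"
      obtain a m where p: "p = (a, m)"
        by (cases p)
      have m: "len x + len y - (?k m + a) - (?l m - a) = m"
        using kl[of m] by linarith
      show "(fst (?k (snd p) + fst p, ?l (snd p) - fst p) -
        ?k (len x + len y - fst (?k (snd p) + fst p, ?l (snd p) - fst p) - snd (?k (snd p) + fst p, ?l (snd p) - fst p)),
        len x + len y - fst (?k (snd p) + fst p, ?l (snd p) - fst p) - snd (?k (snd p) + fst p, ?l (snd p) - fst p)) = p"
        unfolding p fst_conv snd_conv m by simp
    qed
    show "\<forall>p\<in>{p \<in> window N \<times> window N. dst x y \<le> fst p + snd p}.
        (?k (snd (fst p - ?k (len x + len y - fst p - snd p), len x + len y - fst p - snd p)) +
          fst (fst p - ?k (len x + len y - fst p - snd p), len x + len y - fst p - snd p),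
         ?l (snd (fst p - ?k (len x + len y - fst p - snd p), len x + len y - fst p - snd p)) -
          fst (fst p - ?k (len x + len y - fst p - snd p), len x + len y - fst p - snd p)) = p"
    proof
      fix p :: "int \<times> int"
      obtain s t where p: "p = (s, t)"
        by (cases p)
      have "?l (len x + len y - s - t) - (s - ?k (len x + len y - s - t)) = t"
        using kl[of "len x + len y - s - t"] by linarith
      then show "(?k (snd (fst p - ?k (len x + len y - fst p - snd p), len x + len y - fst p - snd p)) +
          fst (fst p - ?k (len x + len y - fst p - snd p), len x + len y - fst p - snd p),
         ?l (snd (fst p - ?k (len x + len y - fst p - snd p), len x + len y - fst p - snd p)) -
          fst (fst p - ?k (len x + len y - fst p - snd p), len x + len y - fst p - snd p)) = p"
        unfolding p fst_conv snd_conv by simp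
    qed
    show "(\<lambda>p. (?k (snd p) + fst p, ?l (snd p) - fst p)) ` Z \<subseteq> {p \<in> window N \<times> window N. dst x y \<le> fst p + snd p}"
      by (auto simp: Z_def)
    show "(\<lambda>p. (fst p - ?k (len x + len y - fst p - snd p), len x + len y - fst p - snd p)) `
        {p \<in> window N \<times> window N. dst x y \<le> fst p + snd p} \<subseteq> Z"
    proof
      fix q assume "q \<in> (\<lambda>p. (fst p - ?k (len x + len y - fst p - snd p), len x + len y - fst p - snd p)) `
        {p \<in> window N \<times> window N. dst x y \<le> fst p + snd p}"
      then obtain s t where st: "s \<in> window N" "t \<in> window N" "dst x y \<le> s + t"
        and q: "q = (s - ?k (len x + len y - s - t), len x + len y - s - t)"
        by auto
      define m where "m = len x + len y - s - t"
      have k: "?k m + ?l m = s + t"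
        using kl[of m] by (simp add: m_def)
      \<comment> \<open>Sets that meet have nonnegative levels. Hence \<open>a = s - k\<close> is
        below \<open>2 * N\<close> and \<open>a = l - t\<close> is above \<open>- 2 * N\<close>,
        which is the range chosen for \<open>a\<close>.\<close>
      have "near x (?k m) \<inter> near y (?l m) \<noteq> {}"
        using near_meet_iff[OF x y, of m] st by (simp add: m_def)
      then have "0 \<le> ?k m" "0 \<le> ?l m"
        using near_nonneg by blast+
      moreover have "s - ?k m = ?l m - t"
        using k by linarith
      ultimately have "s - ?k m \<in> ?A"
        using st by (auto simp: window_def)
      moreover have "m \<in> ?M"
        using st K by (auto simp: m_def window_def)
      moreover have "?k m + (s - ?k m) = s" "?l m - (s - ?k m) = t"
        using k by linarith+
      ultimately show "q \<in> Z"
        using st k unfolding q m_def[symmetric] Z_def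
        by (simp only: mem_Collect_eq mem_Times_iff fst_conv snd_conv simp_thms)
    qed
  qed
  finally show ?thesis
    by (simp add: plateau_def dst_def)
qed

lemma conv_bound_plateau:
  assumes c: "conv_bound c K" and N: "0 < N"
  shows "conv_bound (\<lambda>g. of_real (plateau N g) * c g) (8 * 2 ^ near_bound * K)"
proof (rule conv_bound_schur[OF c, where P = "left_factor N" and Q = "right_factor N"])
  fix X Y assume XY: "finite X" "X \<subseteq> carrier G" "finite Y" "Y \<subseteq> carrier G"
  let ?A = "{- 2 * int N<..<2 * int N}"
  \<comment> \<open>Large enough to contain \<open>m = len x + len y - s - t\<close> for all points
    and window variables at hand; the final bound is independent of it.\<close>
  define J where "J = 4 * N + 2 * (\<Sum>z\<in>X \<union> Y. L z)"
  define U where "U = lball (J + D + 3)"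
  let ?\<Omega> = "?A \<times> {- int J..int J} \<times> Pow U"
  have le: "L z \<le> (\<Sum>z\<in>X \<union> Y. L z)" if "z \<in> X \<union> Y" for z
    using that XY by (intro member_le_sum) auto
  have fact: "plateau N (inv x \<otimes> y) = (\<Sum>s\<in>?\<Omega>. left_factor N s x * right_factor N s y)" if "x \<in> X" "y \<in> Y" for x y
  proof (rule plateau_factorization[OF N _ _ _ U_def])
    show "4 * N + L x + L y \<le> J"
      using le[of x] le[of y] that by (simp add: J_def)
  qed (use that XY in auto)
  have card: "real (card ?A) \<le> 4 * real N"
    using N by simp
  have left: "(\<Sum>s\<in>?\<Omega>. (left_factor N s x)\<^sup>2) \<le> 8 * 2 ^ near_bound" if "x \<in> X" for x
  proof -
    have "(\<Sum>s\<in>?\<Omega>. (left_factor N s x)\<^sup>2)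
        = (\<Sum>a\<in>?A. \<Sum>m\<in>{- int J..int J}. \<Sum>S\<in>Pow U. (left_factor N (a, m, S) x)\<^sup>2)"
      by (simp add: sum.cartesian_product)
    also have "\<dots> \<le> 8 * 2 ^ near_bound"
    \<comment> \<open>The window confines \<open>(m + 1) div 2\<close> to \<open>N\<close>
      consecutive values, hence \<open>m\<close> to \<open>2 * N\<close>.\<close>
    proof (rule sum_window_le[OF _ _ _ N card, where T = "\<lambda>m. near x (len x - (m + 1) div 2)"
          and h = "\<lambda>a. 2 * (len x + a - 2 * int N)"])
      fix a m S
      show "(left_factor N (a, m, S) x)\<^sup>2 \<le> 1 / (real N)\<^sup>2"
        by (simp add: left_factor_def power_divide)
      assume "(left_factor N (a, m, S) x)\<^sup>2 \<noteq> 0"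
      then have "S \<subseteq> near x (len x - (m + 1) div 2)" "len x - (m + 1) div 2 + a \<in> window N"
        by (auto simp: left_factor_def split: if_splits)
      moreover from this(2) have "2 * (len x + a - 2 * int N) < m \<and> m \<le> 2 * (len x + a - 2 * int N) + 2 * int N"
        unfolding window_def atLeastLessThan_iff by presburger
      ultimately show "S \<subseteq> near x (len x - (m + 1) div 2) \<and> 2 * (len x + a - 2 * int N) < m \<and>
          m \<le> 2 * (len x + a - 2 * int N) + 2 * int N"
        by blast
    qed (use XY that in \<open>auto simp: U_def finite_near intro!: card_near\<close>)
    finally show ?thesis .
  qed
  have right: "(\<Sum>s\<in>?\<Omega>. (right_factor N s y)\<^sup>2) \<le> 8 * 2 ^ near_bound" if "y \<in> Y" for y
  proof -
    have "(\<Sum>s\<in>?\<Omega>. (right_factor N s y)\<^sup>2)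
        = (\<Sum>a\<in>?A. \<Sum>m\<in>{- int J..int J}. \<Sum>S\<in>Pow U. (right_factor N (a, m, S) y)\<^sup>2)"
      by (simp add: sum.cartesian_product)
    also have "\<dots> \<le> 8 * 2 ^ near_bound"
    \<comment> \<open>Here the window confines \<open>m div 2\<close>, with rounding in the other
      direction, so the range of \<open>m\<close> is shifted by one.\<close>
    proof (rule sum_window_le[OF _ _ _ N card, where T = "\<lambda>m. near y (len y - m div 2)"
          and h = "\<lambda>a. 2 * (len y - a - 2 * int N) + 1"])
      fix a m S
      show "(right_factor N (a, m, S) y)\<^sup>2 \<le> 1 / (real N)\<^sup>2"
        by (simp add: right_factor_def power_divide flip: power_mult)
      assume "(right_factor N (a, m, S) y)\<^sup>2 \<noteq> 0"
      then have "S \<subseteq> near y (len y - m div 2)" "len y - m div 2 - a \<in> window N"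
        by (auto simp: right_factor_def split: if_splits)
      moreover from this(2) have "2 * (len y - a - 2 * int N) + 1 < m \<and> m \<le> 2 * (len y - a - 2 * int N) + 1 + 2 * int N"
        unfolding window_def atLeastLessThan_iff by presburger
      ultimately show "S \<subseteq> near y (len y - m div 2) \<and> 2 * (len y - a - 2 * int N) + 1 < m \<and>
          m \<le> 2 * (len y - a - 2 * int N) + 1 + 2 * int N"
        by blast
    qed (use XY that in \<open>auto simp: U_def finite_near intro!: card_near\<close>)
    finally show ?thesis .
  qed
  show "\<exists>\<Omega>. finite \<Omega> \<and> (\<forall>x\<in>X. \<forall>y\<in>Y. plateau N (inv x \<otimes> y) = (\<Sum>s\<in>\<Omega>. left_factor N s x * right_factor N s y)) \<and>
      (\<forall>x\<in>X. (\<Sum>s\<in>\<Omega>. (left_factor N s x)\<^sup>2) \<le> 8 * 2 ^ near_bound) \<and>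
      (\<forall>y\<in>Y. (\<Sum>s\<in>\<Omega>. (right_factor N s y)\<^sup>2) \<le> 8 * 2 ^ near_bound)"
    by (intro exI[of _ ?\<Omega>] conjI ballI fact left right) (simp_all add: U_def)
qed simp

lemma revesz_hyperbolic: "revesz_property G"
proof (rule revesz_criterion[OF rapid_decay_hyperbolic, where V = "\<lambda>i. plateau (2 ^ i)" and I = UNIV])
  show "\<forall>m0 :: nat. \<exists>m\<ge>m0. m \<le> 2 * card {i \<in> UNIV. m \<le> i \<and> i < 4 * m}"
  proof
    fix m :: nat
    have "{i \<in> UNIV. m \<le> i \<and> i < 4 * m} = {m..<4 * m}"
      by auto
    then show "\<exists>m'\<ge>m. m' \<le> 2 * card {i \<in> UNIV. m' \<le> i \<and> i < 4 * m'}"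
      by (intro exI[of _ m]) simp
  qed
  show "conv_bound (\<lambda>g. of_real (plateau (2 ^ i) g) * c g) (8 * 2 ^ near_bound * K)" if "conv_bound c K" for i c K
    using that by (rule conv_bound_plateau) simp
  show "plateau (2 ^ i) g = 1" if "L g \<le> 2 ^ i" for i g
    using that by (intro plateau_eq_1) auto
  show "plateau (2 ^ i) g = 0" if "2 ^ (i + 2) < L g" for i g
    using that by (intro plateau_eq_0) simp
qed (auto simp: plateau_bounds)

end

theorem revesz_hyperbolic_group:
  fixes G (structure)
  assumes "group G" "hyperbolic_group G"
  shows "revesz_property G"
proof -
  obtain S \<delta> where S: "finite S" "symmetric_generating_set G S"
    and hyp: "\<And>w x y z. w \<in> carrier G \<Longrightarrow> x \<in> carrier G \<Longrightarrow> y \<in> carrier G \<Longrightarrow> z \<in> carrier G \<Longrightarrow>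
      gromov_product G S w x z \<ge> min (gromov_product G S w x y) (gromov_product G S w y z) - \<delta>"
    using assms(2) unfolding hyperbolic_group_def by blast
  interpret word_group G S
    by (intro word_group.intro word_group_axioms.intro assms S)
  have gp: "gromov_product G S \<one> x y = (real (wl x) + real (wl y) - real (wl (inv x \<otimes> y))) / 2"
    if "x \<in> carrier G" "y \<in> carrier G" for x y
    using that by (simp add: gromov_product_def word_dist_def L_inv)
  have halve: "min a b - n \<le> c" if "min (a / 2) (b / 2) - \<delta> \<le> c / 2" "2 * \<delta> \<le> n" for a b c n :: real
    using that unfolding min_def by (cases "a \<le> b"; simp; linarith)
  \<comment> \<open>Clearing the halves in the Gromov products doubles the constant.\<close>
  interpret hyperbolic_length_group G wl "nat \<lceil>2 * \<delta>\<rceil>"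
  proof
    show "\<exists>u v. u \<in> carrier G \<and> v \<in> carrier G \<and> g = u \<otimes> v \<and> wl u = j \<and> wl v = wl g - j"
      if "g \<in> carrier G" "j \<le> wl g" for g j
      using that by (rule wl_split)
    fix x y z assume xyz: "x \<in> carrier G" "y \<in> carrier G" "z \<in> carrier G"
    have "min (real (wl x) + real (wl y) - real (wl (inv x \<otimes> y))) (real (wl y) + real (wl z) - real (wl (inv y \<otimes> z)))
        - real (nat \<lceil>2 * \<delta>\<rceil>) \<le> real (wl x) + real (wl z) - real (wl (inv x \<otimes> z))"
      by (rule halve[OF hyp[OF one_closed xyz, unfolded gp[OF xyz(1,2)] gp[OF xyz(2,3)] gp[OF xyz(1,3)]] real_nat_ceiling_ge])
    then have "real_of_int (min (int (wl x) + int (wl y) - int (wl (inv x \<otimes> y))) (int (wl y) + int (wl z) - int (wl (inv y \<otimes> z)))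
        - int (nat \<lceil>2 * \<delta>\<rceil>)) \<le> real_of_int (int (wl x) + int (wl z) - int (wl (inv x \<otimes> z)))"
      by (simp only: of_int_min of_int_diff of_int_add of_int_of_nat_eq)
    then show "min (int (wl x) + int (wl y) - int (wl (inv x \<otimes> y))) (int (wl y) + int (wl z) - int (wl (inv y \<otimes> z)))
        - int (nat \<lceil>2 * \<delta>\<rceil>) \<le> int (wl x) + int (wl z) - int (wl (inv x \<otimes> z))"
      by (simp only: of_int_le_iff)
  qed
  show ?thesis
    by (rule revesz_hyperbolic)
qed

section \<open>Free groups\<close>

text \<open>The length of the longest common prefix: on reduced words, the Gromov product at the
  identity in the Cayley tree.\<close>

fun lcp :: "'x list \<Rightarrow> 'x list \<Rightarrow> nat" where
  "lcp (a # x) (b # y) = (if a = b then Suc (lcp x y) else 0)"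
| "lcp _ _ = 0"

lemma lcp_ultrametric: "min (lcp x y) (lcp y z) \<le> lcp x z"
proof (induction x y arbitrary: z rule: lcp.induct)
  case (1 a x b y)
  then show ?case
    by (cases z) auto
qed auto

text \<open>Multiplying by the inverse of \<open>x\<close> removes the letters of \<open>x\<close>
  from the front of \<open>v\<close> as long as they agree, and from the first disagreement on every
  further letter lengthens the word.\<close>

lemma length_cancel_inverse:
  "reduced_word x \<Longrightarrow> reduced_word v \<Longrightarrow>
    length (foldr cancel_cons (rev (map inv_letter x)) v) + 2 * lcp x v = length x + length v"
proof (induction x arbitrary: v)
  case (Cons a x)
  have x: "reduced_word x"
    using Cons.prems(1) by (rule reduced_word_tl)
  \<comment> \<open>Since \<open>a # x\<close> is reduced, \<open>x\<close> does not begin with the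
    inverse of \<open>a\<close>; so cancellation does not resume once it has stopped.\<close>
  have lcp0: "lcp x (inv_letter a # u) = 0" for u
    using Cons.prems(1) by (cases x) auto
  show ?case
  proof (cases "\<exists>u. v = a # u")
    case True
    then obtain u where u: "v = a # u"
      by blast
    then have "reduced_word u"
      using Cons.prems(2) reduced_word_tl by blast
    then show ?thesis
      using Cons.IH[OF x, of u] u by simp
  next
    case False
    then have "cancel_cons (inv_letter a) v = inv_letter a # v" "reduced_word (inv_letter a # v)" "lcp (a # x) v = 0"
      using Cons.prems(2) by (cases v; auto)+
    then show ?thesis
      using Cons.IH[OF x, of "inv_letter a # v"] lcp0[of v] by simp
  qed
qed simp

definition free_generators :: "('x \<times> bool) list set" where
  "free_generators = range (\<lambda>l. [l])"

lemma inv_free_group: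
  assumes "x \<in> carrier (free_group :: ('x \<times> bool) list monoid)"
  shows "inv\<^bsub>free_group\<^esub> x = foldr cancel_cons (rev (map inv_letter x)) []"
proof -
  interpret group "free_group :: ('x \<times> bool) list monoid"
    by (rule group_free_group)
  show ?thesis
  proof (rule inv_equality)
    show "foldr cancel_cons (rev (map inv_letter x)) [] \<otimes>\<^bsub>free_group\<^esub> x = \<one>\<^bsub>free_group\<^esub>"
      using foldr_cancel_inverse[of "[]" x] assms
      by (simp add: free_group_def foldr_cancel_assoc foldr_cancel_Nil)
  qed (use assms in \<open>auto simp: free_group_def reduced_foldr_cancel\<close>)
qed

lemma inv_mult_free_group:
  assumes "x \<in> carrier free_group" "y \<in> carrier free_group"
  shows "inv\<^bsub>free_group\<^esub> x \<otimes>\<^bsub>free_group\<^esub> y = foldr cancel_cons (rev (map inv_letter x)) y"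
  unfolding inv_free_group[OF assms(1)] using assms by (simp add: free_group_def foldr_cancel_assoc)

lemma foldr_free_generators:
  assumes "reduced_word w"
  shows "foldr (\<otimes>\<^bsub>free_group\<^esub>) (map (\<lambda>l. [l]) w) \<one>\<^bsub>free_group\<^esub> = w"
proof -
  have "foldr (\<otimes>\<^bsub>free_group\<^esub>) (map (\<lambda>l. [l]) w) \<one>\<^bsub>free_group\<^esub> = foldr cancel_cons w []"
    by (induction w) (simp_all add: free_group_def)
  then show ?thesis
    using assms by (simp add: foldr_cancel_Nil)
qed

lemma symmetric_free_generators:
  "symmetric_generating_set free_group (free_generators :: ('x \<times> bool) list set)"
proof -
  interpret group "free_group :: ('x \<times> bool) list monoid"
    by (rule group_free_group)
  have sub: "(free_generators :: ('x \<times> bool) list set) \<subseteq> carrier free_group"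
    by (auto simp: free_generators_def free_group_def)
  have "w \<in> generate free_group free_generators" if "reduced_word w" for w :: "('x \<times> bool) list"
    using that
  proof (induction w)
    case Nil
    then show ?case
      using generate.one[of free_group] by (simp add: free_group_def)
  next
    case (Cons l w)
    have "reduced_word w"
      using Cons.prems by (rule reduced_word_tl)
    moreover have "[l] \<otimes>\<^bsub>free_group\<^esub> w = l # w"
      using Cons.prems by (cases w) (auto simp: free_group_def)
    moreover have "[l] \<in> generate free_group free_generators"
      by (intro generate.incl) (auto simp: free_generators_def)
    ultimately show ?case
      using Cons.IH generate.eng[of "[l]" free_group free_generators w] by simp
  qed
  then have "carrier free_group \<subseteq> generate free_group (free_generators :: ('x \<times> bool) list set)"
    by (simp add: free_group_def subset_iff)
  moreover have "generate free_group (free_generators :: ('x \<times> bool) list set) \<subseteq> carrier free_group"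
    by (intro subsetI generate_in_carrier[OF sub])
  moreover have "inv\<^bsub>free_group\<^esub> s \<in> free_generators" if "s \<in> (free_generators :: ('x \<times> bool) list set)" for s
    using that sub inv_free_group[of s] by (auto simp: free_generators_def)
  ultimately show ?thesis
    using sub by (simp add: symmetric_generating_set_def)
qed

lemma word_length_free_group:
  fixes w :: "('x \<times> bool) list"
  assumes "reduced_word w"
  shows "word_length free_group free_generators w = length w"
  unfolding word_length_def
proof (rule Least_equality)
  show "w \<in> word_ball free_group free_generators (length w)"
    unfolding word_ball_def using foldr_free_generators[OF assms]
    by (intro CollectI exI[of _ "map (\<lambda>l. [l]) w"]) (auto simp: free_generators_def)
  fix n assume "w \<in> word_ball free_group free_generators n"
  then obtain ws where ws: "set ws \<subseteq> free_generators" "length ws \<le> n" "w = foldr (\<otimes>\<^bsub>free_group\<^esub>) ws \<one>\<^bsub>free_group\<^esub>"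
    by (auto simp: word_ball_def)
  have cancel: "length (cancel_cons l v) \<le> Suc (length v)" for l :: "'x \<times> bool" and v
    by (cases v) auto
  have "length (foldr (\<otimes>\<^bsub>free_group\<^esub>) ws \<one>\<^bsub>free_group\<^esub>) \<le> length ws"
    using ws(1)
  proof (induction ws)
    case (Cons u ws)
    then obtain l where u: "u = [l]"
      by (auto simp: free_generators_def)
    have "foldr (\<otimes>\<^bsub>free_group\<^esub>) (u # ws) \<one>\<^bsub>free_group\<^esub> = cancel_cons l (foldr (\<otimes>\<^bsub>free_group\<^esub>) ws \<one>\<^bsub>free_group\<^esub>)"
      by (simp add: u free_group_def)
    then show ?case
      using Cons cancel[of l "foldr (\<otimes>\<^bsub>free_group\<^esub>) ws \<one>\<^bsub>free_group\<^esub>"] by auto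
  qed (simp add: free_group_def)
  then show "length w \<le> n"
    using ws by simp
qed

text \<open>The constant is zero: after translating the base point to the identity, the Gromov
  product is \<open>lcp\<close>, which is ultrametric.\<close>

lemma hyperbolic_free_group: "hyperbolic_group (free_group :: ('x :: finite \<times> bool) list monoid)"
proof -
  interpret group "free_group :: ('x \<times> bool) list monoid"
    by (rule group_free_group)
  let ?G = "free_group :: ('x \<times> bool) list monoid" and ?S = "free_generators :: ('x \<times> bool) list set"
  have len: "word_length ?G ?S g = length g" if "g \<in> carrier ?G" for g
    using that by (intro word_length_free_group) (simp add: free_group_def)
  have inv_len: "length (inv\<^bsub>?G\<^esub> x \<otimes>\<^bsub>?G\<^esub> y) + 2 * lcp x y = length x + length y"
    if "x \<in> carrier ?G" "y \<in> carrier ?G" for x y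
    using that length_cancel_inverse[of x y] by (simp add: inv_mult_free_group) (simp add: free_group_def)
  have gp: "gromov_product ?G ?S w x y = real (lcp (inv\<^bsub>?G\<^esub> w \<otimes>\<^bsub>?G\<^esub> x) (inv\<^bsub>?G\<^esub> w \<otimes>\<^bsub>?G\<^esub> y))"
    if w: "w \<in> carrier ?G" and x: "x \<in> carrier ?G" and y: "y \<in> carrier ?G" for w x y
  proof -
    let ?x = "inv\<^bsub>?G\<^esub> w \<otimes>\<^bsub>?G\<^esub> x" and ?y = "inv\<^bsub>?G\<^esub> w \<otimes>\<^bsub>?G\<^esub> y"
    have car: "?x \<in> carrier ?G" "?y \<in> carrier ?G"
      using w x y by auto
    have sym: "length (inv\<^bsub>?G\<^esub> u \<otimes>\<^bsub>?G\<^esub> w) = length (inv\<^bsub>?G\<^esub> w \<otimes>\<^bsub>?G\<^esub> u)" if "u \<in> carrier ?G" for u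
    proof -
      have "lcp u w = lcp w u"
        by (induction u w rule: lcp.induct) auto
      then show ?thesis
        using inv_len[OF that w] inv_len[OF w that] by simp
    qed
    have "inv\<^bsub>?G\<^esub> ?x \<otimes>\<^bsub>?G\<^esub> ?y = inv\<^bsub>?G\<^esub> x \<otimes>\<^bsub>?G\<^esub> y"
      using w x y by (simp add: inv_mult_group m_assoc) (simp flip: m_assoc)
    then have "length (inv\<^bsub>?G\<^esub> x \<otimes>\<^bsub>?G\<^esub> y) + 2 * lcp ?x ?y = length ?x + length ?y"
      using inv_len[OF car] by simp
    then have "real (length (inv\<^bsub>?G\<^esub> x \<otimes>\<^bsub>?G\<^esub> y)) + 2 * real (lcp ?x ?y) = real (length ?x) + real (length ?y)"
      by linarith
    then show ?thesis
      using w x y sym[OF x] sym[OF y] by (simp add: gromov_product_def word_dist_def len)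
  qed
  have "min (gromov_product ?G ?S w x y) (gromov_product ?G ?S w y z) - 0 \<le> gromov_product ?G ?S w x z"
    if "w \<in> carrier ?G" "x \<in> carrier ?G" "y \<in> carrier ?G" "z \<in> carrier ?G" for w x y z
    using lcp_ultrametric[of "inv\<^bsub>?G\<^esub> w \<otimes>\<^bsub>?G\<^esub> x" "inv\<^bsub>?G\<^esub> w \<otimes>\<^bsub>?G\<^esub> y" "inv\<^bsub>?G\<^esub> w \<otimes>\<^bsub>?G\<^esub> z"]
    by (simp add: gp that flip: of_nat_min)
  moreover have "finite ?S"
    by (simp add: free_generators_def)
  ultimately show ?thesis
    unfolding hyperbolic_group_def using symmetric_free_generators
    by (intro exI[of _ ?S] conjI exI[of _ 0] ballI) auto
qed

theorem corollary1p5: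
  "(\<forall>G :: ('a, 'b) monoid_scheme.
      group G \<and> finitely_generated G \<and> hyperbolic_group G \<longrightarrow> revesz_property G) \<and>
   (\<forall>G :: ('a, 'b) monoid_scheme.
      group G \<and> finitely_generated G \<and> polynomial_growth G \<longrightarrow> revesz_property G) \<and>
   revesz_property F2"
  by (intro conjI allI impI revesz_hyperbolic_group[OF group_free_group hyperbolic_free_group])
    (elim conjE, (erule (1) revesz_hyperbolic_group revesz_polynomial_growth_group))+

end
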